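(* Let $q,z,a,b,c,h$ be non-zero complex numbers with $|q|<1$, $|z|<1$, $h,\,h\frac c{bz}\notin\{q^k:k\in\mathbb Z\}$, and assume there are no vanishing denominator factors. Then $${}_2\phi_1(a,b;c;q,z)\;{}_2\phi_1\!\left(a,\tfrac{qa}c;\tfrac{qa}b;q,z\right)=\frac1{\vartheta(h,h\frac c{bz};q)}\Big(U_1+U_2+V_{1}+V_{-1}+W_{1}+W_{-1}\Big),$$ where $$U_1=\frac{\vartheta(ha,h\frac c{abz};q)(\frac qb,\frac ca,\frac cb,\frac cb;q)_\infty}{(c,\frac c{ab},\frac c{ab},\frac{qa}b;q)_\infty}\,{}_6\phi_5\!\left(a,b,\tfrac{qa}c,\tfrac{qb}c,\tfrac{abz}c,\tfrac qz;\tfrac{qab}c,\pm\sqrt{\tfrac{qab}c},\pm q\sqrt{\tfrac{ab}c};q,q\right),$$ $$U_2=\frac{\vartheta(h\frac cb,\frac hz;q)(a,a,b,\frac{qa}c,\frac{abz}c,\frac{abz}c;q)_\infty}{(z,z,c,\frac{qa}b,\frac{ab}c,\frac{ab}c;q)_\infty}\,{}_6\phi_5\!\left(\tfrac qa,\tfrac qb,\tfrac ca,\tfrac cb,z,\tfrac{qc}{abz};\tfrac{qc}{ab},\pm\sqrt{\tfrac{qc}{ab}},\pm q\sqrt{\tfrac c{ab}};q,q\right),$$ and for $\epsilon\in\{1,-1\}$ $$V_\epsilon=\frac{\vartheta(\epsilon h\sqrt{\frac{ac}b},\frac{\epsilon h}z\sqrt{\frac c{ab}},\epsilon\sqrt{\frac{bc}a};q)(a,\frac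 cb,\frac{abz}c;q)_\infty}{(-1,\pm\sqrt q,z,c,\frac{qa}b,\epsilon\sqrt{\frac c{ab}},\epsilon\sqrt{\frac{ab}c};q)_\infty}$$ $$\qquad\times{}_6\phi_5\!\left(\epsilon\sqrt{\tfrac{ac}b},\epsilon\sqrt{\tfrac{bc}a},\epsilon q\sqrt{\tfrac a{bc}},\epsilon q\sqrt{\tfrac b{ac}},\epsilon z\sqrt{\tfrac{ab}c},\tfrac{\epsilon q}z\sqrt{\tfrac c{ab}};-q,\pm\sqrt q,\epsilon q\sqrt{\tfrac{ab}c},\epsilon q\sqrt{\tfrac c{ab}};q,q\right),$$ $$W_\epsilon=\frac{\vartheta(\epsilon h\sqrt{\frac{qac}b},\frac{\epsilon h}z\sqrt{\frac c{qab}};q)(a,\frac cb,\frac{abz}c,\epsilon\sqrt{\frac{ac}{qb}},\epsilon\sqrt{\frac{bc}{qa}},\epsilon\sqrt{\frac{qa}{bc}},\epsilon z\sqrt{\frac{ab}{qc}};q)_\infty}{(-1,\pm\frac1{\sqrt q},z,c,\frac{qa}b,\epsilon\sqrt{\frac{qac}b},\epsilon\sqrt{\frac c{qab}},\epsilon\sqrt{\frac{ab}{qc}},\epsilon z\sqrt{\frac{qab}c};q)_\infty}$$ $$\qquad\times{}_6\phi_5\!\left(\epsilon\sqrt{\tfrac{qac}b},\epsilon\sqrt{\tfrac{qbc}a},\epsilon\sqrt{\tfrac{q^3a}{bc}},\epsilon\sqrt{\tfrac{q^3b}{ac}},\epsilon z\sqrt{\tfrac{qab}c},\tfrac\epsilon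 z\sqrt{\tfrac{q^3c}{ab}};-q,\pm q^{3/2},\epsilon\sqrt{\tfrac{q^3ab}c},\epsilon\sqrt{\tfrac{q^3c}{ab}};q,q\right).$$
   Context: Notation. $(a;q)_k=\prod_{j=0}^{k-1}(1-aq^j)$, $(a;q)_\infty=\prod_{j\ge0}(1-aq^j)$, $(a_1,\dots,a_r;q)_k=\prod_j(a_j;q)_k$ for $k\in\mathbb N_0\cup\{\infty\}$. In a list, $\pm x$ stands for the two entries $x,-x$. $\vartheta(x;q)=(x,q/x;q)_\infty$ for $x\ne0$, $\vartheta(x_1,\dots,x_k;q)=\prod_j\vartheta(x_j;q)$. ${}_{r+1}\phi_r(a_1,\dots,a_{r+1};b_1,\dots,b_r;q,z)=\sum_{k\ge0}\frac{(a_1,\dots,a_{r+1};q)_k}{(q,b_1,\dots,b_r;q)_k}z^k$ for $|z|<1$. Square roots are chosen consistently: fix square roots of $q,a,b,c$ and define all half-integer powers of monomials multiplicatively from these. Convention "no vanishing denominator factors": every infinite $q$-shifted factorial and every theta function appearing in a denominator is non-zero, and no denominator parameter of any series lies in $\{q^{-k}:k\in\mathbb N_0\}$. *)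

theory Defs
  imports "HOL-Analysis.Analysis"
begin

definition qpoch :: "complex \<Rightarrow> complex \<Rightarrow> nat \<Rightarrow> complex" where
  "qpoch a q k = (\<Prod>j<k. 1 - a * q ^ j)"

definition qpoch_inf :: "complex \<Rightarrow> complex \<Rightarrow> complex" where
  "qpoch_inf a q = (\<Prod>j. 1 - a * q ^ j)"

definition qpochs :: "complex list \<Rightarrow> complex \<Rightarrow> nat \<Rightarrow> complex" where
  "qpochs as q k = (\<Prod>a\<leftarrow>as. qpoch a q k)"

definition qpochs_inf :: "complex list \<Rightarrow> complex \<Rightarrow> complex" where
  "qpochs_inf as q = (\<Prod>a\<leftarrow>as. qpoch_inf a q)"

definition qtheta :: "complex \<Rightarrow> complex \<Rightarrow> complex" where
  "qtheta x q = qpochs_inf [x, q / x] q"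

definition qthetas :: "complex list \<Rightarrow> complex \<Rightarrow> complex" where
  "qthetas xs q = (\<Prod>x\<leftarrow>xs. qtheta x q)"

(* The series r+1_phi_r: only meant for length as = length bs + 1.  For other lengths the
   usual definition of a basic hypergeometric series has an additional factor. *)
definition qphi :: "complex list \<Rightarrow> complex list \<Rightarrow> complex \<Rightarrow> complex \<Rightarrow> complex" where
  "qphi as bs q z = (\<Sum>k. qpochs as q k / qpochs (q # bs) q k * z ^ k)"

definition admissible_den :: "complex list \<Rightarrow> complex \<Rightarrow> bool" where
  "admissible_den bs q \<longleftrightarrow> (\<forall>b \<in> set bs. \<forall>k::nat. b \<noteq> q powi (- int k))"

(* Below, rq, ra, rb, rc are the fixed square roots of q, a, b, c; the square root of a monomial
   in q, a, b, c is the corresponding monomial in rq, ra, rb, rc. *)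

definition U1 ::
  "complex \<Rightarrow> complex \<Rightarrow> complex \<Rightarrow> complex \<Rightarrow> complex \<Rightarrow> complex \<Rightarrow>
   complex \<Rightarrow> complex \<Rightarrow> complex \<Rightarrow> complex \<Rightarrow> complex" where
  "U1 q z a b c h rq ra rb rc =
     qthetas [h * a, h * (c / (a * b * z))] q
     * qpochs_inf [q / b, c / a, c / b, c / b] q
     / qpochs_inf [c, c / (a * b), c / (a * b), q * a / b] q
     * qphi [a, b, q * a / c, q * b / c, a * b * z / c, q / z]
            [q * a * b / c,
             rq * ra * rb / rc, - (rq * ra * rb / rc),
             q * (ra * rb / rc), - (q * (ra * rb / rc))] q q"

definition U2 ::
  "complex \<Rightarrow> complex \<Rightarrow> complex \<Rightarrow> complex \<Rightarrow> complex \<Rightarrow> complex \<Rightarrow>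
   complex \<Rightarrow> complex \<Rightarrow> complex \<Rightarrow> complex \<Rightarrow> complex" where
  "U2 q z a b c h rq ra rb rc =
     qthetas [h * (c / b), h / z] q
     * qpochs_inf [a, a, b, q * a / c, a * b * z / c, a * b * z / c] q
     / qpochs_inf [z, z, c, q * a / b, a * b / c, a * b / c] q
     * qphi [q / a, q / b, c / a, c / b, z, q * c / (a * b * z)]
            [q * c / (a * b),
             rq * rc / (ra * rb), - (rq * rc / (ra * rb)),
             q * (rc / (ra * rb)), - (q * (rc / (ra * rb)))] q q"

definition V ::
  "complex \<Rightarrow> complex \<Rightarrow> complex \<Rightarrow> complex \<Rightarrow> complex \<Rightarrow> complex \<Rightarrow> complex \<Rightarrow>
   complex \<Rightarrow> complex \<Rightarrow> complex \<Rightarrow> complex \<Rightarrow> complex" where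
  "V \<epsilon> q z a b c h rq ra rb rc =
     qthetas [\<epsilon> * h * (ra * rc / rb), \<epsilon> * h / z * (rc / (ra * rb)), \<epsilon> * (rb * rc / ra)] q
     * qpochs_inf [a, c / b, a * b * z / c] q
     / qpochs_inf [-1, rq, - rq, z, c, q * a / b,
                   \<epsilon> * (rc / (ra * rb)), \<epsilon> * (ra * rb / rc)] q
     * qphi [\<epsilon> * (ra * rc / rb), \<epsilon> * (rb * rc / ra),
             \<epsilon> * q * (ra / (rb * rc)), \<epsilon> * q * (rb / (ra * rc)),
             \<epsilon> * z * (ra * rb / rc), \<epsilon> * q / z * (rc / (ra * rb))]
            [- q, rq, - rq, \<epsilon> * q * (ra * rb / rc), \<epsilon> * q * (rc / (ra * rb))] q q"

definition W ::
  "complex \<Rightarrow> complex \<Rightarrow> complex \<Rightarrow> complex \<Rightarrow> complex \<Rightarrow> complex \<Rightarrow> complex \<Rightarrow>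
   complex \<Rightarrow> complex \<Rightarrow> complex \<Rightarrow> complex \<Rightarrow> complex" where
  "W \<epsilon> q z a b c h rq ra rb rc =
     qthetas [\<epsilon> * h * (rq * ra * rc / rb), \<epsilon> * h / z * (rc / (rq * ra * rb))] q
     * qpochs_inf [a, c / b, a * b * z / c,
                   \<epsilon> * (ra * rc / (rq * rb)), \<epsilon> * (rb * rc / (rq * ra)),
                   \<epsilon> * (rq * ra / (rb * rc)), \<epsilon> * z * (ra * rb / (rq * rc))] q
     / qpochs_inf [-1, 1 / rq, - (1 / rq), z, c, q * a / b,
                   \<epsilon> * (rq * ra * rc / rb), \<epsilon> * (rc / (rq * ra * rb)),
                   \<epsilon> * (ra * rb / (rq * rc)), \<epsilon> * z * (rq * ra * rb / rc)] q
     * qphi [\<epsilon> * (rq * ra * rc / rb), \<epsilon> * (rq * rb * rc / ra),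
             \<epsilon> * (rq ^ 3 * ra / (rb * rc)), \<epsilon> * (rq ^ 3 * rb / (ra * rc)),
             \<epsilon> * z * (rq * ra * rb / rc), \<epsilon> / z * (rq ^ 3 * rc / (ra * rb))]
            [- q, rq ^ 3, - (rq ^ 3),
             \<epsilon> * (rq ^ 3 * ra * rb / rc), \<epsilon> * (rq ^ 3 * rc / (ra * rb))] q q"

end

theory Submission
  imports Defs "HOL-Complex_Analysis.Complex_Analysis"
begin

text \<open>The obstacle in the first identity is x = 0. The zeros q^m of theta accumulate there, so
  W1 / theta is not given by a convergent power series, and the quotient h may have an essential
  singularity. Each single summand of W1 divided by theta does have a power series at 0, starting at
  x^k; its possible poles approach 0 as k grows. The coefficient identity therefore gives only an
  asymptotic expansion. What makes this enough is the size of theta: on the circles |x| = r|q|^n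
  with |q| < r < 1, which avoid its zeros, it exceeds every power of 1/|x| up to a constant factor.
  This absorbs W2 and the summands of W1 beyond the M-th.

  General position is expressed by absolute values: certain monomials must not have an integral
  power of the norm of a square root of q as their norm. These powers form a group, so finitely many
  conditions exclude all coincidences of poles, and each condition fails only for countably many
  values of a real scaling parameter.\<close>

text \<open>
  Put \<beta> = c/b and x = bz/c, so that z = \<beta>x.  The proof combines two identities.

  First, a formula of Gasper-Rahman type writes the product of the two series, multiplied by
  \<theta>(x) and infinite products, as a combination of two series W1(x) and W2(x).  The difference of
  the two sides (called defect) is holomorphic for 0 < |\<beta>x| < 1 and vanishes at all x = q^m with
  m > 0, so it is \<theta>(x) h(x) with h holomorphic in a punctured disc at 0.  A coefficient identity (Euler's
  transformation and its consequence for products of two series) shows that h is O(|x|^M) for every M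
  on the circles |x| = r|q|^n; the maximum modulus principle then gives h = 0.

  Second, W1(x) and W2(x) are, up to factors, the residue sums over the two pole sequences q^k and
  x q^k of one quotient of infinite products, into which the auxiliary parameter h enters.  The other
  poles form six sequences, and their residue sums are the six terms of the theorem; the square roots
  appear because (\<alpha>u^2; q) with \<alpha> = ac/b splits into (u \<surd>\<alpha>, -u \<surd>\<alpha>, u \<surd>(q\<alpha>), -u \<surd>(q\<alpha>); q).
  The two groups of residue sums agree by a partial fraction identity for truncated products and a
  dominated limit.

  Both identities are proved for parameters in general position; continuity in a and c gives the rest.
\<close>

section \<open>q-shifted factorials\<close>

locale qbase =
  fixes q :: complex
  assumes norm_q: "norm q < 1" and q_nz: "q \<noteq> 0"
begin

lemma qpoch_0 [simp]: "qpoch a q 0 = 1"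
  by (simp add: qpoch_def)

lemma qpoch_Suc: "qpoch a q (Suc n) = qpoch a q n * (1 - a * q ^ n)"
  by (simp add: qpoch_def)

lemma qpoch_Suc_shift: "qpoch a q (Suc n) = (1 - a) * qpoch (a * q) q n"
  unfolding qpoch_def by (subst prod.lessThan_Suc_shift) (simp add: mult_ac)

lemma qpoch_add: "qpoch a q (m + n) = qpoch a q m * qpoch (a * q ^ m) q n"
  by (induction n) (simp_all add: qpoch_Suc power_add mult_ac)

lemma summable_norm_qpow: "summable (\<lambda>n. norm (a * q ^ n))"
  using norm_q by (simp add: norm_mult norm_power summable_mult)

lemma convergent_prod_qpoch: "convergent_prod (\<lambda>n. 1 - a * q ^ n)"
  using summable_norm_qpow[of a]
  by (intro abs_convergent_prod_imp_convergent_prod summable_imp_abs_convergent_prod) simp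

lemma qpoch_inf_has_prod: "(\<lambda>n. 1 - a * q ^ n) has_prod qpoch_inf a q"
  unfolding qpoch_inf_def using convergent_prod_qpoch convergent_prod_has_prod by blast

lemma qpoch_LIMSEQ: "(\<lambda>n. qpoch a q n) \<longlonglongrightarrow> qpoch_inf a q"
  using has_prod_imp_tendsto'[OF qpoch_inf_has_prod] by (simp add: qpoch_def)

lemma qpoch_inf_split: "qpoch_inf a q = qpoch a q n * qpoch_inf (a * q ^ n) q"
proof -
  have "(\<lambda>m. qpoch a q (n + m)) \<longlonglongrightarrow> qpoch_inf a q"
    using LIMSEQ_ignore_initial_segment[OF qpoch_LIMSEQ, of a n] by (simp add: add.commute)
  moreover have "(\<lambda>m. qpoch a q (n + m)) \<longlonglongrightarrow> qpoch a q n * qpoch_inf (a * q ^ n) q"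
    unfolding qpoch_add by (intro tendsto_intros qpoch_LIMSEQ)
  ultimately show ?thesis using LIMSEQ_unique by blast
qed

lemma qpoch_inf_Suc: "qpoch_inf a q = (1 - a) * qpoch_inf (a * q) q"
  using qpoch_inf_split[of a 1] by (simp add: qpoch_Suc)

lemma qpoch_inf_zero [simp]: "qpoch_inf 0 q = 1"
  by (simp add: qpoch_inf_def)

lemma qpoch_inf_eq_0_iff: "qpoch_inf a q = 0 \<longleftrightarrow> (\<exists>n. a * q ^ n = 1)"
proof
  assume "qpoch_inf a q = 0"
  thus "\<exists>n. a * q ^ n = 1"
    using has_prod_0_iff[of "\<lambda>n. 1 - a * q ^ n"] qpoch_inf_has_prod[of a] by auto
next
  assume "\<exists>n. a * q ^ n = 1"
  then obtain n where "a * q ^ n = 1" ..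
  thus "qpoch_inf a q = 0" using qpoch_inf_split[of a "Suc n"] by (simp add: qpoch_Suc)
qed

lemma qpoch_nonzero: "(\<And>n. a * q ^ n \<noteq> 1) \<Longrightarrow> qpoch a q n \<noteq> 0"
  by (auto simp: qpoch_def)

lemma qpoch_inf_nonzero: "(\<And>n. a * q ^ n \<noteq> 1) \<Longrightarrow> qpoch_inf a q \<noteq> 0"
  using qpoch_inf_eq_0_iff by blast

lemma qpoch_eq: "(\<And>n. a * q ^ n \<noteq> 1) \<Longrightarrow> qpoch a q n = qpoch_inf a q / qpoch_inf (a * q ^ n) q"
proof -
  assume *: "\<And>n. a * q ^ n \<noteq> 1"
  have "qpoch_inf a q \<noteq> 0" using * by (rule qpoch_inf_nonzero)
  thus ?thesis using qpoch_inf_split[of a n] by (auto simp: field_simps)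
qed

text \<open>The bound is uniform in \<open>n\<close>, and it does not increase when \<open>a\<close>
  is replaced by \<open>a * q ^ k\<close>. The later majorants rest on these two facts.\<close>

lemma norm_qpoch_le: "norm (qpoch a q n) \<le> exp (norm a / (1 - norm q))"
proof -
  have "norm (qpoch a q n) = (\<Prod>j<n. norm (1 - a * q ^ j))"
    by (simp add: qpoch_def prod_norm)
  also have "\<dots> \<le> (\<Prod>j<n. 1 + norm (a * q ^ j))"
    by (intro prod_mono) (auto intro: order.trans[OF norm_triangle_ineq4])
  also have "\<dots> \<le> exp (\<Sum>j<n. norm (a * q ^ j))"
    by (rule prod_le_exp_sum) auto
  also have "(\<Sum>j<n. norm (a * q ^ j)) \<le> (\<Sum>j. norm (a * q ^ j))"
    by (rule sum_le_suminf) (use summable_norm_qpow in auto)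
  also have "(\<Sum>j. norm (a * q ^ j)) = norm a / (1 - norm q)"
    using norm_q by (simp add: norm_mult norm_power suminf_mult suminf_geometric)
  finally show ?thesis by simp
qed

lemma norm_qpoch_inf_le: "norm (qpoch_inf a q) \<le> exp (norm a / (1 - norm q))"
  by (rule tendsto_upperbound[OF tendsto_norm[OF qpoch_LIMSEQ]])
     (auto simp: norm_qpoch_le intro!: always_eventually)

lemma exp_bound_mono: "norm a \<le> R \<Longrightarrow> exp (norm a / (1 - norm q)) \<le> exp (R / (1 - norm q))"
  using norm_q by (simp add: divide_right_mono)

lemma norm_qpoch_le': "norm a \<le> R \<Longrightarrow> norm (qpoch a q n) \<le> exp (R / (1 - norm q))"
  using norm_qpoch_le[of a n] exp_bound_mono[of a R] by linarith

lemma norm_qpoch_inf_le': "norm a \<le> R \<Longrightarrow> norm (qpoch_inf a q) \<le> exp (R / (1 - norm q))"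
  using norm_qpoch_inf_le[of a] exp_bound_mono[of a R] by linarith

lemma norm_q_power_le_1: "norm (q ^ n) \<le> 1"
  using norm_q by (simp add: norm_power power_le_one)

lemma norm_mult_q_power_le: "norm a \<le> R \<Longrightarrow> norm (a * q ^ n) \<le> R"
  using norm_q_power_le_1[of n] by (simp add: norm_mult)
     (metis mult.right_neutral mult_mono norm_ge_zero norm_power order.trans zero_le_one)

text \<open>The partial products are entire and converge uniformly on closed discs of radius 1,
  because their deviations from 1 are dominated by a geometric series.\<close>

lemma holomorphic_qpoch_UNIV: "(\<lambda>a. qpoch_inf a q) holomorphic_on UNIV"
proof (rule holomorphic_uniform_sequence[where f = "\<lambda>n a. qpoch a q n"])
  show "(\<lambda>a. qpoch a q n) holomorphic_on UNIV" for n
    unfolding qpoch_def by (intro holomorphic_intros)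
  fix x :: complex
  define R where "R = norm x + 1"
  have "uniformly_convergent_on (cball x 1) (\<lambda>N a. \<Prod>n<N. 1 + - a * q ^ n)"
  proof (rule uniformly_convergent_on_prod)
    show "uniformly_convergent_on (cball x 1) (\<lambda>N a. \<Sum>n<N. norm (- a * q ^ n))"
    proof (rule Weierstrass_m_test')
      show "summable (\<lambda>n. R * norm q ^ n)"
        using norm_q by (intro summable_mult) simp
      fix n a assume "a \<in> cball x 1"
      hence "norm a \<le> R" unfolding R_def
        by (metis add.commute add_le_cancel_left diff_add_cancel dist_commute dist_norm mem_cball norm_triangle_sub order_trans)
      thus "norm (norm (- a * q ^ n)) \<le> R * norm q ^ n"
        by (simp add: norm_mult norm_power mult_right_mono)
    qed
  qed (auto intro!: continuous_intros)
  hence "uniformly_convergent_on (cball x 1) (\<lambda>N a. qpoch a q N)"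
    by (simp add: qpoch_def)
  hence "uniform_limit (cball x 1) (\<lambda>N a. qpoch a q N) (\<lambda>a. lim (\<lambda>N. qpoch a q N)) sequentially"
    by (simp add: uniformly_convergent_uniform_limit_iff)
  also have "(\<lambda>a. lim (\<lambda>N. qpoch a q N)) = (\<lambda>a. qpoch_inf a q)"
    using qpoch_LIMSEQ limI by blast
  finally show "\<exists>d>0. cball x d \<subseteq> UNIV \<and> uniform_limit (cball x d) (\<lambda>n a. qpoch a q n) (\<lambda>a. qpoch_inf a q) sequentially"
    by (intro exI[of _ 1]) auto
qed auto

lemma holomorphic_qpoch_inf [holomorphic_intros]:
  "f holomorphic_on S \<Longrightarrow> (\<lambda>x. qpoch_inf (f x) q) holomorphic_on S"
  using holomorphic_on_compose_gen[OF _ holomorphic_qpoch_UNIV, of f S] by (simp add: o_def)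

lemma tendsto_qpoch_inf [tendsto_intros]:
  assumes "(f \<longlongrightarrow> a) F"
  shows "((\<lambda>x. qpoch_inf (f x) q) \<longlongrightarrow> qpoch_inf a q) F"
proof -
  have "isCont (\<lambda>a. qpoch_inf a q) a"
    using holomorphic_on_imp_continuous_on[OF holomorphic_qpoch_UNIV]
    by (simp add: continuous_on_eq_continuous_at)
  from isCont_tendsto_compose[OF this assms] show ?thesis .
qed

lemma holomorphic_qpoch [holomorphic_intros]:
  "f holomorphic_on S \<Longrightarrow> (\<lambda>x. qpoch (f x) q n) holomorphic_on S"
  unfolding qpoch_def by (intro holomorphic_intros)

lemma tendsto_qpoch [tendsto_intros]:
  "(f \<longlongrightarrow> a) F \<Longrightarrow> ((\<lambda>x. qpoch (f x) q n) \<longlongrightarrow> qpoch a q n) F"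
  unfolding qpoch_def by (intro tendsto_intros)

text \<open>Each factor 1 - a / q^j with 1 <= j <= k equals (- a / q^j) (1 - q^j / a). The exponent
  \<open>\<Sum>{..k}\<close> is k (k + 1) / 2, written as a sum to avoid division of natural
  numbers.\<close>

lemma qpoch_reverse:
  assumes "a \<noteq> 0"
  shows "qpoch (a / q ^ k) q k = (- a) ^ k * qpoch (q / a) q k / q ^ (\<Sum>{..k})"
proof (induction k)
  case (Suc k)
  have "qpoch (a / q ^ Suc k) q (Suc k) = (1 - a / q ^ Suc k) * qpoch (a / q ^ k) q k"
    using q_nz by (simp add: qpoch_Suc_shift mult_ac)
  also have "\<dots> = (- a) ^ Suc k * qpoch (q / a) q (Suc k) / q ^ (\<Sum>{..Suc k})"
    using q_nz assms unfolding Suc qpoch_Suc by (simp add: field_simps power_add)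
  finally show ?case .
qed auto

lemma qtheta_eq: "qtheta x q = qpoch_inf x q * qpoch_inf (q / x) q"
  by (simp add: qtheta_def qpochs_inf_def)

lemma qpochs_inf_Nil_Cons: "qpochs_inf [] q = 1" "qpochs_inf (x # xs) q = qpoch_inf x q * qpochs_inf xs q"
  by (simp_all add: qpochs_inf_def)

lemma qthetas_Nil_Cons: "qthetas [] q = 1" "qthetas (x # xs) q = qtheta x q * qthetas xs q"
  by (simp_all add: qthetas_def)

text \<open>One factor leaves (x; q) and one joins (q / x; q); the quotient (1 - 1 / x) / (1 - x) is
  - 1 / x.\<close>

lemma qtheta_shift: "x \<noteq> 0 \<Longrightarrow> qtheta (x * q) q = - qtheta x q / x"
proof -
  assume x: "x \<noteq> 0"
  have *: "qpoch_inf x q = (1 - x) * qpoch_inf (x * q) q"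
          "qpoch_inf (1 / x) q = (1 - 1 / x) * qpoch_inf (q / x) q"
    using qpoch_inf_Suc[of x] qpoch_inf_Suc[of "1 / x"] by simp_all
  have "q / (x * q) = 1 / x" using q_nz by simp
  thus ?thesis unfolding qtheta_eq using x by (simp add: *) (simp add: field_simps)
qed

lemma tendsto_qtheta [tendsto_intros]:
  "(f \<longlongrightarrow> a) F \<Longrightarrow> a \<noteq> 0
      \<Longrightarrow> ((\<lambda>x. qtheta (f x) q) \<longlongrightarrow> qtheta a q) F"
  unfolding qtheta_eq by (intro tendsto_intros)

end

section \<open>Residue sums of quotients of infinite products\<close>

text \<open>The monic polynomials with zeros \<open>b\<close> and \<open>w\<close> have equal
  degree, so their difference \<open>g\<close> has degree below \<open>card Y\<close> and equals its
  interpolation polynomial at the nodes \<open>w\<close>. At a node the second product vanishes, so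
  only the first contributes. The formula is this equality at 0, divided by minus the product of the
  \<open>- w y\<close>.\<close>

lemma lagrange_interpolation_at_0:
  fixes w b :: "'i \<Rightarrow> complex"
  assumes Y: "finite Y" and w0: "\<And>y. y \<in> Y \<Longrightarrow> w y \<noteq> 0" and inj: "inj_on w Y"
  shows "(\<Sum>y\<in>Y. (\<Prod>y'\<in>Y. 1 - b y' / w y) / (\<Prod>y'\<in>Y - {y}. 1 - w y' / w y))
           = 1 - (\<Prod>y\<in>Y. b y) / (\<Prod>y\<in>Y. w y)"
proof (cases "Y = {}")
  case False
  define g :: "complex poly" where "g = (\<Prod>y\<in>Y. [:- b y, 1:]) - (\<Prod>y\<in>Y. [:- w y, 1:])"
  define L :: "'i \<Rightarrow> complex poly" where
    "L = (\<lambda>y. smult (1 / (\<Prod>y'\<in>Y - {y}. w y - w y')) (\<Prod>y'\<in>Y - {y}. [:- w y', 1:]))"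
  define f where "f = (\<Sum>y\<in>Y. smult (poly g (w y)) (L y))"
  have deg_prod: "degree (\<Prod>y\<in>Z. [:- c y, 1::complex:]) = card Z"
      "lead_coeff (\<Prod>y\<in>Z. [:- c y, 1::complex:]) = 1" if "finite Z" for c :: "'i \<Rightarrow> complex" and Z
  proof -
    show "degree (\<Prod>y\<in>Z. [:- c y, 1::complex:]) = card Z"
      by (subst degree_prod_eq_sum_degree) auto
    show "lead_coeff (\<Prod>y\<in>Z. [:- c y, 1::complex:]) = 1"
      by (simp add: lead_coeff_prod)
  qed
  have card: "card Y > 0" using False Y by (simp add: card_gt_0_iff)
  have deg_g: "degree g < card Y"
  proof -
    have "coeff g n = 0" if "n \<ge> card Y" for n
    proof (cases "n = card Y")
      case True
      have "coeff (\<Prod>y\<in>Y. [:- b y, 1:]) (card Y) = 1" "coeff (\<Prod>y\<in>Y. [:- w y, 1:]) (card Y) = 1"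
        using deg_prod[OF Y, of b] deg_prod[OF Y, of w] by simp_all
      thus ?thesis by (simp add: True g_def)
    next
      case False
      with that show ?thesis
        by (simp add: g_def coeff_eq_0 deg_prod(1)[OF Y])
    qed
    with card show ?thesis
      by (metis degree_0 leading_coeff_0_iff not_le_imp_less)
  qed
  have deg_f: "degree f < card Y"
  proof -
    have "degree (smult (poly g (w y)) (L y)) \<le> card Y - 1" if "y \<in> Y" for y
      unfolding L_def using that Y deg_prod(1)[of "Y - {y}" w]
      by (intro order.trans[OF degree_smult_le]) auto
    hence "degree f \<le> card Y - 1"
      unfolding f_def by (intro degree_sum_le Y) auto
    with card show ?thesis by linarith
  qed
  have L: "poly (L y) (w y') = (if y = y' then 1 else 0)" if "y \<in> Y" "y' \<in> Y" for y y'
  proof (cases "y = y'")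
    case True
    have "(\<Prod>y'\<in>Y - {y}. w y - w y') \<noteq> 0"
      using Y inj that by (auto simp: inj_on_def)
    thus ?thesis using True by (simp add: L_def poly_prod)
  next
    case False
    have "(\<Prod>x\<in>Y - {y}. w y' - w x) = 0"
      using Y that False by auto
    thus ?thesis using False by (simp add: L_def poly_prod)
  qed
  have eq: "f = g"
  proof (rule poly_eqI_degree[where A = "w ` Y"])
    fix x assume "x \<in> w ` Y"
    then obtain y' where y': "y' \<in> Y" "x = w y'" by auto
    have "poly f x = (\<Sum>y\<in>Y. poly g (w y) * (if y = y' then 1 else 0))"
      unfolding f_def poly_sum poly_smult y'(2) by (intro sum.cong refl) (simp add: L y')
    also have "\<dots> = (\<Sum>y\<in>Y. if y' = y then poly g (w y) else 0)"
      by (intro sum.cong) auto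
    also have "\<dots> = poly g x" using y' Y by (simp add: sum.delta)
    finally show "poly f x = poly g x" .
  qed (use deg_f deg_g inj in \<open>auto simp: card_image\<close>)
  have gw: "poly g (w y) = (\<Prod>y'\<in>Y. w y - b y')" if "y \<in> Y" for y
    using that Y by (auto simp: g_def poly_prod)
  define W where "W = (\<Prod>y\<in>Y. - w y)"
  have W: "W \<noteq> 0" using w0 Y by (auto simp: W_def)
  have alg: "S = 1 - P / V" if "- V * S = P - V" "V \<noteq> 0" for S P V :: complex
    using that by (simp add: field_simps)
  have trm: "poly (smult (poly g (w y)) (L y)) 0 =
      - W * ((\<Prod>y'\<in>Y. 1 - b y' / w y) / (\<Prod>y'\<in>Y - {y}. 1 - w y' / w y))" if y: "y \<in> Y" for y
  proof -
    have "poly (smult (poly g (w y)) (L y)) 0 =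
        (\<Prod>y'\<in>Y. w y - b y') * (\<Prod>y'\<in>Y - {y}. - w y') / (\<Prod>y'\<in>Y - {y}. w y - w y')"
      by (simp add: gw[OF y] L_def poly_prod)
    also have "(\<Prod>y'\<in>Y. w y - b y') = (\<Prod>y'\<in>Y. w y * (1 - b y' / w y))"
      using w0[OF y] by (intro prod.cong refl) (simp add: field_simps)
    also have "\<dots> = w y ^ card Y * (\<Prod>y'\<in>Y. 1 - b y' / w y)"
      by (simp add: prod.distrib)
    also have "(\<Prod>y'\<in>Y - {y}. w y - w y') = (\<Prod>y'\<in>Y - {y}. w y * (1 - w y' / w y))"
      using w0[OF y] by (intro prod.cong refl) (simp add: field_simps)
    also have "\<dots> = w y ^ (card Y - 1) * (\<Prod>y'\<in>Y - {y}. 1 - w y' / w y)"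
      using y Y by (simp add: prod.distrib)
    also have "w y ^ card Y = w y * w y ^ (card Y - 1)"
      using card by (cases "card Y") auto
    also have "w y * w y ^ (card Y - 1) * (\<Prod>y'\<in>Y. 1 - b y' / w y) * (\<Prod>y'\<in>Y - {y}. - w y') /
         (w y ^ (card Y - 1) * (\<Prod>y'\<in>Y - {y}. 1 - w y' / w y)) =
         (w y * (\<Prod>y'\<in>Y - {y}. - w y')) * ((\<Prod>y'\<in>Y. 1 - b y' / w y) / (\<Prod>y'\<in>Y - {y}. 1 - w y' / w y))"
      using w0[OF y] by simp
    also have "w y * (\<Prod>y'\<in>Y - {y}. - w y') = - W"
      unfolding W_def using prod.remove[OF Y y, of "\<lambda>y. - w y"] by simp
    finally show ?thesis .
  qed
  have "- W * (\<Sum>y\<in>Y. (\<Prod>y'\<in>Y. 1 - b y' / w y) / (\<Prod>y'\<in>Y - {y}. 1 - w y' / w y)) = poly f 0"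
    unfolding f_def poly_sum sum_distrib_left by (intro sum.cong refl) (simp only: trm)
  also have "\<dots> = (\<Prod>y\<in>Y. - b y) - W"
    unfolding eq g_def W_def by (simp add: poly_prod)
  finally have "- W * (\<Sum>y\<in>Y. (\<Prod>y'\<in>Y. 1 - b y' / w y) / (\<Prod>y'\<in>Y - {y}. 1 - w y' / w y)) =
                  (\<Prod>y\<in>Y. - b y) - W" (is "- W * ?S = _") .
  hence "?S = 1 - (\<Prod>y\<in>Y. - b y) / W" using W by (rule alg)
  also have "(\<Prod>y\<in>Y. - b y) / W = (\<Prod>y\<in>Y. b y) / (\<Prod>y\<in>Y. w y)"
    unfolding W_def prod_dividef[symmetric] by simp
  finally show ?thesis .
qed auto

text \<open>Let f(u) be the product of the (1 - a x * u) / (1 - v x * u) and of the (1 - b y / u) /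
  (1 - w y / u). The right-hand side is f(infinity) - f(0), and the left-hand side is the sum of the
  residues of f(u) / u at the poles \<open>w y\<close> and \<open>1 / v x\<close>.\<close>

lemma partial_fractions_two_sided:
  fixes a v :: "'i \<Rightarrow> complex" and b w :: "'j \<Rightarrow> complex"
  assumes fin: "finite X" "finite Y"
    and nz: "\<And>x. x \<in> X \<Longrightarrow> a x \<noteq> 0" "\<And>x. x \<in> X
        \<Longrightarrow> v x \<noteq> 0" "\<And>y. y \<in> Y \<Longrightarrow> w y \<noteq> 0"
    and inj: "inj_on v X" "inj_on w Y"
    and sep: "\<And>x y. x \<in> X \<Longrightarrow> y \<in> Y \<Longrightarrow> v x * w y \<noteq> 1"
  shows "(\<Sum>y\<in>Y. (\<Prod>y'\<in>Y. 1 - b y' / w y) / (\<Prod>y'\<in>Y - {y}. 1 - w y' / w y)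
                   * ((\<Prod>x\<in>X. 1 - a x * w y) / (\<Prod>x\<in>X. 1 - v x * w y)))
       - (\<Sum>x\<in>X. (\<Prod>x'\<in>X. 1 - a x' / v x) / (\<Prod>x'\<in>X - {x}. 1 - v x' / v x)
                   * ((\<Prod>y\<in>Y. 1 - b y * v x) / (\<Prod>y\<in>Y. 1 - w y * v x)))
       = (\<Prod>x\<in>X. a x) / (\<Prod>x\<in>X. v x) - (\<Prod>y\<in>Y. b y) / (\<Prod>y\<in>Y. w y)"
proof -
  \<comment> \<open>As a function of u, f has the zeros \<open>c\<close> and the poles
    \<open>d\<close>. The disjoint union of the index sets brings both kinds of poles under the
    interpolation formula.\<close>
  define c d :: "'i + 'j \<Rightarrow> complex" where
    "c = case_sum (\<lambda>x. 1 / a x) b" and "d = case_sum (\<lambda>x. 1 / v x) w"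
  have c [simp]: "c (Inl x) = 1 / a x" "c (Inr y) = b y" for x y by (simp_all add: c_def)
  have d [simp]: "d (Inl x) = 1 / v x" "d (Inr y) = w y" for x y by (simp_all add: d_def)
  have Plus: "X <+> Y = Inl ` X \<union> Inr ` Y" by auto
  have split: "(\<Prod>z\<in>X <+> Y. f z) = (\<Prod>x\<in>X. f (Inl x)) * (\<Prod>y\<in>Y. f (Inr y))"
      for f :: "'i + 'j \<Rightarrow> complex"
    using fin by (simp add: prod.Plus)
  have splits: "(\<Sum>z\<in>X <+> Y. f z) = (\<Sum>x\<in>X. f (Inl x)) + (\<Sum>y\<in>Y. f (Inr y))" for f :: "'i
      + 'j \<Rightarrow> complex"
    using fin by (simp add: sum.Plus)
  have split1: "(\<Prod>z\<in>X <+> Y - {Inl x}. f z) = (\<Prod>x\<in>X - {x}. f (Inl x)) * (\<Prod>y\<in>Y. f (Inr y))"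
    for f :: "'i + 'j \<Rightarrow> complex" and x
  proof -
    have "X <+> Y - {Inl x} = (X - {x}) <+> Y" by auto
    thus ?thesis using fin by (simp add: prod.Plus)
  qed
  have split2: "(\<Prod>z\<in>X <+> Y - {Inr y}. f z) = (\<Prod>x\<in>X. f (Inl x)) * (\<Prod>y\<in>Y - {y}. f (Inr y))"
    for f :: "'i + 'j \<Rightarrow> complex" and y
  proof -
    have "X <+> Y - {Inr y} = X <+> (Y - {y})" by auto
    thus ?thesis using fin by (simp add: prod.Plus)
  qed
  \<comment> \<open>The value f(infinity). It is the price of writing 1 - a x * u as a multiple of 1
    - (1 / a x) / u, and likewise for \<open>v\<close>.\<close>
  define \<rho> where "\<rho> = (\<Prod>x\<in>X. a x) / (\<Prod>x\<in>X. v x)"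
  have alg1: "r * (PA / (r * Q) * N / (PV / Q * D)) = N / D * (PA / PV)"
    if "Q \<noteq> 0" "r \<noteq> 0" for r Q PA PV N D :: complex
    using that by (simp add: mult_ac)
  have alg2: "- Q * PA * N / (PV * Q * D) = - (PA / PV * (N / D))"
    if "Q \<noteq> 0" for Q PA PV N D :: complex
    using that by simp
  have A0: "(\<Prod>x\<in>X. a x) \<noteq> 0" and V0: "(\<Prod>x\<in>X. v x) \<noteq> 0" using nz fin by auto
  have rho: "\<rho> \<noteq> 0" using A0 V0 by (simp add: \<rho>_def)
  have "inj_on d (X <+> Y)"
  proof (rule inj_onI)
    fix s t assume *: "s \<in> X <+> Y" "t \<in> X <+> Y" "d s = d t"
    have sep': "1 / v x \<noteq> w y" "w y \<noteq> 1 / v x" if "x \<in> X" "y \<in> Y" for x y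
      using sep[OF that] nz(2)[OF that(1)] by (auto simp: field_simps)
    have inj': "x = x'" if "x \<in> X" "x' \<in> X" "1 / v x = 1 / v x'" for x x'
      using inj(1) that nz(2) by (auto simp: inj_on_def)
    show "s = t"
    proof (cases s; cases t)
      fix x x' assume "s = Inl x" "t = Inl x'"
      thus ?thesis using * inj'[of x x'] by auto
    next
      fix y y' assume "s = Inr y" "t = Inr y'"
      thus ?thesis using * inj(2) by (auto simp: inj_on_def)
    qed (use * sep' in auto)
  qed
  moreover have "d z \<noteq> 0" if "z \<in> X <+> Y" for z using that nz by auto
  ultimately have "(\<Sum>z\<in>X <+> Y. (\<Prod>z'\<in>X <+> Y. 1 - c z' / d z) / (\<Prod>z'\<in>X <+> Y - {z}. 1 - d z' / d z))
           = 1 - (\<Prod>z\<in>X <+> Y. c z) / (\<Prod>z\<in>X <+> Y. d z)"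
    using fin by (intro lagrange_interpolation_at_0) auto
  also have "(\<Prod>z\<in>X <+> Y. c z) / (\<Prod>z\<in>X <+> Y. d z) = (\<Prod>y\<in>Y. b y) / (\<Prod>y\<in>Y. w y) / \<rho>"
    using A0 V0 by (simp add: split prod_dividef \<rho>_def)
  finally have main: "\<rho> * (\<Sum>z\<in>X <+> Y. (\<Prod>z'\<in>X <+> Y. 1 - c z' / d z) / (\<Prod>z'\<in>X <+> Y - {z}. 1 - d z' / d z))
      = \<rho> - (\<Prod>y\<in>Y. b y) / (\<Prod>y\<in>Y. w y)"
    using rho by (simp only: right_diff_distrib) simp
  have R: "\<rho> * ((\<Prod>z'\<in>X <+> Y. 1 - c z' / d (Inr y)) / (\<Prod>z'\<in>X <+> Y - {Inr y}. 1 - d z' / d (Inr y)))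
     = (\<Prod>y'\<in>Y. 1 - b y' / w y) / (\<Prod>y'\<in>Y - {y}. 1 - w y' / w y)
                   * ((\<Prod>x\<in>X. 1 - a x * w y) / (\<Prod>x\<in>X. 1 - v x * w y))" if y: "y \<in> Y" for y
  proof -
    have 1: "(\<Prod>x\<in>X. 1 - 1 / a x / w y) = (\<Prod>x\<in>X. 1 - a x * w y) / (\<Prod>x\<in>X. - a x * w y)"
      unfolding prod_dividef[symmetric] using nz y by (intro prod.cong refl) (simp add: field_simps)
    have 2: "(\<Prod>x\<in>X. 1 - 1 / v x / w y) = (\<Prod>x\<in>X. 1 - v x * w y) / (\<Prod>x\<in>X. - v x * w y)"
      unfolding prod_dividef[symmetric] using nz y by (intro prod.cong refl) (simp add: field_simps)
    have 3: "(\<Prod>x\<in>X. - a x * w y) = \<rho> * (\<Prod>x\<in>X. - v x * w y)" "(\<Prod>x\<in>X. - v x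
        * w y) \<noteq> 0" "\<rho> \<noteq> 0"
      unfolding \<rho>_def using A0 V0 nz y fin by (auto simp: prod.distrib mult_ac prod_uminus)
    show ?thesis
      unfolding split split2 c d 1 2 3(1) using 3(2,3) by (rule alg1)
  qed
  have L: "\<rho> * ((\<Prod>z'\<in>X <+> Y. 1 - c z' / d (Inl x)) / (\<Prod>z'\<in>X <+> Y - {Inl x}. 1 - d z' / d (Inl x)))
     = - ((\<Prod>x'\<in>X. 1 - a x' / v x) / (\<Prod>x'\<in>X - {x}. 1 - v x' / v x)
                   * ((\<Prod>y\<in>Y. 1 - b y * v x) / (\<Prod>y\<in>Y. 1 - w y * v x)))" if x: "x \<in> X" for x
  proof -
    have 1: "(\<Prod>x'\<in>X. 1 - v x / a x') = (\<Prod>x'\<in>X. 1 - a x' / v x) * (\<Prod>x'\<in>X. - v x / a x')"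
      unfolding prod.distrib[symmetric] using nz x by (intro prod.cong refl) (simp add: field_simps)
    have 2: "(\<Prod>x'\<in>X - {x}. 1 - v x / v x') = (\<Prod>x'\<in>X - {x}. 1 - v x' / v x)
        * (\<Prod>x'\<in>X - {x}. - v x / v x')"
      unfolding prod.distrib[symmetric] using nz x by (intro prod.cong refl) (simp add: field_simps)
    \<comment> \<open>The index x' = x, missing on the right, contributes the factor -1. This is the
      minus sign in front of the second sum.\<close>
    have 3: "\<rho> * (\<Prod>x'\<in>X. - v x / a x') = - (\<Prod>x'\<in>X - {x}. - v x / v x')"
    proof -
      have "\<rho> * (\<Prod>x'\<in>X. - v x / a x') = (\<Prod>x'\<in>X. - v x / v x')"
        unfolding \<rho>_def prod_dividef using A0 by simp
      also have "\<dots> = - (\<Prod>x'\<in>X - {x}. - v x / v x')"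
        using prod.remove[OF fin(1) x, of "\<lambda>x'. - v x / v x'"] nz x by simp
      finally show ?thesis .
    qed
    have 4: "(\<Prod>x'\<in>X - {x}. - v x / v x') \<noteq> 0" using nz x fin by auto
    have "\<rho> * ((\<Prod>z'\<in>X <+> Y. 1 - c z' / d (Inl x)) / (\<Prod>z'\<in>X <+> Y - {Inl x}. 1 - d z' / d (Inl x)))
        = (\<rho> * (\<Prod>x'\<in>X. - v x / a x')) * (\<Prod>x'\<in>X. 1 - a x' / v x) * (\<Prod>y\<in>Y. 1 - b y * v x) /
          ((\<Prod>x'\<in>X - {x}. 1 - v x' / v x) * (\<Prod>x'\<in>X - {x}. - v x / v x') * (\<Prod>y\<in>Y. 1 - w y * v x))"
      unfolding split split1 by (simp add: 1 2 mult_ac)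
    also have "\<dots> = - ((\<Prod>x'\<in>X. 1 - a x' / v x) / (\<Prod>x'\<in>X - {x}. 1 - v x' / v x)
                   * ((\<Prod>y\<in>Y. 1 - b y * v x) / (\<Prod>y\<in>Y. 1 - w y * v x)))"
      unfolding 3 using 4 by (rule alg2)
    finally show ?thesis .
  qed
  have "(\<Sum>x\<in>X. \<rho> * ((\<Prod>z'\<in>X <+> Y. 1 - c z' / d (Inl x)) / (\<Prod>z'\<in>X <+> Y - {Inl x}. 1 - d z' / d (Inl x))))
      = - (\<Sum>x\<in>X. (\<Prod>x'\<in>X. 1 - a x' / v x) / (\<Prod>x'\<in>X - {x}. 1 - v x' / v x)
                   * ((\<Prod>y\<in>Y. 1 - b y * v x) / (\<Prod>y\<in>Y. 1 - w y * v x)))"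
    unfolding sum_negf[symmetric] by (intro sum.cong refl L)
  moreover have "(\<Sum>y\<in>Y. \<rho>
      * ((\<Prod>z'\<in>X <+> Y. 1 - c z' / d (Inr y)) / (\<Prod>z'\<in>X <+> Y - {Inr y}. 1 - d z' / d (Inr y))))
      = (\<Sum>y\<in>Y. (\<Prod>y'\<in>Y. 1 - b y' / w y) / (\<Prod>y'\<in>Y - {y}. 1 - w y' / w y)
                   * ((\<Prod>x\<in>X. 1 - a x * w y) / (\<Prod>x\<in>X. 1 - v x * w y)))"
    by (intro sum.cong refl R)
  ultimately show ?thesis
    using main unfolding splits distrib_left sum_distrib_left unfolding \<rho>_def by simp
qed

text \<open>The range of summation grows with N and the bound holds only for k < N. The terms are
  therefore set to 0 from k = N on before Tannery's theorem is applied.\<close>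

lemma tannery_partial_sums:
  fixes z :: complex and f :: "nat \<Rightarrow> nat \<Rightarrow> complex"
  assumes z: "norm z < 1" and lim: "\<And>k. (\<lambda>N. f N k) \<longlonglongrightarrow> g k"
    and bd: "\<And>N k. k < N \<Longrightarrow> norm (f N k) \<le> C"
  shows "(\<lambda>N. \<Sum>k<N. z ^ k * f N k) \<longlonglongrightarrow> (\<Sum>k. z ^ k * g k)"
proof -
  define a where "a = (\<lambda>k N. if k < N then z ^ k * f N k else 0)"
  have "(\<lambda>N. suminf (\<lambda>k. a k N)) \<longlonglongrightarrow> (\<Sum>k. z ^ k * g k)"
  proof (rule tannerys_theorem[THEN conjunct2, THEN conjunct2])
    show "(\<lambda>N. a k N) \<longlonglongrightarrow> z ^ k * g k" for k
    proof (rule Lim_transform_eventually)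
      show "(\<lambda>N. z ^ k * f N k) \<longlonglongrightarrow> z ^ k * g k" by (intro tendsto_intros lim)
      show "\<forall>\<^sub>F N in sequentially. z ^ k * f N k = a k N"
        using eventually_gt_at_top[of k] by eventually_elim (simp add: a_def)
    qed
    show "\<forall>\<^sub>F (k, N) in sequentially \<times>\<^sub>F sequentially. norm (a k N) \<le> norm z ^ k * max C 0"
    proof (intro always_eventually allI, clarify)
      fix k N
      show "norm (a k N) \<le> norm z ^ k * max C 0"
      proof (cases "k < N")
        case True
        hence "norm (f N k) \<le> max C 0" using bd[OF True] by simp
        thus ?thesis using True by (simp add: a_def norm_mult norm_power mult_left_mono)
      qed (simp add: a_def)
    qed
    show "summable (\<lambda>k. norm z ^ k * max C 0)" using z by (intro summable_mult2) simp
  qed auto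
  also have "(\<lambda>N. suminf (\<lambda>k. a k N)) = (\<lambda>N. \<Sum>k<N. z ^ k * f N k)"
  proof
    fix N
    have "suminf (\<lambda>k. a k N) = (\<Sum>k<N. a k N)"
      by (rule suminf_finite) (auto simp: a_def)
    thus "suminf (\<lambda>k. a k N) = (\<Sum>k<N. z ^ k * f N k)" by (simp add: a_def)
  qed
  finally show ?thesis .
qed

text \<open>Only the triangle k < N matters: there the lengths N - k and N - 1 - k of the truncated
  factorials are genuine differences.\<close>

definition diag_bounded :: "(nat \<Rightarrow> nat \<Rightarrow> complex) \<Rightarrow> bool" where
  "diag_bounded f \<longleftrightarrow> (\<exists>C. \<forall>N k. k < N \<longrightarrow> norm (f N k) \<le> C)"

lemma diag_boundedI: "(\<And>N k. k < N \<Longrightarrow> norm (f N k) \<le> C) \<Longrightarrow> diag_bounded f"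
  unfolding diag_bounded_def by blast

lemma diag_bounded_mult:
  assumes "diag_bounded f" "diag_bounded g"
  shows "diag_bounded (\<lambda>N k. f N k * g N k)"
proof -
  from assms obtain C D where C: "\<And>N k. k < N \<Longrightarrow> norm (f N k) \<le> C"
      and D: "\<And>N k. k < N \<Longrightarrow> norm (g N k) \<le> D"
    unfolding diag_bounded_def by blast
  have "C \<ge> 0" using order_trans[OF norm_ge_zero C[of 0 1]] by simp
  thus ?thesis by (intro diag_boundedI[of _ "C * D"]) (auto simp: norm_mult intro!: mult_mono C D)
qed

lemma diag_bounded_prod:
  "(\<And>i. i \<in> I \<Longrightarrow> diag_bounded (f i))
      \<Longrightarrow> diag_bounded (\<lambda>N k. \<Prod>i\<in>I. f i N k)"
proof (induction I rule: infinite_finite_induct)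
  case (insert x F)
  thus ?case by (simp add: diag_bounded_mult)
qed (auto intro: diag_boundedI[of _ 1])

section \<open>Truncated residue sums and their limits\<close>

context qbase
begin

text \<open>The reciprocal is (a q^(k+m); q)_inf (a; q)_k / (a; q)_inf. A single denominator thus
  serves every starting point k and every length m.\<close>

lemma inverse_qpoch_bounded:
  assumes "\<And>n. a * q ^ n \<noteq> 1"
  obtains C where "\<And>k m. norm (inverse (qpoch (a * q ^ k) q m)) \<le> C"
proof -
  define C where "C = exp (norm a / (1 - norm q)) * exp (norm a / (1 - norm q)) / norm (qpoch_inf a q)"
  have a0: "qpoch_inf a q \<noteq> 0" by (rule qpoch_inf_nonzero) fact
  have "norm (inverse (qpoch (a * q ^ k) q m)) \<le> C" for k m
  proof -
    have ne: "a * q ^ k * q ^ n \<noteq> 1" for n using assms[of "k + n"] by (simp add: power_add mult_ac)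
    have 1: "qpoch (a * q ^ k) q m = qpoch_inf (a * q ^ k) q / qpoch_inf (a * q ^ (k + m)) q"
      using qpoch_eq[OF ne] by (simp add: power_add mult_ac)
    have 2: "qpoch_inf a q = qpoch a q k * qpoch_inf (a * q ^ k) q" by (rule qpoch_inf_split)
    have "inverse (qpoch (a * q ^ k) q m) = qpoch_inf (a * q ^ (k + m)) q * qpoch a q k / qpoch_inf a q"
      unfolding 1 using a0 by (simp add: 2)
    also have "norm \<dots> \<le> C"
      unfolding C_def norm_mult norm_divide
      by (intro divide_right_mono mult_mono norm_qpoch_le' norm_qpoch_inf_le' norm_mult_q_power_le) auto
    finally show ?thesis .
  qed
  thus thesis by (rule that)
qed

lemma power_q_neq_1: "n > 0 \<Longrightarrow> q ^ n \<noteq> 1"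
proof
  assume "n > 0" "q ^ n = 1"
  hence "norm q ^ n = 1" by (metis norm_one norm_power)
  moreover have "norm q ^ n < 1" using norm_q \<open>n > 0\<close> by (simp add: power_Suc_less_one power_less_one_iff)
  ultimately show False by simp
qed

lemma q_mult_power_neq_1: "q * q ^ n \<noteq> 1"
  using power_q_neq_1[of "Suc n"] by simp

lemma diag_bounded_qpoch:
  "(\<And>N k. norm (a N k) \<le> R) \<Longrightarrow> diag_bounded (\<lambda>N k. qpoch (a N k) q (m N k))"
  by (rule diag_boundedI, rule norm_qpoch_le') auto

lemma diag_bounded_inverse_qpoch:
  assumes "\<And>n. a * q ^ n \<noteq> 1"
  shows "diag_bounded (\<lambda>N k. inverse (qpoch (a * q ^ l N k) q (m N k)))"
proof -
  obtain C where "\<And>k m. norm (inverse (qpoch (a * q ^ k) q m)) \<le> C"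
    using inverse_qpoch_bounded[OF assms] by metis
  thus ?thesis by (intro diag_boundedI)
qed

lemma qpoch_div_power:
  assumes "a \<noteq> 0" "k \<le> N"
  shows "qpoch (a / q ^ k) q N = (- a) ^ k * qpoch (q / a) q k / q ^ (\<Sum>{..k}) * qpoch a q (N - k)"
proof -
  have "qpoch (a / q ^ k) q N = qpoch (a / q ^ k) q (k + (N - k))" using assms by simp
  also have "\<dots> = qpoch (a / q ^ k) q k * qpoch (a / q ^ k * q ^ k) q (N - k)" by (rule qpoch_add)
  also have "a / q ^ k * q ^ k = a" using q_nz by simp
  finally show ?thesis unfolding qpoch_reverse[OF assms(1)] .
qed

text \<open>The contribution of the other poles of the same sequence: those before k give a reversed
  factorial, those after k one of length N - 1 - k, since the pole itself is left out.\<close>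

lemma prod_one_minus_q_ratio:
  assumes "k < N"
  shows "(\<Prod>k'\<in>{..<N} - {k}. 1 - q ^ k' / q ^ k)
           = (- 1) ^ k * qpoch q q k / q ^ (\<Sum>{..k}) * qpoch q q (N - 1 - k)"
proof -
  have "{..<N} - {k} = {..<k} \<union> {Suc k..<N}" using assms by auto
  moreover have "(\<Prod>k'\<in>{..<k} \<union> {Suc k..<N}. 1 - q ^ k' / q ^ k)
      = (\<Prod>k'<k. 1 - q ^ k' / q ^ k) * (\<Prod>k'\<in>{Suc k..<N}. 1 - q ^ k' / q ^ k)"
    by (rule prod.union_disjoint) auto
  ultimately have "(\<Prod>k'\<in>{..<N} - {k}. 1 - q ^ k' / q ^ k)
      = (\<Prod>k'<k. 1 - q ^ k' / q ^ k) * (\<Prod>k'\<in>{Suc k..<N}. 1 - q ^ k' / q ^ k)"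
    by (rule ssubst)
  also have "(\<Prod>k'<k. 1 - q ^ k' / q ^ k) = qpoch (1 / q ^ k) q k"
    by (simp add: qpoch_def)
  also have "\<dots> = (- 1) ^ k * qpoch q q k / q ^ (\<Sum>{..k})"
    using qpoch_reverse[of 1 k] by simp
  also have "(\<Prod>k'\<in>{Suc k..<N}. 1 - q ^ k' / q ^ k) = (\<Prod>j<N - 1 - k. 1 - q * q ^ j)"
  proof (rule prod.reindex_bij_witness[of _ "\<lambda>j. j + Suc k" "\<lambda>j. j - Suc k"])
    fix k' assume "k' \<in> {Suc k..<N}"
    then obtain j where j: "k' = k + Suc j" by (auto simp: le_iff_add)
    show "1 - q * q ^ (k' - Suc k) = 1 - q ^ k' / q ^ k" using q_nz by (simp add: j power_add)
  qed (use assms in auto)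
  finally show ?thesis by (simp add: qpoch_def)
qed

text \<open>
  Let f(u) be the product of the (A i u) and the (B j / u) divided by the product of the (v i u) and
  the (w j / u), with (y) for qpoch_inf y q.  Up to a factor independent of i and k, the residue of
  f(u) du/u at u = 1 / (v i * q ^ k) is residue_coeff times the k-th power of the quotient of
  the product of the A i by that of the v i; residue_coeff_fin is the analogue for factorials of length N.
\<close>

definition residue_coeff ::
  "nat \<Rightarrow> (nat \<Rightarrow> complex) \<Rightarrow> (nat \<Rightarrow> complex)
      \<Rightarrow> nat \<Rightarrow> (nat \<Rightarrow> complex) \<Rightarrow> (nat
      \<Rightarrow> complex) \<Rightarrow> nat \<Rightarrow> nat \<Rightarrow> complex" where
  "residue_coeff r A v s B w i k =
     (\<Prod>i'<r. qpoch (q * v i / A i') q k * qpoch_inf (A i' / v i) q)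
     * (\<Prod>i'\<in>{..<r} - {i}. inverse (qpoch (q * v i / v i') q k) * inverse (qpoch_inf (v i' / v i) q))
     * (inverse (qpoch q q k) * inverse (qpoch_inf q q))
     * (\<Prod>j<s. qpoch_inf (B j * v i * q ^ k) q * inverse (qpoch_inf (w j * v i * q ^ k) q))"

definition residue_coeff_fin ::
  "nat \<Rightarrow> (nat \<Rightarrow> complex) \<Rightarrow> (nat \<Rightarrow> complex)
      \<Rightarrow> nat \<Rightarrow> (nat \<Rightarrow> complex) \<Rightarrow> (nat
      \<Rightarrow> complex) \<Rightarrow> nat \<Rightarrow> nat \<Rightarrow> nat \<Rightarrow> complex" where
  "residue_coeff_fin r A v s B w i N k =
     (\<Prod>i'<r. qpoch (q * v i / A i') q k * qpoch (A i' / v i) q (N - k))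
     * (\<Prod>i'\<in>{..<r} - {i}. inverse (qpoch (q * v i / v i') q k) * inverse (qpoch (v i' / v i) q (N - k)))
     * (inverse (qpoch q q k) * inverse (qpoch q q (N - 1 - k)))
     * (\<Prod>j<s. qpoch (B j * v i * q ^ k) q N * inverse (qpoch (w j * v i * q ^ k) q N))"

definition residue_sum ::
  "nat \<Rightarrow> (nat \<Rightarrow> complex) \<Rightarrow> (nat \<Rightarrow> complex)
      \<Rightarrow> nat \<Rightarrow> (nat \<Rightarrow> complex) \<Rightarrow> (nat
      \<Rightarrow> complex) \<Rightarrow> nat \<Rightarrow> complex" where
  "residue_sum r A v s B w i =
     (\<Sum>k. ((\<Prod>i<r. A i) / (\<Prod>i<r. v i)) ^ k * residue_coeff r A v s B w i k)"

text \<open>The hypotheses \<open>vv\<close> and \<open>vw\<close> keep all denominator factorials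
  away from 0, which bounds the truncated coefficients on the triangle k < N. The powers of the
  quotient in \<open>ratio\<close> then give the summable majorant.\<close>

lemma residue_sum_limit:
  assumes i: "i < r" and vnz: "\<And>i. i < r \<Longrightarrow> v i \<noteq> 0"
    and ratio: "norm ((\<Prod>i<r. A i) / (\<Prod>i<r. v i)) < 1"
    and vv: "\<And>i i' n. i < r \<Longrightarrow> i' < r \<Longrightarrow> i \<noteq> i' \<Longrightarrow> v i'
        * q ^ n \<noteq> v i"
    and vw: "\<And>i j n. i < r \<Longrightarrow> j < s \<Longrightarrow> v i * w j * q ^ n \<noteq> 1"
  shows "(\<lambda>N. \<Sum>k<N. ((\<Prod>i<r. A i) / (\<Prod>i<r. v i)) ^ k * residue_coeff_fin r A v s B w i N k)
           \<longlonglongrightarrow> residue_sum r A v s B w i"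
proof -
  have vv1: "v i' / v i * q ^ n \<noteq> 1" if "i' < r" "i' \<noteq> i" for i' n
    using vv[of i i' n] that i vnz[OF i] by (auto simp: field_simps)
  have vv2: "q * v i / v i' * q ^ n \<noteq> 1" if "i' < r" "i' \<noteq> i" for i' n
    using vv[of i' i "Suc n"] that i vnz[OF that(1)] by (auto simp: field_simps)
  have vw': "w j * v i * q ^ n \<noteq> 1" if "j < s" for j n
    using vw[OF i that, of n] by (simp add: mult_ac)
  have vw'': "w j * v i * q ^ k * q ^ n \<noteq> 1" if "j < s" for j n k
    using vw'[OF that, of "k + n"] by (simp add: power_add mult_ac)
  have sub: "filterlim (\<lambda>N. N - c) sequentially sequentially" for c :: nat
    by (rule filterlim_minus_const_nat_at_top)
  have L1: "(\<lambda>N. qpoch a q (N - c)) \<longlonglongrightarrow> qpoch_inf a q" for a c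
    using filterlim_compose[OF qpoch_LIMSEQ sub] by simp
  have L2: "(\<lambda>N. qpoch a q (N - 1 - c)) \<longlonglongrightarrow> qpoch_inf a q" for a c
    using L1[of a "Suc c"] by simp
  have lim: "(\<lambda>N. residue_coeff_fin r A v s B w i N k) \<longlonglongrightarrow> residue_coeff r A v s B w i k" for k
    unfolding residue_coeff_def residue_coeff_fin_def
    by (intro tendsto_intros L1 L2 qpoch_LIMSEQ qpoch_inf_nonzero)
       (use vv1 vw'' q_mult_power_neq_1 in auto)
  have B1: "diag_bounded (\<lambda>N k. qpoch a q (m N k))" for a m
    by (rule diag_bounded_qpoch[of _ "norm a"]) simp
  have B2: "diag_bounded (\<lambda>N k. qpoch (a * q ^ k) q (m N k))" for a m
    by (rule diag_bounded_qpoch[of _ "norm a"]) (rule norm_mult_q_power_le, simp)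
  have B3: "diag_bounded (\<lambda>N k. inverse (qpoch a q (m N k)))" if "\<And>n. a * q ^ n \<noteq> 1" for a m
    using diag_bounded_inverse_qpoch[OF that, of "\<lambda>_ _. 0"] by simp
  have B4: "diag_bounded (\<lambda>N k. inverse (qpoch (a * q ^ k) q (m N k)))" if "\<And>n. a * q ^ n \<noteq> 1" for a m
    using diag_bounded_inverse_qpoch[OF that, of "\<lambda>_ k. k"] by simp
  have "diag_bounded (residue_coeff_fin r A v s B w i)"
    unfolding residue_coeff_fin_def
    by (intro diag_bounded_mult diag_bounded_prod B1 B2 B3 B4)
       (use vv1 vv2 vw' q_mult_power_neq_1 in auto)
  then obtain C where "\<And>N k. k < N \<Longrightarrow> norm (residue_coeff_fin r A v s B w i N k) \<le> C"
    unfolding diag_bounded_def by blast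
  from tannery_partial_sums[OF ratio lim this] show ?thesis
    unfolding residue_sum_def .
qed

text \<open>A summand of the two-sided partial fraction formula, for the pole 1 / (v i * q^k). Each
  factorial split at k yields a power q^(-k(k+1)/2). Numerator and denominator contain r such powers
  each, so they cancel and only the k-th power of the quotient of products is left.\<close>

lemma residue_term_fin:
  assumes i: "i < r" and k: "k < N"
    and nz: "\<And>i. i < r \<Longrightarrow> A i \<noteq> 0" "\<And>i. i < r \<Longrightarrow> v i \<noteq> 0"
  defines "X \<equiv> {..<r} \<times> {..<N}"
  shows "(\<Prod>x\<in>X. 1 - (case x of (i', k') \<Rightarrow> A i' * q ^ k') / (v i * q ^ k))
          / (\<Prod>x\<in>X - {(i, k)}. 1 - (case x of (i', k') \<Rightarrow> v i' * q ^ k') / (v i * q ^ k))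
          * ((\<Prod>y\<in>{..<s} \<times> {..<N}. 1 - (case y of (j', k') \<Rightarrow> B j' * q ^ k') * (v i * q ^ k))
             / (\<Prod>y\<in>{..<s} \<times> {..<N}. 1 - (case y of (j', k') \<Rightarrow> w j' * q ^ k') * (v i * q ^ k)))
       = ((\<Prod>i<r. A i) / (\<Prod>i<r. v i)) ^ k * residue_coeff_fin r A v s B w i N k"
proof -
  let ?T = "q ^ (\<Sum>{..k})"
  have T: "?T \<noteq> 0" using q_nz by simp
  have vi: "v i \<noteq> 0" using nz i by simp
  have P1: "(\<Prod>x\<in>I \<times> {..<N}. 1 - (case x of (i', k') \<Rightarrow> A i' * q ^ k') / (v i * q ^ k))
      = (\<Prod>i'\<in>I. (- (A i' / v i)) ^ k / ?T) * (\<Prod>i'\<in>I. qpoch (q * v i / A i') q k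
          * qpoch (A i' / v i) q (N - k))"
    if "I \<subseteq> {..<r}" "\<And>i. i < r \<Longrightarrow> A i \<noteq> 0" for I and A :: "nat \<Rightarrow> complex"
  proof -
    have "(\<Prod>x\<in>I \<times> {..<N}. 1 - (case x of (i', k') \<Rightarrow> A i' * q ^ k') / (v i * q ^ k))
        = (\<Prod>i'\<in>I. qpoch (A i' / v i / q ^ k) q N)"
      unfolding qpoch_def by (simp add: prod.cartesian_product case_prod_unfold)
    also have "\<dots> = (\<Prod>i'\<in>I. ((- (A i' / v i)) ^ k / ?T) * (qpoch (q * v i / A i') q k
        * qpoch (A i' / v i) q (N - k)))"
    proof (intro prod.cong refl)
      fix i' assume "i' \<in> I"
      hence "A i' / v i \<noteq> 0" using that vi by auto
      from qpoch_div_power[OF this, of k N] k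
      show "qpoch (A i' / v i / q ^ k) q N = ((- (A i' / v i)) ^ k / ?T) * (qpoch (q * v i / A i') q k
          * qpoch (A i' / v i) q (N - k))"
        by simp
    qed
    finally show ?thesis by (simp only: prod.distrib)
  qed
  have X: "X - {(i, k)} = (({..<r} - {i}) \<times> {..<N}) \<union> ({i} \<times> ({..<N} - {k}))"
    using i k by (auto simp: X_def)
  have P2: "(\<Prod>x\<in>X - {(i, k)}. 1 - (case x of (i', k') \<Rightarrow> v i' * q ^ k') / (v i * q ^ k))
      = (\<Prod>i'\<in>{..<r} - {i}. (- (v i' / v i)) ^ k / ?T) * (\<Prod>i'\<in>{..<r} - {i}. qpoch (q
          * v i / v i') q k * qpoch (v i' / v i) q (N - k))
        * ((- 1) ^ k / ?T * (qpoch q q k * qpoch q q (N - 1 - k)))"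
  proof -
    have "(\<Prod>x\<in>{i} \<times> ({..<N} - {k}). 1 - (case x of (i', k') \<Rightarrow> v i' * q ^ k') / (v i * q ^ k))
       = (\<Prod>k'\<in>{..<N} - {k}. 1 - q ^ k' / q ^ k)"
      by (rule prod.reindex_bij_witness[of _ "\<lambda>k'. (i, k')" snd]) (auto simp: vi)
    thus ?thesis
      unfolding X using P1[of "{..<r} - {i}" v] nz(2)
      by (subst prod.union_disjoint) (auto simp: prod_one_minus_q_ratio[OF k] mult_ac)
  qed
  have P3: "(\<Prod>y\<in>{..<s} \<times> {..<N}. 1 - (case y of (j', k') \<Rightarrow> B j' * q ^ k') * (v i * q ^ k))
      = (\<Prod>j<s. qpoch (B j * v i * q ^ k) q N)" for B
    unfolding qpoch_def by (simp add: prod.cartesian_product case_prod_unfold mult_ac)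
  have pw: "(\<Prod>i'<r. (- (A i' / v i)) ^ k / ?T)
      = ((\<Prod>i<r. A i) / (\<Prod>i<r. v i)) ^ k * ((\<Prod>i'\<in>{..<r} - {i}. (- (v i' / v i)) ^ k / ?T)
          * ((- 1) ^ k / ?T))"
  proof -
    have "(\<Prod>i'\<in>{..<r} - {i}. (- (v i' / v i)) ^ k / ?T) * ((- 1) ^ k / ?T) = (\<Prod>i'<r. (- (v i' / v i)) ^ k / ?T)"
      using prod.remove[of "{..<r}" i "\<lambda>i'. (- (v i' / v i)) ^ k / ?T"] i vi by (simp add: mult_ac)
    moreover have "((\<Prod>i<r. A i) / (\<Prod>i<r. v i)) ^ k = (\<Prod>i'<r. (A i' / v i') ^ k)"
      by (simp add: prod_dividef prod_power_distrib power_divide)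
    ultimately show ?thesis
      using nz by (simp flip: prod.distrib) (intro prod.cong refl, simp add: power_divide power_minus' field_simps vi)
  qed
  have pw0: "(\<Prod>i'\<in>{..<r} - {i}. (- (v i' / v i)) ^ k / ?T) * ((- 1) ^ k / ?T) \<noteq> 0"
    using nz T vi by auto
  have alg: "(\<rho> * (u * t)) * PA / (u * PV * (t * R)) * (PB / PW) = \<rho> * (PA * inverse PV * inverse R * (PB
      * inverse PW))"
    if "u * t \<noteq> 0" for \<rho> u t PA PV R PB PW :: complex
    using that by (simp add: divide_inverse mult_ac)
  have inv: "(\<Prod>i\<in>J. inverse (f i)) = inverse (\<Prod>i\<in>J. f i)" for f :: "nat \<Rightarrow> complex" and J
    using prod_inversef[of f J] by (simp add: o_def)
  have P1A: "(\<Prod>x\<in>X. 1 - (case x of (i', k') \<Rightarrow> A i' * q ^ k') / (v i * q ^ k))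
      = ((\<Prod>i<r. A i) / (\<Prod>i<r. v i)) ^ k * ((\<Prod>i'\<in>{..<r} - {i}. (- (v i' / v i)) ^ k / ?T) * ((- 1) ^ k / ?T))
        * (\<Prod>i'<r. qpoch (q * v i / A i') q k * qpoch (A i' / v i) q (N - k))"
    unfolding X_def using P1[of "{..<r}" A, OF order.refl nz(1)] unfolding pw by assumption
  show ?thesis
    unfolding P1A P2 P3 alg[OF pw0] residue_coeff_fin_def
    by (simp only: prod.distrib inv inverse_mult_distrib mult.assoc)
qed

text \<open>For truncation length N the two sides differ by \<rho>^N - \<sigma>^N: in the quotient
  of all numerator parameters by all denominator parameters the powers of q cancel. Both \<rho> and
  \<sigma> have norm below 1.\<close>

theorem residue_sums_eq:
  assumes nz: "\<And>i. i < r \<Longrightarrow> A i \<noteq> 0" "\<And>i. i < r \<Longrightarrow> v i \<noteq> 0"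
      "\<And>j. j < s \<Longrightarrow> B j \<noteq> 0" "\<And>j. j < s \<Longrightarrow> w j \<noteq> 0"
    and ratio: "norm ((\<Prod>i<r. A i) / (\<Prod>i<r. v i)) < 1" "norm ((\<Prod>j<s. B j) / (\<Prod>j<s. w j)) < 1"
    and vv: "\<And>i i' n. i < r \<Longrightarrow> i' < r \<Longrightarrow> i \<noteq> i' \<Longrightarrow> v i'
        * q ^ n \<noteq> v i"
    and ww: "\<And>j j' n. j < s \<Longrightarrow> j' < s \<Longrightarrow> j \<noteq> j' \<Longrightarrow> w j'
        * q ^ n \<noteq> w j"
    and vw: "\<And>i j n. i < r \<Longrightarrow> j < s \<Longrightarrow> v i * w j * q ^ n \<noteq> 1"
  shows "(\<Sum>j<s. residue_sum s B w r A v j) = (\<Sum>i<r. residue_sum r A v s B w i)"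
proof -
  define \<rho> \<sigma> where "\<rho> = (\<Prod>i<r. A i) / (\<Prod>i<r. v i)" and "\<sigma>
      = (\<Prod>j<s. B j) / (\<Prod>j<s. w j)"
  define F where "F = (\<lambda>N. (\<Sum>j<s. \<Sum>k<N. \<sigma> ^ k * residue_coeff_fin s B w r A v j N k)
                     - (\<Sum>i<r. \<Sum>k<N. \<rho> ^ k * residue_coeff_fin r A v s B w i N k))"
  have inj: "inj_on (\<lambda>(i, k). v i * q ^ k) ({..<r} \<times> {..<N})"
    if "\<And>i i' n. i < r \<Longrightarrow> i' < r \<Longrightarrow> i \<noteq> i' \<Longrightarrow> v i'
        * q ^ n \<noteq> v i" "\<And>i. i < r \<Longrightarrow> v i \<noteq> 0"
    for r N and v :: "nat \<Rightarrow> complex"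
  proof (rule inj_onI, clarsimp)
    fix i k i' k' assume *: "i < r" "i' < r" "v i * q ^ k = v i' * q ^ k'"
    have w: "i = i' \<and> k = k'" if "k \<le> k'" "i < r" "i' < r" "v i * q ^ k = v i' * q ^ k'" for i i' k k'
    proof -
      have "v i * q ^ k = v i' * q ^ (k' - k) * q ^ k" using that by (simp add: power_add[symmetric])
      hence e: "v i = v i' * q ^ (k' - k)" using q_nz by simp
      hence "i = i'" using \<open>\<And>i i' n. i < r \<Longrightarrow> i' < r
          \<Longrightarrow> i \<noteq> i' \<Longrightarrow> v i' * q ^ n \<noteq> v i\<close>[of i i' "k' - k"] that by metis
      moreover from this e have "q ^ (k' - k) = 1" using \<open>\<And>i. i < r
          \<Longrightarrow> v i \<noteq> 0\<close>[of i] that by simp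
      hence "k' - k = 0" using power_q_neq_1 by (metis bot_nat_0.not_eq_extremum)
      ultimately show ?thesis using that by simp
    qed
    show "i = i' \<and> k = k'"
      using w[of k k' i i'] w[of k' k i' i] * by (cases "k \<le> k'") auto
  qed
  have ratio_power: "(\<Prod>(i, k)\<in>{..<r} \<times> {..<N}. f i * q ^ k) / (\<Prod>(i,
      k)\<in>{..<r} \<times> {..<N}. g i * q ^ k)
      = ((\<Prod>i<r. f i) / (\<Prod>i<r. g i)) ^ N" for f g :: "nat \<Rightarrow> complex" and r N
  proof -
    have "(\<Prod>(i, k)\<in>{..<r} \<times> {..<N}. f i * q ^ k) / (\<Prod>(i, k)\<in>{..<r} \<times> {..<N}. g i * q ^ k)
        = (\<Prod>(i, k)\<in>{..<r} \<times> {..<N}. f i / g i)"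
      unfolding prod_dividef[symmetric] using q_nz by (intro prod.cong refl) (auto split: prod.splits)
    also have "\<dots> = (\<Prod>i<r. \<Prod>k<N. f i / g i)"
      by (rule prod.cartesian_product[symmetric])
    finally show ?thesis by (simp add: prod_dividef prod_power_distrib power_divide)
  qed
  have "F N = \<rho> ^ N - \<sigma> ^ N" for N
  proof -
    let ?X = "{..<r} \<times> {..<N}" and ?Y = "{..<s} \<times> {..<N}"
    let ?e = "\<lambda>f (i :: nat, k :: nat). f i * q ^ k :: complex"
    have "(\<Sum>y\<in>?Y. (\<Prod>y'\<in>?Y. 1 - ?e B y' / ?e w y) / (\<Prod>y'\<in>?Y - {y}. 1 - ?e w y' / ?e w y)
                   * ((\<Prod>x\<in>?X. 1 - ?e A x * ?e w y) / (\<Prod>x\<in>?X. 1 - ?e v x * ?e w y)))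
       - (\<Sum>x\<in>?X. (\<Prod>x'\<in>?X. 1 - ?e A x' / ?e v x) / (\<Prod>x'\<in>?X - {x}. 1 - ?e v x' / ?e v x)
                   * ((\<Prod>y\<in>?Y. 1 - ?e B y * ?e v x) / (\<Prod>y\<in>?Y. 1 - ?e w y * ?e v x)))
       = (\<Prod>x\<in>?X. ?e A x) / (\<Prod>x\<in>?X. ?e v x) - (\<Prod>y\<in>?Y. ?e B y) / (\<Prod>y\<in>?Y. ?e w y)"
    proof (rule partial_fractions_two_sided)
      show "inj_on (?e v) ?X" by (rule inj) (use vv nz in auto)
      show "inj_on (?e w) ?Y" by (rule inj) (use ww nz in auto)
      fix x y assume "x \<in> ?X" "y \<in> ?Y"
      thus "?e v x * ?e w y \<noteq> 1" using vw[of "fst x" "fst y" "snd x + snd y"]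
        by (auto simp: case_prod_unfold power_add mult_ac)
    qed (use nz q_nz in auto)
    also have "(\<Sum>y\<in>?Y. (\<Prod>y'\<in>?Y. 1 - ?e B y' / ?e w y) / (\<Prod>y'\<in>?Y - {y}. 1 - ?e w y' / ?e w y)
                   * ((\<Prod>x\<in>?X. 1 - ?e A x * ?e w y) / (\<Prod>x\<in>?X. 1 - ?e v x * ?e w y)))
        = (\<Sum>(j, k)\<in>?Y. \<sigma> ^ k * residue_coeff_fin s B w r A v j N k)"
      unfolding \<sigma>_def using nz
      by (intro sum.cong refl, clarify) (subst residue_term_fin[symmetric], auto)
    also have "(\<Sum>x\<in>?X. (\<Prod>x'\<in>?X. 1 - ?e A x' / ?e v x) / (\<Prod>x'\<in>?X - {x}. 1 - ?e v x' / ?e v x)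
                   * ((\<Prod>y\<in>?Y. 1 - ?e B y * ?e v x) / (\<Prod>y\<in>?Y. 1 - ?e w y * ?e v x)))
        = (\<Sum>(i, k)\<in>?X. \<rho> ^ k * residue_coeff_fin r A v s B w i N k)"
      unfolding \<rho>_def using nz
      by (intro sum.cong refl, clarify) (subst residue_term_fin[symmetric], auto)
    also have "(\<Prod>x\<in>?X. ?e A x) / (\<Prod>x\<in>?X. ?e v x) = \<rho> ^ N"
      unfolding \<rho>_def by (rule ratio_power)
    also have "(\<Prod>y\<in>?Y. ?e B y) / (\<Prod>y\<in>?Y. ?e w y) = \<sigma> ^ N"
      unfolding \<sigma>_def by (rule ratio_power)
    finally show ?thesis unfolding F_def by (simp add: sum.cartesian_product)
  qed
  moreover have "(\<lambda>N. \<rho> ^ N - \<sigma> ^ N) \<longlonglongrightarrow> 0"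
    using ratio by (intro tendsto_eq_intros LIMSEQ_power_zero) (auto simp: \<rho>_def \<sigma>_def)
  ultimately have "F \<longlonglongrightarrow> 0" by presburger
  moreover have "F \<longlonglongrightarrow> (\<Sum>j<s. residue_sum s B w r A v j) - (\<Sum>i<r. residue_sum r A v s B w i)"
    unfolding F_def \<rho>_def \<sigma>_def
    by (intro tendsto_diff tendsto_sum residue_sum_limit) (use nz ratio vv ww vw in \<open>auto simp: mult.commute\<close>)
  ultimately show ?thesis
    using LIMSEQ_unique by fastforce
qed

end

section \<open>Products of two series: the coefficient identity\<close>

lemma sum_lessThan_add: "\<Sum>{..<k + j} = \<Sum>{..<k} + \<Sum>{..<j} + k * (j :: nat)"
  by (induction j) auto

lemma power_square_sum_lessThan:
  fixes x :: "'a :: comm_monoid_mult"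
  shows "x ^ (k * k) = x ^ (\<Sum>{..<k}) * x ^ (\<Sum>{..<k}) * x ^ k"
proof -
  have "k * k = \<Sum>{..<k} + \<Sum>{..<k} + k" by (induction k) auto
  thus ?thesis by (metis power_add)
qed

section \<open>Formal power series and the dilation F(x) -> F(u x)\<close>

definition fps_scale :: "complex \<Rightarrow> complex fps \<Rightarrow> complex fps" where
  "fps_scale u F = Abs_fps (\<lambda>n. u ^ n * fps_nth F n)"

lemma fps_scale_nth [simp]: "fps_nth (fps_scale u F) n = u ^ n * fps_nth F n"
  by (simp add: fps_scale_def)

lemma fps_scale_mult: "fps_scale u (F * G) = fps_scale u F * fps_scale u G"
proof (rule fps_ext)
  fix n
  have "u ^ n * (\<Sum>i=0..n. fps_nth F i * fps_nth G (n - i)) = (\<Sum>i=0..n. (u ^ i * fps_nth F i)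
      * (u ^ (n - i) * fps_nth G (n - i)))"
    unfolding sum_distrib_left
    by (intro sum.cong refl) (simp add: power_add[symmetric] mult_ac flip: power_add)
  thus "fps_nth (fps_scale u (F * G)) n = fps_nth (fps_scale u F * fps_scale u G) n"
    by (simp add: fps_mult_nth)
qed

lemma fps_scale_scale: "fps_scale u (fps_scale v F) = fps_scale (u * v) F"
  by (rule fps_ext) (simp add: power_mult_distrib)

lemma fps_scale_1 [simp]: "fps_scale 1 F = F"
  by (rule fps_ext) simp

lemma fps_scale_linear: "fps_scale u (1 - fps_const c * fps_X) = 1 - fps_const (u * c) * fps_X"
proof (rule fps_ext)
  fix n show "fps_nth (fps_scale u (1 - fps_const c * fps_X)) n = fps_nth (1 - fps_const (u * c) * fps_X) n"
    by (cases n) (auto simp: fps_X_def)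
qed

context qbase
begin

text \<open>The coefficients of the series 2phi1(A, B; C; q, x).\<close>

definition hyp :: "complex \<Rightarrow> complex \<Rightarrow> complex \<Rightarrow> nat \<Rightarrow> complex" where
  "hyp A B C n = qpoch A q n * qpoch B q n / (qpoch q q n * qpoch C q n)"

text \<open>The coefficients of (u x; q)_inf / (x; q)_inf, by the q-binomial theorem
  (\<open>qbin_expansion\<close>).\<close>

definition qbin :: "complex \<Rightarrow> nat \<Rightarrow> complex" where
  "qbin u n = qpoch u q n / qpoch q q n"

lemma qpoch_q_nonzero: "qpoch q q n \<noteq> 0"
  by (rule qpoch_nonzero) (rule q_mult_power_neq_1)

lemma qbin_Suc: "qbin u (Suc n) = qbin u n * (1 - u * q ^ n) / (1 - q * q ^ n)"
  by (simp add: qbin_def qpoch_Suc)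

text \<open>The telescoping identity for one summand, with y = q^k, Z = q^(n-k) and T the k-th
  summand at n. In free variables it is a mere identity of rational functions.\<close>

lemma euler_coeff_step:
  fixes A B C y Z T :: complex
  assumes "A \<noteq> 0" "B \<noteq> 0" "C \<noteq> 0" "q * Z \<noteq> 1"
  defines "\<mu> \<equiv> A * B / C"
  shows "(1 - q * (y * Z)) * (1 - C * (y * Z)) * (T * (1 - \<mu> * Z) / (1 - q * Z)) - (1 - A * (y * Z)) * (1 - B * (y * Z)) * T
       = - (Z * \<mu> * T * (1 - C / A * y) * (1 - C / B * y)) + q * Z * (T * (1 - \<mu> * Z) / (1 - q * Z))
           * (1 - y) * (1 - C * y / q)"
proof -
  have nz: "1 - q * Z \<noteq> 0" using assms by auto
  show ?thesis
    unfolding \<mu>_def using assms(1-3) nz q_nz by (simp add: divide_simps) (simp add: algebra_simps)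
qed

text \<open>Euler's transformation of 2phi1, coefficient by coefficient. Both sides satisfy (1 -
  q^(n+1)) (1 - C q^n) S(n+1) = (1 - A q^n) (1 - B q^n) S(n).\<close>

lemma euler_transformation_coeff:
  assumes nz: "A \<noteq> 0" "B \<noteq> 0" "C \<noteq> 0" and C: "\<And>n. C * q ^ n \<noteq> 1"
  defines "\<mu> \<equiv> A * B / C"
  shows "(\<Sum>k\<le>n. hyp (C / A) (C / B) C k * \<mu> ^ k * qbin \<mu> (n - k)) = hyp A B C n"
proof (induction n)
  case 0
  show ?case by (simp add: hyp_def qbin_def)
next
  case (Suc n)
  define t where "t = (\<lambda>n k. hyp (C / A) (C / B) C k * \<mu> ^ k * qbin \<mu> (n - k))"
  \<comment> \<open>The telescoping certificate of q-Zeilberger type for the first-order recurrence in n.\<close>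
  define H where "H = (\<lambda>k. - (q ^ (Suc n - k) * t (Suc n) k * (1 - q ^ k) * (1 - C * q ^ k / q)))"
  have alg: "x * (S + T) = y" if "x * S - y = - (x * T)" for x S T y :: complex
    using that by (simp add: algebra_simps)
  have C': "1 - C * q ^ k \<noteq> 0" "1 - q * q ^ k \<noteq> 0" for k
    using C[of k] q_mult_power_neq_1[of k] by auto
  have H_Suc: "H (Suc k) = - (q ^ (n - k) * \<mu> * t n k * (1 - C / A * q ^ k) * (1 - C / B * q ^ k))" for k
  proof -
    have "hyp (C / A) (C / B) C (Suc k) * (1 - q ^ Suc k) * (1 - C * q ^ k)
        = hyp (C / A) (C / B) C k * (1 - C / A * q ^ k) * (1 - C / B * q ^ k)"
      using C'[of k] by (simp add: hyp_def qpoch_Suc)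
    moreover have "C * q ^ Suc k / q = C * q ^ k" using q_nz by simp
    ultimately show ?thesis unfolding H_def t_def by (simp add: mult_ac)
  qed
  have step: "(1 - q ^ Suc n) * (1 - C * q ^ n) * t (Suc n) k - (1 - A * q ^ n) * (1 - B * q ^ n) * t n k
                = H (Suc k) - H k" if "k \<le> n" for k
  proof -
    have yZ: "q ^ n = q ^ k * q ^ (n - k)" using that by (simp flip: power_add)
    have t_Suc: "t (Suc n) k = t n k * (1 - \<mu> * q ^ (n - k)) / (1 - q * q ^ (n - k))"
      using that by (simp add: t_def Suc_diff_le qbin_Suc)
    have H_k: "H k = - (q * q ^ (n - k) * t (Suc n) k * (1 - q ^ k) * (1 - C * q ^ k / q))"
      using that by (simp add: H_def Suc_diff_le)
    show ?thesis
      unfolding H_Suc H_k t_Suc power_Suc yZ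
      using euler_coeff_step[OF nz q_mult_power_neq_1[of "n - k"], of "q ^ k" "t n k"]
      unfolding \<mu>_def by simp
  qed
  have "(\<Sum>k\<le>n. (1 - q ^ Suc n) * (1 - C * q ^ n) * t (Suc n) k - (1 - A * q ^ n) * (1 - B * q ^ n) * t n k)
      = (\<Sum>k<Suc n. H (Suc k) - H k)"
    unfolding lessThan_Suc_atMost by (intro sum.cong refl step) auto
  also have "\<dots> = H (Suc n) - H 0" by (rule sum_lessThan_telescope)
  \<comment> \<open>The telescoped range ends at k = n, but the sum at \<open>Suc n\<close> has one
    more summand. \<open>H 0\<close> vanishes through 1 - q^0, and \<open>H (Suc n)\<close> is minus
    that last summand times the factor of the recurrence.\<close>
  also have "\<dots> = - ((1 - q ^ Suc n) * (1 - C * q ^ n) * t (Suc n) (Suc n))"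
    using q_nz by (simp add: H_def mult_ac)
  finally have "(1 - q ^ Suc n) * (1 - C * q ^ n) * (\<Sum>k\<le>Suc n. t (Suc n) k)
      = (1 - A * q ^ n) * (1 - B * q ^ n) * (\<Sum>k\<le>n. t n k)"
    unfolding sum_subtractf sum_distrib_left[symmetric] sum.atMost_Suc by (rule alg)
  also have "(\<Sum>k\<le>n. t n k) = hyp A B C n" using Suc by (simp add: t_def)
  finally have "(\<Sum>k\<le>Suc n. t (Suc n) k) = (1 - A * q ^ n) * (1 - B * q ^ n) * hyp A B C n / ((1 - q
      * q ^ n) * (1 - C * q ^ n))"
    using C'[of n] by (simp add: eq_divide_eq mult_ac)
  also have "\<dots> = hyp A B C (Suc n)" by (simp add: hyp_def qpoch_Suc mult_ac)
  finally show ?case by (simp add: t_def)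
qed

definition hyp_fps :: "complex \<Rightarrow> complex \<Rightarrow> complex \<Rightarrow> complex fps" where
  "hyp_fps A B C = Abs_fps (hyp A B C)"

definition qbin_fps :: "complex \<Rightarrow> complex fps" where
  "qbin_fps u = Abs_fps (qbin u)"

lemma hyp_fps_nth [simp]: "fps_nth (hyp_fps A B C) n = hyp A B C n"
  and qbin_fps_nth [simp]: "fps_nth (qbin_fps u) n = qbin u n"
  by (simp_all add: hyp_fps_def qbin_fps_def)

lemma euler_transformation_fps:
  assumes "A \<noteq> 0" "B \<noteq> 0" "C \<noteq> 0" "\<And>n. C * q ^ n \<noteq> 1"
  shows "hyp_fps A B C = qbin_fps (A * B / C) * fps_scale (A * B / C) (hyp_fps (C / A) (C / B) C)"
proof (rule fps_ext)
  fix n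
  let ?u = "A * B / C" and ?F = "hyp_fps (C / A) (C / B) C"
  have "fps_nth (qbin_fps ?u * fps_scale ?u ?F) n = fps_nth (fps_scale ?u ?F * qbin_fps ?u) n"
    by (rule arg_cong[OF mult.commute])
  also have "\<dots> = (\<Sum>k\<le>n. hyp (C / A) (C / B) C k * ?u ^ k * qbin ?u (n - k))"
    unfolding fps_mult_nth atMost_atLeast0 by (intro sum.cong refl) simp
  finally show "fps_nth (hyp_fps A B C) n = fps_nth (qbin_fps ?u * fps_scale ?u ?F) n"
    using euler_transformation_coeff[OF assms, of n] by simp
qed

text \<open>For F(x) = (u x; q)_inf / (x; q)_inf this is (1 - x) F(x) = (1 - u x) F(q x). Together
  with the constant term it determines the series, because 1 - q^(m+1) is never 0.\<close>

lemma qbin_fps_functional: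
  "(1 - fps_X) * qbin_fps u = (1 - fps_const u * fps_X) * fps_scale q (qbin_fps u)"
proof (rule fps_ext)
  fix n
  show "fps_nth ((1 - fps_X) * qbin_fps u) n = fps_nth ((1 - fps_const u * fps_X) * fps_scale q (qbin_fps u)) n"
  proof (cases n)
    case (Suc m)
    have "1 - q * q ^ m \<noteq> 0" using q_mult_power_neq_1[of m] by auto
    hence "qbin u (Suc m) * (1 - q * q ^ m) = qbin u m * (1 - u * q ^ m)"
      by (simp add: qbin_Suc)
    thus ?thesis by (simp add: Suc left_diff_distrib mult.assoc) (simp add: algebra_simps)
  qed (simp add: left_diff_distrib mult.assoc)
qed

lemma qbin_fps_unique:
  assumes "(1 - fps_X) * F = (1 - fps_const u * fps_X) * fps_scale q F" "fps_nth F 0 = 1"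
  shows "F = qbin_fps u"
proof (rule fps_ext)
  fix n show "fps_nth F n = fps_nth (qbin_fps u) n"
  proof (induction n)
    case (Suc m)
    have nz: "1 - q * q ^ m \<noteq> 0" using q_mult_power_neq_1[of m] by auto
    have "fps_nth ((1 - fps_X) * F) (Suc m) = fps_nth ((1 - fps_const u * fps_X) * fps_scale q F) (Suc m)"
      by (simp only: assms)
    hence "fps_nth F (Suc m) * (1 - q * q ^ m) = fps_nth F m * (1 - u * q ^ m)"
      by (simp add: left_diff_distrib mult.assoc) (simp add: algebra_simps)
    thus ?case using nz Suc by (simp add: qbin_Suc eq_divide_eq)
  qed (use assms in \<open>simp add: qbin_def\<close>)
qed

text \<open>The formal version of cancelling (u x; q)_inf / (x; q)_inf against its reciprocal. The
  product H satisfies H(x) = H(q x), so all its coefficients except the constant one vanish.\<close>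

lemma qbin_fps_inverse:
  assumes "u \<noteq> 0"
  shows "qbin_fps u * fps_scale u (qbin_fps (1 / u)) = 1"
proof -
  define K where "K = fps_scale u (qbin_fps (1 / u))"
  define H where "H = qbin_fps u * K"
  let ?L = "\<lambda>c. 1 - fps_const c * fps_X :: complex fps"
  have L1: "fps_scale u (1 - fps_X) = ?L u" using fps_scale_linear[of u 1] by simp
  have "fps_scale u ((1 - fps_X) * qbin_fps (1 / u)) = fps_scale u (?L (1 / u) * fps_scale q (qbin_fps (1 / u)))"
    by (simp only: qbin_fps_functional)
  hence K: "?L u * K = (1 - fps_X) * fps_scale q K"
    using assms by (simp add: L1 fps_scale_mult fps_scale_linear fps_scale_scale K_def mult.commute[of u q])
  have "(1 - fps_X) * ?L u * H = ((1 - fps_X) * qbin_fps u) * (?L u * K)" by (simp add: H_def mult_ac)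
  also have "\<dots> = (1 - fps_X) * ?L u * fps_scale q H"
    unfolding K qbin_fps_functional by (simp add: H_def fps_scale_mult mult_ac)
  finally have H: "H = fps_scale q H"
  proof -
    assume *: "(1 - fps_X) * ?L u * H = (1 - fps_X) * ?L u * fps_scale q H"
    have nz: "?L c \<noteq> 0" for c
    proof
      assume "?L c = 0"
      hence "fps_nth (?L c) 0 = 0" by simp
      thus False by simp
    qed
    have "(1 - fps_X) * ?L u \<noteq> 0" using nz[of 1] nz[of u] by simp
    from *[unfolded mult_left_cancel[OF this]] show ?thesis .
  qed
  have "H = 1"
  proof (rule fps_ext)
    fix n
    show "fps_nth H n = fps_nth 1 n"
    proof (cases "n = 0")
      case False
      have "fps_nth H n = q ^ n * fps_nth H n" by (subst H) simp
      hence "fps_nth H n * (1 - q ^ n) = 0" by (simp add: algebra_simps)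
      moreover have "1 - q ^ n \<noteq> 0" using power_q_neq_1[of n] False by auto
      ultimately show ?thesis using False by simp
    qed (simp add: H_def K_def qbin_def)
  qed
  thus ?thesis by (simp add: H_def K_def)
qed

text \<open>Euler's transformation is applied to both series. The condition linking \<open>u\<close>
  to the second series makes the two q-binomial prefactors inverse to each other, so they drop
  out.\<close>

lemma sears_fps:
  assumes "A1 \<noteq> 0" "B1 \<noteq> 0" "C1 \<noteq> 0" "\<And>n. C1 * q ^ n \<noteq> 1"
    and "A2 \<noteq> 0" "B2 \<noteq> 0" "C2 \<noteq> 0" "\<And>n. C2 * q ^ n \<noteq> 1"
    and u: "u = A1 * B1 / C1" "u * (A2 * B2 / C2) = 1"
  shows "hyp_fps A1 B1 C1 * fps_scale u (hyp_fps A2 B2 C2)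
           = fps_scale u (hyp_fps (C1 / A1) (C1 / B1) C1) * hyp_fps (C2 / A2) (C2 / B2) C2"
proof -
  have u0: "u \<noteq> 0" using u(2) by auto
  have u': "A2 * B2 / C2 = 1 / u" using u(2) u0 by (simp add: eq_divide_eq mult.commute)
  have "hyp_fps A1 B1 C1 = qbin_fps u * fps_scale u (hyp_fps (C1 / A1) (C1 / B1) C1)"
    using euler_transformation_fps[OF assms(1-4)] by (simp only: u(1))
  moreover have "fps_scale u (hyp_fps A2 B2 C2) = fps_scale u (qbin_fps (1 / u)) * hyp_fps (C2 / A2) (C2 / B2) C2"
    using euler_transformation_fps[OF assms(5-8)] u0 by (simp add: u' fps_scale_mult fps_scale_scale)
  ultimately have "hyp_fps A1 B1 C1 * fps_scale u (hyp_fps A2 B2 C2)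
     = (qbin_fps u * fps_scale u (qbin_fps (1 / u))) * (fps_scale u (hyp_fps (C1 / A1) (C1 / B1) C1)
         * hyp_fps (C2 / A2) (C2 / B2) C2)"
    by (simp only: mult_ac)
  thus ?thesis using qbin_fps_inverse[OF u0] by simp
qed

text \<open>With n = k + j, reversing the k factors of (u q^(-n); q)_k gives (q/u; q)_n / (q/u; q)_j
  up to elementary factors. The form without division also covers zeros of the denominator.\<close>

lemma qpoch_reverse_part:
  assumes "u \<noteq> 0"
  shows "qpoch (u / q ^ (k + j)) q k * qpoch (q / u) q j * q ^ ((k + j) * k)
           = (- u) ^ k * q ^ (\<Sum>{..<k}) * qpoch (q / u) q (k + j)"
proof (induction k arbitrary: j)
  case (Suc k)
  have alg: "P * E * R * (S * T) = P * (R * F) * S * U" if "E * T = U * F" for P E R S T U F :: complex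
  proof -
    have "P * E * R * (S * T) = P * R * S * (E * T)" by (simp only: mult_ac)
    thus ?thesis unfolding that by (simp only: mult_ac)
  qed
  have "(1 - u / q ^ (Suc k + j) * q ^ k) * q ^ (Suc k + j) = - u * q ^ k * (1 - q / u * q ^ j)"
    using assms q_nz by (simp add: field_simps power_add)
  moreover have "q ^ ((k + Suc j) * Suc k) = q ^ ((k + Suc j) * k) * q ^ (Suc k + j)"
    unfolding power_add[symmetric] by (rule arg_cong[of _ _ "(^) q"]) simp
  ultimately have "qpoch (u / q ^ (k + Suc j)) q (Suc k) * qpoch (q / u) q j * q ^ ((k + Suc j) * Suc k)
      = (qpoch (u / q ^ (k + Suc j)) q k * qpoch (q / u) q (Suc j) * q ^ ((k + Suc j) * k)) * (- u * q ^ k)"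
    unfolding qpoch_Suc by (simp only: add_Suc add_Suc_right) (rule alg, simp only: mult_minus_left)
  also have "\<dots> = (- u) ^ Suc k * q ^ (\<Sum>{..<Suc k}) * qpoch (q / u) q (k + Suc j)"
    unfolding Suc.IH by (simp add: power_add mult_ac)
  finally show ?case by simp
qed auto

text \<open>The factorial of length 2k splits into four of length k, with parameters plus and minus
  the square roots of \<alpha> and q \<alpha> for \<alpha> = a \<beta>. These are thus coefficients
  of a basic hypergeometric series.\<close>

definition d_coeff :: "complex \<Rightarrow> complex \<Rightarrow> complex \<Rightarrow> nat \<Rightarrow> complex" where
  "d_coeff a b \<beta> k = qpoch a q k * qpoch \<beta> q k * qpoch (a * \<beta>) q (2 * k)
      / (qpoch q q k * qpoch (q * a / b) q k * qpoch (\<beta> * b) q k * qpoch (a * \<beta>) q k)"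

text \<open>The left side is the coefficient of x^n in 2phi1(\<beta>b/a, \<beta>; \<beta>b; q, ax)
  2phi1(a, qa/(\<beta>b); qa/b; q, \<beta>x). The right side is that coefficient in the sum of the
  functions \<open>Dk\<close> defined later. Both come from the n-th coefficient of
  \<open>sears_fps\<close> with parameters that depend on n: \<open>B1\<close> and \<open>C2\<close>
  contain q^(-n), and reversing their factorials turns the summands into the desired ones times a
  common factor \<open>K\<close>.\<close>

lemma product_coeff:
  fixes a b \<beta> :: complex
  assumes nz: "a \<noteq> 0" "b \<noteq> 0" "\<beta> \<noteq> 0"
    and \<beta>: "\<And>m n. \<beta> * q ^ m \<noteq> q ^ n" and c: "\<And>n. \<beta> * b * q ^ n \<noteq> 1"
    and ab: "\<And>n. q * a / b * q ^ n \<noteq> 1" and \<alpha>: "\<And>n. a * \<beta> * q ^ n \<noteq> 1"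
  shows "(\<Sum>k\<le>n. hyp (\<beta> * b / a) \<beta> (\<beta> * b) k * a ^ k * (hyp a (q * a / (\<beta> * b)) (q
      * a / b) (n - k) * \<beta> ^ (n - k)))
       = (\<Sum>k\<le>n. d_coeff a b \<beta> k * (- 1) ^ k / q ^ (\<Sum>{..<k}) * ((1 / q ^ k) ^ (n - k) * qbin (a
           * \<beta> * q ^ (2 * k)) (n - k)))"
proof -
  define A1 B1 C1 A2 B2 C2 u where "A1 = \<beta> * b / a" and "B1 = b / a / q ^ n" and "C1 = \<beta> * b"
    and "A2 = a" and "B2 = q * a / (\<beta> * b)" and "C2 = q / \<beta> / q ^ n" and "u = b / (a * a * q ^ n)"
  note defs = A1_def B1_def C1_def A2_def B2_def C2_def u_def
  define K where "K = qpoch (q * a / b) q n / qpoch \<beta> q n * (- b / (q * a * a)) ^ n / q ^ (\<Sum>{..<n})"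
  have \<beta>1: "\<beta> * q ^ m \<noteq> 1" for m using \<beta>[of m 0] by simp
  have nzp: "qpoch \<beta> q m \<noteq> 0" "qpoch (\<beta> * b) q m \<noteq> 0" "qpoch (q * a / b) q m \<noteq> 0"
      "qpoch (a * \<beta>) q m \<noteq> 0"
     "qpoch q q m \<noteq> 0" for m
    by (intro qpoch_nonzero \<beta>1 c ab \<alpha> q_mult_power_neq_1)+
  \<comment> \<open>Here \<beta> must avoid all integral powers of q, as the lower parameter
    \<open>C2\<close> is q^(1-n) / \<beta>.\<close>
  have C2: "C2 * q ^ m \<noteq> 1" for m
    using \<beta>[of n "Suc m"] nz q_nz by (auto simp: C2_def field_simps)
  have sears: "hyp_fps A1 B1 C1 * fps_scale u (hyp_fps A2 B2 C2)
           = fps_scale u (hyp_fps (C1 / A1) (C1 / B1) C1) * hyp_fps (C2 / A2) (C2 / B2) C2"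
    by (rule sears_fps) (use nz q_nz c C2 in \<open>auto simp: defs field_simps\<close>)
  \<comment> \<open>The powers of -1 are hidden behind a name, so that they are treated as atoms in
    the field computations below.\<close>
  define sg :: "nat \<Rightarrow> complex" where "sg = (\<lambda>k. (- 1) ^ k)"
  have sg: "(- x) ^ k = sg k * x ^ k" for x k unfolding sg_def by (rule power_minus)
  have sg_add: "sg k * sg (j + k) = sg j" "sg k \<noteq> 0" for j k
    by (simp_all add: sg_def power_add)
  have sgd: "x / sg k = x * sg k" for k x by (simp add: sg_def divide_inverse power_inverse[symmetric])
  have qn: "q ^ ((k + j) * k) = q ^ (\<Sum>{..<k}) * q ^ (\<Sum>{..<k}) * q ^ k * q ^ (k * j)"
      "q ^ ((k + j) * j) = q ^ (\<Sum>{..<j}) * q ^ (\<Sum>{..<j}) * q ^ j * q ^ (k * j)"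
      "q ^ (\<Sum>{..<k + j}) = q ^ (\<Sum>{..<k}) * q ^ (\<Sum>{..<j}) * q ^ (k * j)" for k j
    unfolding distrib_right power_add power_square_sum_lessThan sum_lessThan_add by (simp_all add: mult_ac)
  have alg1: "A * B / (Q * C) * (U * (A' * B' / (Q' * C'))) = K * (A * Y / (Q * C) * V * (A' * B' / (Q' * X) * W))"
    if "B * (U / C') = K * (Y / X * (V * W))" for A B Q C U A' B' Q' C' Y X V W :: complex
  proof -
    have "A * B / (Q * C) * (U * (A' * B' / (Q' * C'))) = A / (Q * C) * (A' * B' / Q') * (B * (U / C'))"
      by (simp add: mult_ac)
    thus ?thesis unfolding that by (simp add: mult_ac)
  qed
  have alg2: "U * (A * G / (Q * C)) * ((X * R * An / (Ak * N)) * (Y * R * P / (Pk * N)) / (Qj * (Z * R * S / (Bk * N))))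
      = K * (A * Bk * A2 / (Q * Pk * C * Ak) * e / p * (w * (T / Qj)))"
    if "An * G = A2 * T" "N \<noteq> 0" "U * (X * R * (Y * R * P) / (N * (Z * R * S))) = K * (e / p * w)"
    for U A G Q C X R An Ak N Y P Pk Qj Z S Bk A2 e p w T :: complex
  proof -
    have "U * (A * G / (Q * C)) * ((X * R * An / (Ak * N)) * (Y * R * P / (Pk * N)) / (Qj * (Z * R * S / (Bk * N))))
       = A * Bk * (An * G) / (Q * C * Ak * Pk * Qj) * (U * (X * R * (Y * R * P) / (N * (Z * R * S))))"
      using that(2) by (simp add: divide_inverse mult_ac)
    thus ?thesis unfolding that by (simp add: mult_ac)
  qed
  have L: "hyp A1 B1 C1 k * (u ^ j * hyp A2 B2 C2 j)
      = K * (hyp (\<beta> * b / a) \<beta> (\<beta> * b) k * a ^ k * (hyp a (q * a / (\<beta> * b)) (q * a / b) j * \<beta> ^ j))"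
    if n: "n = k + j" for k j
  proof -
    have 1: "qpoch B1 q k = (- (b / a)) ^ k * q ^ (\<Sum>{..<k}) * qpoch (q * a / b) q n / (qpoch (q * a / b) q j * q ^ (n * k))"
      using qpoch_reverse_part[of "b / a" k j] nz nzp(3)[of j] q_nz by (simp add: B1_def n eq_divide_eq mult_ac)
    have 2: "qpoch C2 q j = (- (q / \<beta>)) ^ j * q ^ (\<Sum>{..<j}) * qpoch \<beta> q n / (qpoch \<beta> q k * q ^ (n * j))"
      using qpoch_reverse_part[of "q / \<beta>" j k] nz nzp(1)[of k] q_nz by (simp add: C2_def n eq_divide_eq mult_ac add.commute)
    have u: "u ^ j * q ^ (n * j) = (b / (a * a)) ^ j"
      using q_nz by (simp add: u_def power_divide power_mult power_mult_distrib)
    have "qpoch B1 q k * (u ^ j / qpoch C2 q j) = K * (qpoch \<beta> q k / qpoch (q * a / b) q j * (a ^ k * \<beta> ^ j))"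
    proof -
      have "qpoch B1 q k * (u ^ j / qpoch C2 q j) = (- (b / a)) ^ k * q ^ (\<Sum>{..<k}) * qpoch (q
          * a / b) q n / (qpoch (q * a / b) q j * q ^ (n * k))
          * ((u ^ j * q ^ (n * j)) * qpoch \<beta> q k / ((- (q / \<beta>)) ^ j * q ^ (\<Sum>{..<j}) * qpoch \<beta> q n))"
        unfolding 1 2 by simp
      also have "\<dots> = (sg k * b ^ k / a ^ k) * q ^ (\<Sum>{..<k}) * qpoch (q * a / b) q n / (qpoch (q
          * a / b) q j * q ^ (n * k))
          * ((b ^ j / (a ^ j * a ^ j)) * qpoch \<beta> q k / ((sg j * q ^ j / \<beta> ^ j) * q ^ (\<Sum>{..<j})
              * qpoch \<beta> q n))"
        unfolding u by (simp add: sg power_divide power_mult_distrib)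
      also have "\<dots> = K * (qpoch \<beta> q k / qpoch (q * a / b) q j * (a ^ k * \<beta> ^ j))"
        unfolding K_def unfolding n qn
        using nz q_nz nzp by (simp add: sgd sg power_divide power_mult_distrib power_add field_simps)
      finally show ?thesis .
    qed
    thus ?thesis unfolding hyp_def A1_def C1_def A2_def B2_def
      by (rule alg1)
  qed
  have R: "u ^ k * hyp (C1 / A1) (C1 / B1) C1 k * hyp (C2 / A2) (C2 / B2) C2 j
      = K * (d_coeff a b \<beta> k * (- 1) ^ k / q ^ (\<Sum>{..<k}) * ((1 / q ^ k) ^ j * qbin (a * \<beta> * q ^ (2 * k)) j))"
    if n: "n = k + j" for k j
  proof -
    have 2: "qpoch C2 q j = (- (q / \<beta>)) ^ j * q ^ (\<Sum>{..<j}) * qpoch \<beta> q n / (qpoch \<beta> q k * q ^ (n * j))"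
      using qpoch_reverse_part[of "q / \<beta>" j k] nz nzp(1)[of k] q_nz by (simp add: C2_def n eq_divide_eq mult_ac add.commute)
    have 3: "qpoch (C2 / A2) q j = (- (q / (a * \<beta>))) ^ j * q ^ (\<Sum>{..<j}) * qpoch (a
        * \<beta>) q n / (qpoch (a * \<beta>) q k * q ^ (n * j))"
      using qpoch_reverse_part[of "q / (a * \<beta>)" j k] nz nzp(4)[of k] q_nz
          by (simp add: C2_def A2_def n eq_divide_eq mult_ac add.commute)
    have e4: "C2 / B2 = b / a / q ^ n" using nz q_nz by (simp add: defs)
    have 4: "qpoch (C2 / B2) q j = (- (b / a)) ^ j * q ^ (\<Sum>{..<j}) * qpoch (q * a / b) q n / (qpoch (q
        * a / b) q k * q ^ (n * j))"
      unfolding e4 using qpoch_reverse_part[of "b / a" j k] nz nzp(3)[of k] q_nz by (simp add: n eq_divide_eq mult_ac add.commute)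
    have e5: "C1 / A1 = a" "C1 / B1 = a * \<beta> * q ^ n" using nz q_nz by (simp_all add: defs)
    \<comment> \<open>The second factorial starts where the first ends. Their total length n + k =
      2k + j is cut again at 2k, which produces the factorial of length 2k in
      \<open>d_coeff\<close>.\<close>
    have 5: "qpoch (a * \<beta>) q n * qpoch (a * \<beta> * q ^ n) q k = qpoch (a * \<beta>) q (2 * k) * qpoch (a
        * \<beta> * q ^ (2 * k)) q j"
      unfolding qpoch_add[symmetric] by (simp add: n mult_2 add_ac)
    have "u ^ k * ((- (q / (a * \<beta>))) ^ j * q ^ (\<Sum>{..<j}) * ((- (b / a)) ^ j * q ^ (\<Sum>{..<j})
        * qpoch (q * a / b) q n)
        / (q ^ (n * j) * ((- (q / \<beta>)) ^ j * q ^ (\<Sum>{..<j}) * qpoch \<beta> q n)))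
        = K * ((- 1) ^ k / q ^ (\<Sum>{..<k}) * (1 / q ^ k) ^ j)"
    proof -
      have u: "u ^ k = b ^ k / (a ^ k * a ^ k * q ^ (n * k))"
        by (simp add: u_def power_divide power_mult power_mult_distrib)
      have s: "(1 / q ^ k) ^ j = 1 / q ^ (k * j)" by (simp add: power_divide power_mult)
      show ?thesis
        unfolding K_def u s sg[of "q / (a * \<beta>)"] sg[of "b / a"] sg[of "q / \<beta>"] sg[of "b / (q * a * a)",
            unfolded minus_divide_left]
        unfolding n qn sg_def[symmetric]
        using nz q_nz nzp by (simp add: sgd sg power_divide power_mult_distrib power_add field_simps) (simp add: sg_add)
    qed
    thus ?thesis unfolding hyp_def e5 d_coeff_def qbin_def 2 3 4
      unfolding C1_def using q_nz by (intro alg2 5) auto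
  qed
  have K: "K \<noteq> 0" using nzp nz q_nz by (simp add: K_def)
  have "K * (\<Sum>k\<le>n. hyp (\<beta> * b / a) \<beta> (\<beta> * b) k * a ^ k * (hyp a (q * a / (\<beta>
      * b)) (q * a / b) (n - k) * \<beta> ^ (n - k)))
      = fps_nth (hyp_fps A1 B1 C1 * fps_scale u (hyp_fps A2 B2 C2)) n"
    unfolding fps_mult_nth sum_distrib_left atMost_atLeast0 by (intro sum.cong refl) (simp add: L)
  also have "\<dots> = K * (\<Sum>k\<le>n. d_coeff a b \<beta> k * (- 1) ^ k / q ^ (\<Sum>{..<k})
      * ((1 / q ^ k) ^ (n - k) * qbin (a * \<beta> * q ^ (2 * k)) (n - k)))"
    unfolding sears fps_mult_nth sum_distrib_left atMost_atLeast0 by (intro sum.cong refl) (simp add: R)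
  finally show ?thesis using K by (simp only: mult_cancel_left) blast
qed

end

section \<open>Complex analysis\<close>

text \<open>At a zero z0 of \<open>g\<close> the difference quotients F and G of \<open>f\<close>
  and \<open>g\<close> are holomorphic, and G(z0) is the nonzero derivative of \<open>g\<close>. So
  F / G is the holomorphic extension of f / g.\<close>

lemma holomorphic_quotient_simple_zeros:
  fixes f g :: "complex \<Rightarrow> complex"
  assumes S: "open S" and f: "f holomorphic_on S" and g: "g holomorphic_on S"
    and zeros: "\<And>z. z \<in> S \<Longrightarrow> g z = 0 \<Longrightarrow> f z = 0 \<and> deriv g z \<noteq> 0"
  obtains h where "h holomorphic_on S" "\<And>z. z \<in> S \<Longrightarrow> f z = g z * h z"
proof
  define h where "h = (\<lambda>z. if g z = 0 then deriv f z / deriv g z else f z / g z)"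
  show "f z = g z * h z" if "z \<in> S" for z
    using zeros[OF that] by (auto simp: h_def)
  have "h field_differentiable (at z0)" if z0: "z0 \<in> S" for z0
  proof (cases "g z0 = 0")
    case False
    define T where "T = {z \<in> S. g z \<noteq> 0}"
    have cg: "continuous_on S g" using g by (rule holomorphic_on_imp_continuous_on)
    have "open (S \<inter> g -` (- {0}))"
      by (rule continuous_open_preimage[OF cg S]) auto
    also have "S \<inter> g -` (- {0}) = T" by (auto simp: T_def)
    finally have T: "open T" .
    have "(\<lambda>z. f z / g z) holomorphic_on T"
      by (intro holomorphic_intros holomorphic_on_subset[OF f] holomorphic_on_subset[OF g]) (auto simp: T_def)
    hence "h holomorphic_on T" by (rule holomorphic_transform) (simp add: h_def T_def)
    moreover have "z0 \<in> T" using False z0 by (simp add: T_def)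
    ultimately show ?thesis using T holomorphic_on_imp_differentiable_at by blast
  next
    case True
    define F where "F = (\<lambda>z. if z = z0 then deriv f z0 else (f z - f z0) / (z - z0))"
    define G where "G = (\<lambda>z. if z = z0 then deriv g z0 else (g z - g z0) / (z - z0))"
    have z0': "z0 \<in> interior S" using S z0 by (simp add: interior_open)
    have F: "F holomorphic_on S" unfolding F_def by (rule pole_lemma[OF f z0'])
    have G: "G holomorphic_on S" unfolding G_def by (rule pole_lemma[OF g z0'])
    define T where "T = {z \<in> S. G z \<noteq> 0}"
    have cG: "continuous_on S G" using G by (rule holomorphic_on_imp_continuous_on)
    have "open (S \<inter> G -` (- {0}))"
      by (rule continuous_open_preimage[OF cG S]) auto
    also have "S \<inter> G -` (- {0}) = T" by (auto simp: T_def)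
    finally have T: "open T" .
    have "(\<lambda>z. F z / G z) holomorphic_on T"
      by (intro holomorphic_intros holomorphic_on_subset[OF F] holomorphic_on_subset[OF G]) (auto simp: T_def)
    moreover have "F z / G z = h z" if "z \<in> T" for z
    proof (cases "z = z0")
      case False
      have "f z0 = 0" using zeros[OF z0 True] by simp
      moreover have "g z \<noteq> 0" using that False True by (auto simp: T_def G_def)
      ultimately show ?thesis using False True by (simp add: F_def G_def h_def)
    qed (use True in \<open>simp add: F_def G_def h_def\<close>)
    ultimately have "h holomorphic_on T" by (rule holomorphic_transform)
    moreover have "z0 \<in> T" using z0 zeros[OF z0 True] by (simp add: T_def G_def)
    ultimately show ?thesis using T holomorphic_on_imp_differentiable_at by blast
  qed
  thus "h holomorphic_on S"
    unfolding holomorphic_on_def using field_differentiable_at_within by blast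
qed

text \<open>The maximum modulus principle is applied to h(z) / z^M on the annulus between the
  circles of radius r p^n and of a fixed radius R. As n grows the inner circle loses its influence,
  leaving |h(z)| <= B (|z| / R)^M for every M; then M tends to infinity.\<close>

lemma holomorphic_flat_on_circles_eq_0:
  fixes h :: "complex \<Rightarrow> complex" and p r \<rho> :: real
  assumes hol: "h holomorphic_on (ball 0 \<rho> - {0})"
    and p: "0 < p" "p < 1" and r: "0 < r" and \<rho>: "0 < \<rho>"
    and flat: "\<And>M :: nat. \<exists>C. \<forall>\<^sub>F n in sequentially. \<forall>z. norm z = r
        * p ^ n \<longrightarrow> norm (h z) \<le> C * (p ^ n) ^ M"
  shows "\<exists>R>0. R \<le> \<rho> \<and> (\<forall>z. 0 < norm z \<and> norm z < R \<longrightarrow> h z = 0)"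
proof -
  have lim0: "(\<lambda>n. r * p ^ n) \<longlonglongrightarrow> 0"
    by (intro tendsto_mult_right_zero LIMSEQ_power_zero) (use p in auto)
  have "\<forall>\<^sub>F n in sequentially. r * p ^ n < \<rho>"
    using order_tendstoD(2)[OF lim0 \<rho>] .
  then obtain n1 where n1: "r * p ^ n1 < \<rho>"
    by (meson eventually_sequentially order_refl)
  define R where "R = r * p ^ n1"
  have R: "0 < R" "R < \<rho>" using n1 p r by (simp_all add: R_def)
  have cont: "continuous_on (ball 0 \<rho> - {0}) h"
    using hol by (rule holomorphic_on_imp_continuous_on)
  have "compact (h ` sphere 0 R)"
    by (intro compact_continuous_image continuous_on_subset[OF cont]) (use R in auto)
  hence "bounded (h ` sphere 0 R)" by (rule compact_imp_bounded)
  then obtain B where B': "B > 0" "\<forall>y\<in>h ` sphere 0 R. norm y \<le> B"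
    unfolding bounded_pos by blast
  have B: "\<And>z. norm z = R \<Longrightarrow> norm (h z) \<le> B" "B > 0" using B' by auto
  have "h z = 0" if z: "0 < norm z" "norm z < R" for z
  proof -
    have bound: "norm (h z) \<le> B * (norm z / R) ^ M" for M
    proof -
      \<comment> \<open>The exponent is one more than M, so a factor p^n survives the division by
        z^M on the inner circle and tends to 0.\<close>
      obtain C where C: "\<forall>\<^sub>F n in sequentially. \<forall>z. norm z = r * p ^ n
          \<longrightarrow> norm (h z) \<le> C * (p ^ n) ^ Suc M"
        using flat by blast
      have ev: "\<forall>\<^sub>F n in sequentially. norm (h z / z ^ M) \<le> max (C / r ^ M * p ^ n) (B / R ^ M)"
        using C order_tendstoD(2)[OF lim0 z(1)] eventually_gt_at_top[of n1]
      proof eventually_elim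
        case (elim n)
        define A where "A = cball 0 R - ball (0 :: complex) (r * p ^ n)"
        have rn: "0 < r * p ^ n" using r p by simp
        have AS: "closure A \<subseteq> ball 0 \<rho> - {0}"
        proof -
          have "closed A" unfolding A_def by (intro closed_Diff) auto
          thus ?thesis using rn R by (auto simp: A_def closure_closed)
        qed
        have hol2: "(\<lambda>z. h z / z ^ M) holomorphic_on (ball 0 \<rho> - {0})"
          by (intro holomorphic_intros hol) auto
        show ?case
        proof (rule maximum_modulus_frontier[where S = A and f = "\<lambda>z. h z / z ^ M"])
          show "(\<lambda>z. h z / z ^ M) holomorphic_on interior A"
            using AS interior_subset closure_subset by (intro holomorphic_on_subset[OF hol2]) blast
          show "continuous_on (closure A) (\<lambda>z. h z / z ^ M)"
            by (rule continuous_on_subset[OF holomorphic_on_imp_continuous_on[OF hol2] AS])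
          show "bounded A" unfolding A_def by (rule bounded_subset[of "cball 0 R"]) auto
          show "z \<in> A" using z elim(2) by (auto simp: A_def)
          fix y assume "y \<in> frontier A"
          moreover have "closed A" unfolding A_def by (intro closed_Diff) auto
          ultimately have yA: "y \<in> A" "y \<notin> interior A" by (auto simp: frontier_def closure_closed)
          have sub: "ball 0 R - cball (0::complex) (r * p ^ n) \<subseteq> interior A"
            by (rule interior_maximal) (auto simp: A_def intro!: open_Diff)
          have "norm y = R \<or> norm y = r * p ^ n"
          proof (rule ccontr)
            assume "\<not> (norm y = R \<or> norm y = r * p ^ n)"
            hence "y \<in> ball 0 R - cball 0 (r * p ^ n)" using yA(1) by (auto simp: A_def)
            thus False using sub yA(2) by blast
          qed
          thus "norm (h y / y ^ M) \<le> max (C / r ^ M * p ^ n) (B / R ^ M)"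
          proof
            assume y: "norm y = R"
            have "norm (h y / y ^ M) \<le> B / R ^ M"
              using B(1)[OF y] R by (simp add: norm_divide norm_power y divide_right_mono)
            thus ?thesis by simp
          next
            assume y: "norm y = r * p ^ n"
            have "norm (h y) \<le> C * (p ^ n) ^ Suc M" using elim(1) y by blast
            hence "norm (h y / y ^ M) \<le> C * (p ^ n) ^ Suc M / (r * p ^ n) ^ M"
              using rn by (simp add: norm_divide norm_power y divide_right_mono)
            also have "\<dots> = C / r ^ M * p ^ n"
              using p r by (simp add: power_mult_distrib)
            finally show ?thesis by simp
          qed
        qed
      qed
      have "(\<lambda>n. max (C / r ^ M * p ^ n) (B / R ^ M)) \<longlonglongrightarrow> max (C / r ^ M * 0) (B / R ^ M)"
        by (intro tendsto_intros LIMSEQ_power_zero) (use p in auto)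
      from tendsto_lowerbound[OF this ev] have "norm (h z / z ^ M) \<le> B / R ^ M"
        using B R by (simp add: max_def split: if_splits)
      thus ?thesis using z R by (simp add: norm_divide norm_power power_divide field_simps)
    qed
    have "(\<lambda>M. B * (norm z / R) ^ M) \<longlonglongrightarrow> 0"
      by (intro tendsto_mult_right_zero LIMSEQ_power_zero) (use z R in auto)
    from tendsto_lowerbound[OF this always_eventually[OF allI[OF bound]]] show "h z = 0" by simp
  qed
  thus ?thesis using R by (intro exI[of _ R]) auto
qed

text \<open>After division by x^M there is still a power series, so the quotient is bounded near 0.
  At the point 0 itself the cases M = 0 and M > 0 differ.\<close>

lemma has_fps_expansion_bigo:
  fixes f :: "complex \<Rightarrow> complex"
  assumes f: "f has_fps_expansion F" and F: "\<And>n. n < M \<Longrightarrow> fps_nth F n = 0"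
  shows "\<exists>C. eventually (\<lambda>z. norm (f z) \<le> C * norm z ^ M) (nhds 0)"
proof (cases "F = 0")
  case True
  hence "eventually (\<lambda>z. 0 = f z) (nhds 0)" using f by (simp add: has_fps_expansion_def)
  hence "eventually (\<lambda>z. norm (f z) \<le> 0 * norm z ^ M) (nhds 0)" by eventually_elim auto
  thus ?thesis by blast
next
  case False
  have M: "M \<le> subdegree F" by (rule subdegree_geI[OF False F])
  define g where "g = (\<lambda>x. if x = 0 then fps_nth F M else f x / x ^ M)"
  have g: "g has_fps_expansion fps_shift M F"
    unfolding g_def by (rule has_fps_expansion_shift[OF f M refl])
  have "(g \<longlongrightarrow> fps_nth (fps_shift M F) 0) (nhds 0)" by (rule has_fps_expansion_imp_tendsto_0[OF g])
  hence "((\<lambda>z. norm (g z)) \<longlongrightarrow> norm (fps_nth F M)) (nhds 0)" by (intro tendsto_norm) simp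
  hence ev: "eventually (\<lambda>z. norm (g z) < norm (fps_nth F M) + 1) (nhds 0)"
    by (rule order_tendstoD) simp
  have "eventually (\<lambda>z. eval_fps F z = f z) (nhds 0)" using f by (simp add: has_fps_expansion_def)
  hence "eval_fps F 0 = f 0" by (rule eventually_nhds_x_imp_x)
  hence f0: "f 0 = fps_nth F 0" by (simp add: eval_fps_at_0)
  from ev have "eventually (\<lambda>z. norm (f z) \<le> (norm (fps_nth F M) + 1) * norm z ^ M) (nhds 0)"
  proof eventually_elim
    case (elim z)
    show ?case
    proof (cases "z = 0")
      case True
      show ?thesis using F[of 0] f0 True by (cases "M = 0") auto
    next
      case False
      hence "f z = g z * z ^ M" by (simp add: g_def)
      thus ?thesis using elim by (simp add: norm_mult norm_power mult_right_mono)
    qed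
  qed
  thus ?thesis by blast
qed

text \<open>The neighbourhood depends on the point, but the bound is uniform in the index. With a
  geometric factor this is what the Weierstrass test requires.\<close>

definition locally_unif_bounded :: "complex set \<Rightarrow> (nat \<Rightarrow> complex
    \<Rightarrow> complex) \<Rightarrow> bool" where
  "locally_unif_bounded S F \<longleftrightarrow> (\<forall>x\<in>S. \<exists>C. eventually (\<lambda>y. \<forall>k. norm (F k y) \<le> C) (nhds x))"

lemma locally_unif_bounded_mult:
  assumes "locally_unif_bounded S F" "locally_unif_bounded S G"
  shows "locally_unif_bounded S (\<lambda>k y. F k y * G k y)"
  unfolding locally_unif_bounded_def
proof
  fix x assume "x \<in> S"
  then obtain C D where "eventually (\<lambda>y. \<forall>k. norm (F k y) \<le> C) (nhds x)"
      "eventually (\<lambda>y. \<forall>k. norm (G k y) \<le> D) (nhds x)"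
    using assms unfolding locally_unif_bounded_def by blast
  hence "eventually (\<lambda>y. \<forall>k. norm (F k y * G k y) \<le> C * D) (nhds x)"
  proof eventually_elim
    case (elim y)
    have "C \<ge> 0" using elim(1) norm_ge_zero order_trans by blast
    thus ?case using elim by (auto simp: norm_mult intro!: mult_mono)
  qed
  thus "\<exists>C. eventually (\<lambda>y. \<forall>k. norm (F k y * G k y) \<le> C) (nhds x)" by blast
qed

lemma locally_unif_bounded_const: "(\<And>k. norm (c k) \<le> C) \<Longrightarrow> locally_unif_bounded S (\<lambda>k y. c k)"
  unfolding locally_unif_bounded_def by (auto intro!: exI[of _ C] always_eventually)

lemma locally_unif_bounded_continuous:
  assumes "open S" "continuous_on S f"
  shows "locally_unif_bounded S (\<lambda>k y. f y)"
  unfolding locally_unif_bounded_def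
proof
  fix x assume "x \<in> S"
  hence "isCont f x" using assms by (simp add: continuous_on_eq_continuous_at)
  hence "((\<lambda>y. norm (f y)) \<longlongrightarrow> norm (f x)) (nhds x)"
    by (intro tendsto_norm) (simp add: isCont_def tendsto_at_iff_tendsto_nhds)
  hence "eventually (\<lambda>y. norm (f y) < norm (f x) + 1) (nhds x)" by (rule order_tendstoD) simp
  thus "\<exists>C. eventually (\<lambda>y. \<forall>k::nat. norm (f y) \<le> C) (nhds x)"
    by (intro exI[of _ "norm (f x) + 1"]) (auto elim: eventually_mono)
qed

lemma holomorphic_on_geometric_series:
  fixes F :: "nat \<Rightarrow> complex \<Rightarrow> complex"
  assumes S: "open S" and hol: "\<And>k. F k holomorphic_on S" and bd: "locally_unif_bounded S F"
    and q: "norm q < 1"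
  shows "(\<lambda>x. \<Sum>k. q ^ k * F k x) holomorphic_on S"
proof (rule holomorphic_uniform_sequence[where f = "\<lambda>n x. \<Sum>k<n. q ^ k * F k x"])
  show "open S" by fact
  show "(\<lambda>x. \<Sum>k<n. q ^ k * F k x) holomorphic_on S" for n
    by (intro holomorphic_intros hol)
  fix x assume x: "x \<in> S"
  then obtain C where C: "eventually (\<lambda>y. \<forall>k. norm (F k y) \<le> C) (nhds x)"
    using bd unfolding locally_unif_bounded_def by blast
  have "eventually (\<lambda>y. y \<in> S) (nhds x)" using S x by (rule eventually_nhds_in_open)
  with C have "eventually (\<lambda>y. y \<in> S \<and> (\<forall>k. norm (F k y) \<le> C)) (nhds x)" by eventually_elim auto
  then obtain T where T: "open T" "x \<in> T" "\<And>y. y \<in> T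
      \<Longrightarrow> y \<in> S \<and> (\<forall>k. norm (F k y) \<le> C)"
    unfolding eventually_nhds by blast
  from T(1,2) obtain d where d: "d > 0" "cball x d \<subseteq> T" by (meson open_contains_cball)
  have "uniform_limit (cball x d) (\<lambda>n x. \<Sum>k<n. q ^ k * F k x) (\<lambda>x. \<Sum>k. q ^ k * F k x) sequentially"
  proof (rule Weierstrass_m_test)
    show "summable (\<lambda>k. norm q ^ k * C)" using q by (intro summable_mult2) simp
    fix k y assume "y \<in> cball x d"
    hence "norm (F k y) \<le> C" using T d by blast
    thus "norm (q ^ k * F k y) \<le> norm q ^ k * C" by (simp add: norm_mult norm_power mult_left_mono)
  qed
  thus "\<exists>d>0. cball x d \<subseteq> S \<and> uniform_limit (cball x d) (\<lambda>n x. \<Sum>k<n. q ^ k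
      * F k x) (\<lambda>x. \<Sum>k. q ^ k * F k x) sequentially"
    using d T by (intro exI[of _ d]) auto
qed

context qbase
begin

lemma locally_unif_bounded_qpoch_inf:
  assumes "locally_unif_bounded S G"
  shows "locally_unif_bounded S (\<lambda>k y. qpoch_inf (G k y) q)"
  unfolding locally_unif_bounded_def
proof
  fix x assume "x \<in> S"
  then obtain C where "eventually (\<lambda>y. \<forall>k. norm (G k y) \<le> C) (nhds x)"
    using assms unfolding locally_unif_bounded_def by blast
  hence "eventually (\<lambda>y. \<forall>k. norm (qpoch_inf (G k y) q) \<le> exp (C / (1 - norm q))) (nhds x)"
    by eventually_elim (auto intro: norm_qpoch_inf_le')
  thus "\<exists>C. eventually (\<lambda>y. \<forall>k. norm (qpoch_inf (G k y) q) \<le> C) (nhds x)" by blast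
qed

lemma locally_unif_bounded_qpoch:
  assumes "locally_unif_bounded S G"
  shows "locally_unif_bounded S (\<lambda>k y. qpoch (G k y) q (n k))"
  unfolding locally_unif_bounded_def
proof
  fix x assume "x \<in> S"
  then obtain C where "eventually (\<lambda>y. \<forall>k. norm (G k y) \<le> C) (nhds x)"
    using assms unfolding locally_unif_bounded_def by blast
  hence "eventually (\<lambda>y. \<forall>k. norm (qpoch (G k y) q (n k)) \<le> exp (C / (1 - norm q))) (nhds x)"
    by eventually_elim (auto intro: norm_qpoch_le')
  thus "\<exists>C. eventually (\<lambda>y. \<forall>k. norm (qpoch (G k y) q (n k)) \<le> C) (nhds x)" by blast
qed

lemma locally_unif_bounded_times_qpow:
  assumes "open S" "continuous_on S f"
  shows "locally_unif_bounded S (\<lambda>k y. f y * q ^ n k)"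
  using norm_q by (intro locally_unif_bounded_mult locally_unif_bounded_continuous locally_unif_bounded_const[of _ 1] assms)
    (simp add: norm_power power_le_one)

end

lemma has_fps_expansion_scale:
  assumes "f has_fps_expansion F"
  shows "(\<lambda>y. f (u * y)) has_fps_expansion fps_scale u F"
proof -
  have "(f \<circ> (\<lambda>y. u * y)) has_fps_expansion fps_compose F (fps_const u * fps_X)"
    by (intro has_fps_expansion_compose assms fps_expansion_intros) simp
  thus ?thesis by (simp add: o_def fps_compose_linear fps_scale_def)
qed

section \<open>Expansions at 0 and the growth of theta on circles\<close>

context qbase
begin

lemma qpoch_inf_nonzero_norm: "norm a < 1 \<Longrightarrow> qpoch_inf a q \<noteq> 0"
proof (rule qpoch_inf_nonzero)
  fix n assume "norm a < 1"
  hence "norm (a * q ^ n) < 1"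
    using norm_q_power_le_1[of n] by (simp add: norm_mult) (metis mult_left_le norm_ge_zero norm_power order_le_less_trans)
  thus "a * q ^ n \<noteq> 1" by auto
qed

text \<open>The q-binomial theorem. The quotient is analytic at 0, and its expansion obeys the
  functional equation that characterises \<open>qbin_fps\<close>.\<close>

lemma qbin_expansion: "(\<lambda>y. qpoch_inf (u * y) q / qpoch_inf y q) has_fps_expansion qbin_fps u"
proof -
  define h where "h = (\<lambda>y. qpoch_inf (u * y) q / qpoch_inf y q)"
  have "h holomorphic_on ball 0 1"
    unfolding h_def by (intro holomorphic_intros) (simp add: qpoch_inf_nonzero_norm)
  hence "h analytic_on {0}" by (simp add: analytic_at) (meson centre_in_ball open_ball zero_less_one)
  then have F: "h has_fps_expansion fps_expansion h 0"
    by (rule analytic_at_imp_has_fps_expansion_0)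
  define F where "F = fps_expansion h 0"
  have hF: "h has_fps_expansion F" using F by (simp add: F_def)
  have 1: "(\<lambda>y. (1 - y) * h y) has_fps_expansion (1 - fps_X) * F"
    by (intro fps_expansion_intros hF)
  have 2: "(\<lambda>y. (1 - u * y) * h (q * y)) has_fps_expansion (1 - fps_const u * fps_X) * fps_scale q F"
    by (intro fps_expansion_intros has_fps_expansion_scale hF)
  have "eventually (\<lambda>y. y \<in> ball 0 1) (nhds (0::complex))" by (intro eventually_nhds_in_open) auto
  hence "eventually (\<lambda>y. (1 - y) * h y = (1 - u * y) * h (q * y)) (nhds 0)"
  proof eventually_elim
    case (elim y)
    have n1: "qpoch_inf y q \<noteq> 0" using elim by (intro qpoch_inf_nonzero_norm) simp
    have e: "qpoch_inf (u * y) q = (1 - u * y) * qpoch_inf (u * y * q) q" "qpoch_inf y q = (1 - y) * qpoch_inf (y * q) q"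
      by (rule qpoch_inf_Suc)+
    show ?case using n1 unfolding h_def e by (simp add: mult_ac)
  qed
  hence "(\<lambda>y. (1 - y) * h y) has_fps_expansion (1 - fps_const u * fps_X) * fps_scale q F"
    using 2 by (subst has_fps_expansion_cong[OF _ refl]) auto
  hence "(1 - fps_X) * F = (1 - fps_const u * fps_X) * fps_scale q F"
    by (rule fps_expansion_unique_complex[OF 1])
  moreover have "fps_nth F 0 = 1"
    using has_fps_expansion_imp_0_eq_fps_nth_0[OF hF] by (simp add: h_def)
  ultimately have "F = qbin_fps u" by (rule qbin_fps_unique)
  thus ?thesis using hF by (simp add: h_def)
qed

lemma hyp_bounded:
  assumes "\<And>n. C * q ^ n \<noteq> 1"
  obtains K where "\<And>n. norm (hyp A B C n) \<le> K"
proof -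
  obtain K1 where K1: "\<And>k m. norm (inverse (qpoch (q * q ^ k) q m)) \<le> K1"
    using inverse_qpoch_bounded[of q] q_mult_power_neq_1 by metis
  obtain K2 where K2: "\<And>k m. norm (inverse (qpoch (C * q ^ k) q m)) \<le> K2"
    using inverse_qpoch_bounded[OF assms] by metis
  have K1': "norm (inverse (qpoch q q n)) \<le> K1" for n using K1[of 0 n] by simp
  have K2': "norm (inverse (qpoch C q n)) \<le> K2" for n using K2[of 0 n] by simp
  have "K1 \<ge> 0" "K2 \<ge> 0" using K1' K2' norm_ge_zero order_trans by blast+
  hence "norm (qpoch A q n * qpoch B q n * (inverse (qpoch q q n) * inverse (qpoch C q n)))
     \<le> exp (norm A / (1 - norm q)) * exp (norm B / (1 - norm q)) * (K1 * K2)" for n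
    unfolding norm_mult by (intro mult_mono norm_qpoch_le K1' K2' mult_nonneg_nonneg) auto
  thus ?thesis by (intro that) (simp add: hyp_def divide_inverse)
qed

lemma hyp_fps_conv_radius:
  assumes "\<And>n. C * q ^ n \<noteq> 1"
  shows "fps_conv_radius (hyp_fps A B C) \<ge> 1"
  unfolding fps_conv_radius_def one_ereal_def
proof (rule conv_radius_geI_ex')
  obtain K where K: "\<And>n. norm (hyp A B C n) \<le> K" using hyp_bounded[OF assms] by metis
  fix r :: real assume r: "0 < r" "ereal r < ereal 1"
  show "summable (\<lambda>n. fps_nth (hyp_fps A B C) n * of_real r ^ n)"
  proof (rule summable_comparison_test')
    show "summable (\<lambda>n. K * r ^ n)" using r by (intro summable_mult) simp
    fix n show "norm (fps_nth (hyp_fps A B C) n * of_real r ^ n) \<le> K * r ^ n"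
      using K[of n] r by (simp add: norm_mult norm_power mult_right_mono)
  qed
qed

text \<open>Induction over the circles, from y to x = y q. The norm of theta is multiplied by 1/|y|
  = 1/(r |q|^n), that of the tail at most by 1 + |q|^M / (r |q|^n). The quotient of tail and theta
  thus gains |q|^M times 1 + (r / |q|^M) |q|^n, and the product of the latter factors over all n is
  bounded. On the first circle theta has no zero because |q| < r < 1.\<close>

lemma norm_tail_theta_le:
  fixes r :: real
  assumes r: "norm q < r" "r < 1"
  shows "\<exists>C. \<forall>n x k. norm x = r * norm q ^ n \<longrightarrow> M \<le> k \<longrightarrow>
    norm (qpoch_inf (q / x * q ^ k) q) \<le> C * (norm q ^ n) ^ M * norm (qtheta x q)"
proof -
  define p where "p = norm q"
  have p: "0 < p" "p < 1" using norm_q q_nz by (simp_all add: p_def)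
  have r0: "0 < r" using p(1) r(1) unfolding p_def by (rule less_trans)
  have theta_nz: "qtheta x q \<noteq> 0" if "norm x = r" for x
  proof -
    have "norm (q / x) < 1" using that r r0 by (simp add: norm_divide)
    thus ?thesis using that r by (simp add: qtheta_eq qpoch_inf_nonzero_norm)
  qed
  have "continuous_on (sphere 0 r) (\<lambda>x. qtheta x q)"
    unfolding qtheta_eq by (intro holomorphic_on_imp_continuous_on holomorphic_intros) (use r0 in auto)
  hence "continuous_on (sphere 0 r) (\<lambda>x. inverse (qtheta x q))"
    by (intro continuous_intros) (use theta_nz in auto)
  hence "compact ((\<lambda>x. inverse (qtheta x q)) ` sphere 0 r)" by (intro compact_continuous_image) auto
  from compact_imp_bounded[OF this] obtain B where B: "B > 0"
      "\<forall>y\<in>(\<lambda>x. inverse (qtheta x q)) ` sphere 0 r. norm y \<le> B"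
    unfolding bounded_pos by blast
  define C0 where "C0 = exp ((p / r) / (1 - p)) * B"
  have C0: "C0 \<ge> 0" using B by (simp add: C0_def)
  define c where "c = (\<lambda>n. \<Prod>j<n. 1 + r / p ^ M * p ^ j)"
  have main: "norm (qpoch_inf (q / x * q ^ k) q) \<le> C0 * (p ^ n) ^ M * c n * norm (qtheta x q)"
    if "norm x = r * p ^ n" "M \<le> k" for n x k
    using that
  proof (induction n arbitrary: x)
    case 0
    hence x: "norm x = r" by simp
    have "norm (q / x * q ^ k) \<le> p / r"
      by (rule norm_mult_q_power_le) (simp add: norm_divide x p_def)
    hence 1: "norm (qpoch_inf (q / x * q ^ k) q) \<le> exp ((p / r) / (1 - p))"
      unfolding p_def by (rule norm_qpoch_inf_le')
    have "norm (inverse (qtheta x q)) \<le> B" using B x by auto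
    hence "norm (inverse (qtheta x q)) * norm (qtheta x q) \<le> B * norm (qtheta x q)"
      by (rule mult_right_mono) simp
    hence "1 \<le> B * norm (qtheta x q)"
      unfolding norm_mult[symmetric] using theta_nz[OF x] by simp
    hence "exp ((p / r) / (1 - p)) * 1 \<le> exp ((p / r) / (1 - p)) * (B * norm (qtheta x q))"
      by (intro mult_left_mono) auto
    from order.trans[OF 1 this[unfolded mult_1_right]] show ?case
      by (simp add: C0_def c_def mult.assoc)
  next
    case (Suc n)
    define y where "y = x / q"
    have x: "x = y * q" using q_nz by (simp add: y_def)
    have y: "norm y = r * p ^ n" using Suc.prems(1) p unfolding y_def by (simp add: norm_divide p_def)
    have y0: "y \<noteq> 0" using y r0 p by auto
    have th: "norm (qtheta y q) = r * p ^ n * norm (qtheta x q)"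
      unfolding x qtheta_shift[OF y0] using y y0 by (simp add: norm_divide norm_minus_cancel flip: y)
    have "q / x * q ^ k = q ^ k / y" using q_nz by (simp add: x)
    hence "qpoch_inf (q / x * q ^ k) q = (1 - q ^ k / y) * qpoch_inf (q / y * q ^ k) q"
      using qpoch_inf_Suc[of "q ^ k / y"] by (simp add: mult_ac)
    hence "norm (qpoch_inf (q / x * q ^ k) q) = norm (1 - q ^ k / y) * norm (qpoch_inf (q / y * q ^ k) q)"
      by (simp add: norm_mult)
    also have "\<dots> \<le> (1 + p ^ M / (r * p ^ n)) * (C0 * (p ^ n) ^ M * c n * norm (qtheta y q))"
    proof (intro mult_mono Suc.IH y Suc.prems)
      have "norm (1 - q ^ k / y) \<le> 1 + norm (q ^ k / y)"
        by (rule order.trans[OF norm_triangle_ineq4]) simp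
      also have "norm (q ^ k / y) = p ^ k / (r * p ^ n)" by (simp add: norm_divide norm_power y p_def)
      also have "\<dots> \<le> p ^ M / (r * p ^ n)"
        using p r0 Suc.prems(2) by (intro divide_right_mono power_decreasing) auto
      finally show "norm (1 - q ^ k / y) \<le> 1 + p ^ M / (r * p ^ n)" by simp
    qed (use p r0 in auto)
    also have "\<dots> = C0 * (p ^ Suc n) ^ M * c (Suc n) * norm (qtheta x q)"
      unfolding th c_def using p r0 by (simp add: field_simps power_mult_distrib)
    finally show ?case .
  qed
  define K where "K = exp (r / p ^ M / (1 - p))"
  have cK: "c n \<le> K" for n
  proof -
    have "c n \<le> exp (\<Sum>j<n. r / p ^ M * p ^ j)"
      unfolding c_def using r0 p by (intro prod_le_exp_sum) auto
    also have "(\<Sum>j<n. r / p ^ M * p ^ j) \<le> (\<Sum>j. r / p ^ M * p ^ j)"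
      using r0 p by (intro sum_le_suminf summable_mult) auto
    also have "\<dots> = r / p ^ M / (1 - p)" using p by (subst suminf_mult) (auto simp: suminf_geometric)
    finally show ?thesis by (simp add: K_def)
  qed
  have "norm (qpoch_inf (q / x * q ^ k) q) \<le> C0 * K * (p ^ n) ^ M * norm (qtheta x q)"
    if "norm x = r * p ^ n" "M \<le> k" for n x k
  proof -
    have "C0 * (p ^ n) ^ M * c n * norm (qtheta x q) \<le> C0 * (p ^ n) ^ M * K * norm (qtheta x q)"
      using C0 p by (intro mult_right_mono mult_left_mono cK) auto
    thus ?thesis using main[OF that] by (simp add: mult_ac)
  qed
  thus ?thesis unfolding p_def by blast
qed

text \<open>The limit k -> infinity of the preceding bound, in which the tail tends to 1.\<close>

lemma one_le_theta_circle:
  fixes r :: real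
  assumes r: "norm q < r" "r < 1"
  shows "\<exists>C. \<forall>n x. norm x = r * norm q ^ n \<longrightarrow> 1 \<le> C * (norm q ^ n) ^ M * norm (qtheta x q)"
proof -
  obtain C where C: "\<And>n x k. norm x = r * norm q ^ n \<Longrightarrow> M \<le> k \<Longrightarrow>
    norm (qpoch_inf (q / x * q ^ k) q) \<le> C * (norm q ^ n) ^ M * norm (qtheta x q)"
    using norm_tail_theta_le[OF assms, of M] by blast
  have "1 \<le> C * (norm q ^ n) ^ M * norm (qtheta x q)" if x: "norm x = r * norm q ^ n" for n x
  proof -
    have "(\<lambda>k. q / x * q ^ k) \<longlonglongrightarrow> 0"
      by (intro tendsto_mult_right_zero LIMSEQ_power_zero norm_q)
    hence "(\<lambda>k. norm (qpoch_inf (q / x * q ^ k) q)) \<longlonglongrightarrow> norm (qpoch_inf 0 q)"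
      by (intro tendsto_intros)
    hence lim: "(\<lambda>k. norm (qpoch_inf (q / x * q ^ k) q)) \<longlonglongrightarrow> 1" by simp
    have "eventually (\<lambda>k. norm (qpoch_inf (q / x * q ^ k) q) \<le> C * (norm q ^ n) ^ M * norm (qtheta x q)) sequentially"
      using eventually_ge_at_top[of M] by eventually_elim (rule C[OF x])
    from tendsto_upperbound[OF lim this] show ?thesis by simp
  qed
  thus ?thesis by blast
qed

end

section \<open>The product formula\<close>

locale qprod = qbase +
  fixes a b \<beta> :: complex
  assumes nz: "a \<noteq> 0" "b \<noteq> 0" "\<beta> \<noteq> 0"
    and \<beta>_pow: "\<And>m n. \<beta> * q ^ m \<noteq> q ^ n"
    and c_pow: "\<And>n. \<beta> * b * q ^ n \<noteq> 1"
    and ab_pow: "\<And>n. q * a / b * q ^ n \<noteq> 1"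
    and \<alpha>_pow: "\<And>n. a * \<beta> * q ^ n \<noteq> 1"
    and a_pow: "\<And>n. a * q ^ n \<noteq> 1"
begin

lemma \<beta>_pow1: "\<beta> * q ^ n \<noteq> 1"
  using \<beta>_pow[of n 0] by simp

abbreviation \<alpha> :: complex where "\<alpha> \<equiv> a * \<beta>"

abbreviation d :: "nat \<Rightarrow> complex" where "d \<equiv> d_coeff a b \<beta>"

definition f1 :: "complex \<Rightarrow> complex" where
  "f1 = eval_fps (hyp_fps a b (\<beta> * b))"

definition f2 :: "complex \<Rightarrow> complex" where
  "f2 = eval_fps (hyp_fps a (q * a / (\<beta> * b)) (q * a / b))"

definition t1 :: "nat \<Rightarrow> complex \<Rightarrow> complex" where
  "t1 k x = d k * (qpoch_inf (\<alpha> * x * q ^ k) q * qpoch_inf (q / x * q ^ k) q)"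

text \<open>Chosen so that at x = q^m it matches the summand of \<open>W1\<close> whose index is
  larger by m; see \<open>W_residue_match\<close>.\<close>

definition t2 :: "nat \<Rightarrow> complex \<Rightarrow> complex" where
  "t2 k x = qpoch_inf (q * x * q ^ k) q * qpoch_inf (q * a / b * x * q ^ k) q
     * qpoch_inf (\<beta> * b * x * q ^ k) q * qpoch_inf (\<alpha> * x * q ^ k) q
     * qpoch (\<alpha> * x\<^sup>2 * q ^ k) q k * qpoch (a * x) q k * qpoch (\<beta> * x) q k * inverse (qpoch q q k)"

definition W1 :: "complex \<Rightarrow> complex" where "W1 x = (\<Sum>k. q ^ k * t1 k x)"
definition W2 :: "complex \<Rightarrow> complex" where "W2 x = (\<Sum>k. q ^ k * t2 k x)"

text \<open>The constant for which the two series cancel at every x = q^m with m > 0.\<close>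

definition lam :: complex where
  "lam = qpoch_inf a q * qpoch_inf \<beta> q / (qpoch_inf (q * a / b) q * qpoch_inf (\<beta> * b) q)"

definition defect :: "complex \<Rightarrow> complex" where
  "defect x = qpoch_inf (a * x) q * qpoch_inf (\<beta> * x) q * W1 x - lam * x * W2 x
     - qtheta x q * qpoch_inf (\<beta> * x) q ^ 2 * f1 (\<beta> * x) * f2 (\<beta> * x)"

lemma d_bounded: obtains K where "\<And>k. norm (d k) \<le> K"
proof -
  have inv: "\<exists>K. \<forall>n. norm (inverse (qpoch c q n)) \<le> K" if "\<And>n. c * q ^ n \<noteq> 1" for c
    using inverse_qpoch_bounded[OF that] by (metis mult.right_neutral power_0)
  from inv[OF q_mult_power_neq_1] inv[OF c_pow] inv[OF ab_pow] inv[OF \<alpha>_pow]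
  obtain K1 K2 K3 K4 where K: "\<And>n. norm (inverse (qpoch q q n)) \<le> K1"
      "\<And>n. norm (inverse (qpoch (\<beta> * b) q n)) \<le> K2"
     "\<And>n. norm (inverse (qpoch (q * a / b) q n)) \<le> K3" "\<And>n. norm (inverse (qpoch \<alpha> q n)) \<le> K4" by blast
  have K0: "K1 \<ge> 0" "K2 \<ge> 0" "K3 \<ge> 0" "K4 \<ge> 0" using K norm_ge_zero order_trans by blast+
  have "norm (qpoch a q k * qpoch \<beta> q k * qpoch \<alpha> q (2 * k) *
     (inverse (qpoch q q k) * inverse (qpoch (q * a / b) q k) * inverse (qpoch (\<beta> * b) q k) * inverse (qpoch \<alpha> q k)))
     \<le> exp (norm a / (1 - norm q)) * exp (norm \<beta> / (1 - norm q)) * exp (norm \<alpha> / (1 - norm q))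
         * (K1 * K3 * K2 * K4)" for k
    unfolding norm_mult[of _ "inverse _"] norm_mult[of "_ * qpoch _ _ _"] norm_mult[of "qpoch _ _ _" "qpoch _ _ _"]
    unfolding norm_mult[of "_ * _"]
    by (intro mult_mono norm_qpoch_le K mult_nonneg_nonneg K0) auto
  thus ?thesis by (intro that) (simp add: d_coeff_def divide_inverse mult_ac)
qed

lemma inverse_qpoch_q_bounded: obtains K where "\<And>k. norm (inverse (qpoch q q k)) \<le> K"
  using inverse_qpoch_bounded[OF q_mult_power_neq_1] by (metis mult.right_neutral power_0)

lemma t1_bounded: "locally_unif_bounded (- {0}) t1"
proof -
  obtain K where K: "\<And>k. norm (d k) \<le> K" using d_bounded by metis
  show ?thesis unfolding t1_def[abs_def]
    by (intro locally_unif_bounded_mult locally_unif_bounded_const[of d, OF K]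
        locally_unif_bounded_qpoch_inf locally_unif_bounded_times_qpow continuous_intros) auto
qed

lemma t2_bounded: "locally_unif_bounded UNIV t2"
proof -
  obtain K where K: "\<And>k. norm (inverse (qpoch q q k)) \<le> K" using inverse_qpoch_q_bounded by metis
  have L1: "locally_unif_bounded UNIV (\<lambda>k y. c * y * q ^ k)" for c
    by (rule locally_unif_bounded_times_qpow) (auto intro!: continuous_intros)
  have L2: "locally_unif_bounded UNIV (\<lambda>k y. \<alpha> * y\<^sup>2 * q ^ k)"
    by (rule locally_unif_bounded_times_qpow) (auto intro!: continuous_intros)
  have L3: "locally_unif_bounded UNIV (\<lambda>k y. c * y)" for c
    by (rule locally_unif_bounded_continuous) (auto intro!: continuous_intros)
  show ?thesis unfolding t2_def[abs_def]
    by (intro locally_unif_bounded_mult[OF _ locally_unif_bounded_qpoch_inf[OF L1]]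
        locally_unif_bounded_mult[OF _ locally_unif_bounded_qpoch[OF L2]]
        locally_unif_bounded_mult[OF _ locally_unif_bounded_qpoch[OF L3]]
        locally_unif_bounded_mult[OF _ locally_unif_bounded_const[of "\<lambda>k. inverse (qpoch q q k)", OF K]]
        locally_unif_bounded_qpoch_inf[OF L1])
qed

lemma W1_holomorphic: "W1 holomorphic_on (- {0})"
  unfolding W1_def[abs_def]
  by (rule holomorphic_on_geometric_series[OF _ _ t1_bounded norm_q])
     (auto simp: t1_def[abs_def] intro!: holomorphic_intros)

lemma W2_holomorphic: "W2 holomorphic_on UNIV"
  unfolding W2_def[abs_def]
  by (rule holomorphic_on_geometric_series[OF _ _ t2_bounded norm_q])
     (auto simp: t2_def[abs_def] intro!: holomorphic_intros)

lemma summable_t1: "x \<noteq> 0 \<Longrightarrow> summable (\<lambda>k. q ^ k * t1 k x)"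
proof -
  assume "x \<noteq> 0"
  then obtain C where "eventually (\<lambda>y. \<forall>k. norm (t1 k y) \<le> C) (nhds x)"
    using t1_bounded unfolding locally_unif_bounded_def by auto
  from eventually_nhds_x_imp_x[OF this] have C: "norm (t1 k x) \<le> C" for k by blast
  show ?thesis
  proof (rule summable_comparison_test')
    show "summable (\<lambda>k. norm q ^ k * C)" using norm_q by (intro summable_mult2) simp
    show "norm (q ^ k * t1 k x) \<le> norm q ^ k * C" for k
      using C[of k] by (simp add: norm_mult norm_power mult_left_mono)
  qed
qed

lemma f_holomorphic: "f1 holomorphic_on ball 0 1" "f2 holomorphic_on ball 0 1"
proof -
  have "ball 0 1 \<subseteq> eball (0::complex) (fps_conv_radius (hyp_fps A B C))" if "\<And>n. C * q ^ n \<noteq> 1" for A B C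
    using hyp_fps_conv_radius[OF that, of A B] by (auto simp: in_eball_iff) (metis ereal_less(3) less_le_trans)
  thus "f1 holomorphic_on ball 0 1" "f2 holomorphic_on ball 0 1"
    unfolding f1_def f2_def using c_pow ab_pow by (intro holomorphic_intros; simp)+
qed

lemma defect_holomorphic: "defect holomorphic_on {x. x \<noteq> 0 \<and> norm (\<beta> * x) < 1}"
proof -
  have f: "(\<lambda>x. f1 (\<beta> * x)) holomorphic_on {x. x \<noteq> 0 \<and> norm (\<beta> * x) < 1}"
          "(\<lambda>x. f2 (\<beta> * x)) holomorphic_on {x. x \<noteq> 0 \<and> norm (\<beta> * x) < 1}"
    by (rule holomorphic_on_compose_gen[OF _ f_holomorphic(1), unfolded o_def]
             holomorphic_on_compose_gen[OF _ f_holomorphic(2), unfolded o_def];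
        auto intro!: holomorphic_intros)+
  show ?thesis unfolding defect_def[abs_def] qtheta_eq
    by (intro holomorphic_intros f holomorphic_on_subset[OF W1_holomorphic] holomorphic_on_subset[OF W2_holomorphic]) auto
qed

text \<open>For k = i + m and x = q^m the argument q / x * q^k is q^(i+1). All factorials on both
  sides can then be expressed by infinite ones starting at multiples of q^k and q^(2k) and by finite
  ones of length i or k.\<close>

lemma W_residue_match:
  "qpoch_inf (a * q ^ m) q * qpoch_inf (\<beta> * q ^ m) q * (q ^ (i + m) * t1 (i + m) (q ^ m))
     = lam * q ^ m * (q ^ i * t2 i (q ^ m))"
proof -
  define k where "k = i + m"
  have n0: "qpoch_inf a q \<noteq> 0" "qpoch_inf \<beta> q \<noteq> 0" "qpoch_inf (q * a / b) q \<noteq> 0"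
      "qpoch_inf (\<beta> * b) q \<noteq> 0"
     "qpoch_inf \<alpha> q \<noteq> 0" "qpoch_inf q q \<noteq> 0"
    by (intro qpoch_inf_nonzero a_pow \<beta>_pow1 ab_pow c_pow \<alpha>_pow q_mult_power_neq_1)+
  have nk: "qpoch_inf (c * q ^ k) q \<noteq> 0" if "qpoch_inf c q \<noteq> 0" for c k
    using that qpoch_inf_split[of c k] by auto
  have fin: "qpoch c q k = qpoch_inf c q / qpoch_inf (c * q ^ k) q" if "qpoch_inf c q \<noteq> 0" for c k
    using nk[OF that, of k] qpoch_inf_split[of c k] by simp
  have e1: "qpoch_inf (c * q ^ m) q = qpoch (c * q ^ m) q i * qpoch_inf (c * q ^ k) q" for c
    using qpoch_inf_split[of "c * q ^ m" i] by (simp add: k_def power_add mult_ac)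
  have e2: "qpoch \<alpha> q (2 * k) = qpoch \<alpha> q k * qpoch (\<alpha> * q ^ k) q k"
    using qpoch_add[of \<alpha> k k] by (simp add: mult_2)
  have e3: "qpoch_inf (\<alpha> * q ^ k) q = qpoch (\<alpha> * q ^ k) q k * qpoch_inf (\<alpha> * q ^ (2 * k)) q"
    using qpoch_inf_split[of "\<alpha> * q ^ k" k] unfolding mult_2 power_add by (simp only: mult.assoc)
  have e4: "qpoch_inf (\<alpha> * q ^ m * q ^ k) q = qpoch (\<alpha> * (q ^ m)\<^sup>2 * q ^ i) q i
      * qpoch_inf (\<alpha> * q ^ (2 * k)) q"
    using qpoch_inf_split[of "\<alpha> * q ^ m * q ^ k" i]
    unfolding mult_2 k_def power_add power2_eq_square by (simp only: mult_ac)
  have e5: "q / q ^ m * q ^ k = q * q ^ i" using q_nz by (simp add: k_def power_add)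
  have e6: "qpoch_inf (q * q ^ i) q = qpoch_inf q q / qpoch q q i"
    using qpoch_inf_split[of q i] qpoch_q_nonzero[of i] by simp
  have pk: "\<And>c. c * q ^ m * q ^ i = c * q ^ k" by (simp add: k_def power_add mult_ac)
  have alg0: "A0 / A * (B0 / B) * (P * D) / (Qi / E * (H / F) * (I / G) * P) * (J * K * (Qi / L))
      = A0 * B0 * D * E * F * G / (A * B * H * I) * (J * K / L)"
    if "P \<noteq> 0" "Qi \<noteq> 0" for A0 A B0 B P D Qi E H F I G J K L :: complex
    using that by (simp add: divide_inverse mult_ac) (auto simp: field_simps)
  have L: "t1 k (q ^ m) = qpoch_inf a q * qpoch_inf \<beta> q * qpoch (\<alpha> * q ^ k) q k * qpoch_inf (q
      * q ^ k) q * qpoch_inf (q * a / b * q ^ k) q * qpoch_inf (\<beta> * b * q ^ k) q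
      / (qpoch_inf (a * q ^ k) q * qpoch_inf (\<beta> * q ^ k) q * qpoch_inf (q * a / b) q * qpoch_inf (\<beta> * b) q)
      * (qpoch (\<alpha> * (q ^ m)\<^sup>2 * q ^ i) q i * qpoch_inf (\<alpha> * q ^ (2 * k)) q / qpoch q q i)"
    unfolding t1_def d_coeff_def e2 e4 e5 e6 fin[OF n0(1), of k] fin[OF n0(2), of k] fin[OF n0(3),
        of k] fin[OF n0(4), of k] fin[OF n0(6), of k]
    by (rule alg0[OF qpoch_nonzero[OF \<alpha>_pow] n0(6)])
  have R: "t2 i (q ^ m) = qpoch_inf (q * q ^ k) q * qpoch_inf (q * a / b * q ^ k) q
     * qpoch_inf (\<beta> * b * q ^ k) q * (qpoch (\<alpha> * q ^ k) q k * qpoch_inf (\<alpha> * q ^ (2 * k)) q)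
     * qpoch (\<alpha> * (q ^ m)\<^sup>2 * q ^ i) q i * qpoch (a * q ^ m) q i * qpoch (\<beta> * q ^ m) q i / qpoch q q i"
    unfolding t2_def pk e3 by (simp add: divide_inverse mult_ac)
  have alg: "pa * A * (pb * B) * (qi * qm * (A0 * B0 * D * E * F * G / (A * B * H * I) * (J * K / L)))
      = A0 * B0 / (H * I) * qm * (qi * (E * F * G * (D * K) * J * pa * pb / L))"
    if "A \<noteq> 0" "B \<noteq> 0" for pa A pb B qi qm A0 B0 D E F G H I J K L :: complex
    using that by (simp add: divide_inverse mult_ac) (auto simp: field_simps)
  have "qpoch_inf (a * q ^ m) q * qpoch_inf (\<beta> * q ^ m) q * (q ^ (i + m) * t1 (i + m) (q ^ m))
      = qpoch_inf (a * q ^ m) q * qpoch_inf (\<beta> * q ^ m) q * (q ^ i * q ^ m * t1 k (q ^ m))"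
    unfolding k_def by (simp only: power_add)
  also have "\<dots> = lam * q ^ m * (q ^ i * t2 i (q ^ m))"
    unfolding L R lam_def e1[of a] e1[of \<beta>] by (rule alg[OF nk[OF n0(1)] nk[OF n0(2)]])
  finally show ?thesis .
qed

text \<open>For k < m the tail starting at q^(k+1-m) contains the factor 1 - 1, so \<open>W1\<close>
  effectively begins at k = m. Its shifted terms then agree with those of \<open>W2\<close>, and
  theta vanishes.\<close>

lemma defect_vanishes:
  assumes "m > 0"
  shows "defect (q ^ m) = 0"
proof -
  have qm: "q ^ m \<noteq> 0" using q_nz by simp
  have "qpoch_inf (q / q ^ m) q = 0"
    unfolding qpoch_inf_eq_0_iff using assms q_nz by (intro exI[of _ "m - 1"]) (cases m; simp)
  hence theta: "qtheta (q ^ m) q = 0" by (simp add: qtheta_eq)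
  have t0: "t1 k (q ^ m) = 0" if "k < m" for k
  proof -
    have "q / q ^ m * q ^ k * q ^ (m - 1 - k) = q * q ^ (k + (m - 1 - k)) / q ^ m"
      by (simp only: power_add) simp
    also have "k + (m - 1 - k) = m - 1" using that by simp
    also have "q * q ^ (m - 1) / q ^ m = 1" using assms q_nz by (cases m) auto
    finally have "qpoch_inf (q / q ^ m * q ^ k) q = 0" unfolding qpoch_inf_eq_0_iff by blast
    thus ?thesis by (simp add: t1_def)
  qed
  have "W1 (q ^ m) = (\<Sum>i. q ^ (i + m) * t1 (i + m) (q ^ m))"
    unfolding W1_def using suminf_split_initial_segment[OF summable_t1[OF qm], of m] t0 by simp
  hence "qpoch_inf (a * q ^ m) q * qpoch_inf (\<beta> * q ^ m) q * W1 (q ^ m)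
      = (\<Sum>i. qpoch_inf (a * q ^ m) q * qpoch_inf (\<beta> * q ^ m) q * (q ^ (i + m) * t1 (i + m) (q ^ m)))"
    using summable_ignore_initial_segment[OF summable_t1[OF qm], of m] by (simp only: suminf_mult)
  also have "\<dots> = (\<Sum>i. lam * q ^ m * (q ^ i * t2 i (q ^ m)))"
    by (simp only: W_residue_match)
  also have "\<dots> = lam * q ^ m * W2 (q ^ m)"
  proof -
    obtain C where "eventually (\<lambda>y. \<forall>k. norm (t2 k y) \<le> C) (nhds (q ^ m))"
      using t2_bounded unfolding locally_unif_bounded_def by auto
    from eventually_nhds_x_imp_x[OF this] have C: "norm (t2 k (q ^ m)) \<le> C" for k by blast
    have "summable (\<lambda>k. q ^ k * t2 k (q ^ m))"
    proof (rule summable_comparison_test')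
      show "summable (\<lambda>k. norm q ^ k * C)" using norm_q by (intro summable_mult2) simp
      show "norm (q ^ k * t2 k (q ^ m)) \<le> norm q ^ k * C" for k
        using C[of k] by (simp add: norm_mult norm_power mult_left_mono)
    qed
    thus ?thesis unfolding W2_def by (rule suminf_mult)
  qed
  finally show ?thesis by (simp add: defect_def theta)
qed

lemma theta_eq_0_imp:
  assumes "x \<noteq> 0" "norm x < 1" "qtheta x q = 0"
  obtains m where "m > 0" "x = q ^ m"
proof -
  have "qpoch_inf (q / x) q = 0"
    using assms qpoch_inf_nonzero_norm[of x] by (simp add: qtheta_eq)
  then obtain n where "q / x * q ^ n = 1" unfolding qpoch_inf_eq_0_iff by blast
  hence "x = q ^ Suc n" using assms by (simp add: field_simps)
  thus ?thesis using that[of "Suc n"] by simp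
qed

text \<open>The factor 1 - q^m / x is split off. The cofactor \<open>u\<close> does not vanish at
  q^m, because distinct powers of q are different.\<close>

lemma deriv_theta_nonzero:
  assumes "m > 0"
  shows "deriv (\<lambda>x. qtheta x q) (q ^ m) \<noteq> 0"
proof -
  let ?x = "q ^ m"
  define u where "u = (\<lambda>x. qpoch_inf x q * qpoch (q / x) q (m - 1) * qpoch_inf (q * ?x / x) q)"
  have x0: "?x \<noteq> 0" using q_nz by simp
  have split: "qtheta x q = u x * (1 - ?x / x)" if "x \<noteq> 0" for x
  proof -
    have "qpoch_inf (q / x) q = qpoch (q / x) q m * qpoch_inf (q / x * ?x) q" by (rule qpoch_inf_split)
    also have "qpoch (q / x) q m = qpoch (q / x) q (m - 1) * (1 - ?x / x)"
      using assms by (cases m) (simp_all add: qpoch_Suc)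
    finally show ?thesis by (simp add: qtheta_eq u_def mult_ac)
  qed
  have u0: "u ?x \<noteq> 0"
  proof -
    have 1: "qpoch_inf ?x q \<noteq> 0"
      using assms norm_q by (intro qpoch_inf_nonzero_norm) (simp add: norm_power power_less_one_iff)
    have 2: "qpoch_inf (q * ?x / ?x) q \<noteq> 0" using x0 norm_q by (simp add: qpoch_inf_nonzero_norm)
    have 3: "qpoch (q / ?x) q (m - 1) \<noteq> 0"
    proof -
      have "1 - q / ?x * q ^ j \<noteq> 0" if "j < m - 1" for j
      proof
        assume "1 - q / ?x * q ^ j = 0"
        hence "?x = q ^ Suc j" using x0 by (simp add: field_simps)
        moreover from that obtain i where m: "m = Suc j + Suc i"
          using less_iff_Suc_add[of "Suc j" m] by auto
        hence "?x = q ^ Suc j * q ^ Suc i" by (simp only: power_add)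
        ultimately have "q ^ Suc i = 1" using q_nz by simp
        thus False using power_q_neq_1[of "Suc i"] by simp
      qed
      thus ?thesis by (auto simp only: qpoch_def prod_zero_iff finite_lessThan lessThan_iff)
    qed
    show ?thesis using 1 2 3 by (simp add: u_def)
  qed
  have der: "((\<lambda>x. u x * (1 - X / x)) has_field_derivative (u X * (X / X\<^sup>2) + u' * (1 - X / X))) (at X)"
    if "X \<noteq> 0" "(u has_field_derivative u') (at X)" for X u'
    using that by (auto intro!: derivative_eq_intros simp: power2_eq_square)
  have hu: "u holomorphic_on (- {0})" unfolding u_def by (intro holomorphic_intros) auto
  have "u field_differentiable (at ?x)"
    by (rule holomorphic_on_imp_differentiable_at[OF hu]) (use x0 in auto)
  then obtain u' where u': "(u has_field_derivative u') (at ?x)" unfolding field_differentiable_def by blast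
  have "((\<lambda>x. u x * (1 - ?x / x)) has_field_derivative (u ?x * (?x / ?x\<^sup>2) + u' * (1 - ?x / ?x))) (at ?x)"
    by (rule der[OF x0 u'])
  hence "((\<lambda>x. qtheta x q) has_field_derivative (u ?x * (?x / ?x\<^sup>2) + u' * (1 - ?x / ?x))) (at ?x)"
    by (rule has_field_derivative_transform_within_open[of _ _ _ "- {0}"]) (use split x0 in auto)
  hence "deriv (\<lambda>x. qtheta x q) ?x = u ?x * (?x / ?x\<^sup>2)" using x0 DERIV_imp_deriv by fastforce
  thus ?thesis using u0 x0 by simp
qed

section \<open>The asymptotic expansion at x = 0\<close>

definition \<delta> :: "nat \<Rightarrow> complex" where
  "\<delta> k = d k * (- 1) ^ k / q ^ (\<Sum>{..<k})"

text \<open>The k-th summand of \<open>W1\<close> divided by theta (\<open>theta_mult_Dk\<close>),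
  in a form that shows its power series at 0 with lowest power x^k.\<close>

definition Dk :: "nat \<Rightarrow> complex \<Rightarrow> complex" where
  "Dk k x = \<delta> k * x ^ k * (qpoch_inf (\<alpha> * q ^ (2 * k) * (1 / q ^ k * x)) q / qpoch_inf (1 / q ^ k * x) q)"

text \<open>What the product term of \<open>defect\<close> becomes after division by theta and by
  the two factorials in front of \<open>W1\<close>.\<close>

definition quotE :: "complex \<Rightarrow> complex" where
  "quotE x = f1 (\<beta> * x) * f2 (\<beta> * x) * (qpoch_inf (\<beta> * x) q / qpoch_inf (a * x) q)"

lemma Dk_expansion:
  "Dk k has_fps_expansion fps_const (\<delta> k) * fps_X ^ k * fps_scale (1 / q ^ k) (qbin_fps (\<alpha> * q ^ (2 * k)))"
  unfolding Dk_def[abs_def]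
  by (intro fps_expansion_intros has_fps_expansion_scale[OF qbin_expansion])

text \<open>Euler's transformation gives \<open>f1\<close> the prefactor (a x; q)_inf / (\<beta> x;
  q)_inf, which cancels the quotient in \<open>quotE\<close>. What remains is the generating series
  of the left side of \<open>product_coeff\<close>.\<close>

lemma quotE_expansion:
  "quotE has_fps_expansion fps_scale a (hyp_fps (\<beta> * b / a) \<beta> (\<beta> * b))
      * fps_scale \<beta> (hyp_fps a (q * a / (\<beta> * b)) (q * a / b))"
proof -
  have pos: "fps_conv_radius (hyp_fps A B C) > 0" if "\<And>n. C * q ^ n \<noteq> 1" for A B C
    by (rule less_le_trans[OF _ hyp_fps_conv_radius[OF that]]) simp
  have f: "(\<lambda>x. f1 (\<beta> * x)) has_fps_expansion fps_scale \<beta> (hyp_fps a b (\<beta> * b))"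
    "(\<lambda>x. f2 (\<beta> * x)) has_fps_expansion fps_scale \<beta> (hyp_fps a (q * a / (\<beta> * b)) (q * a / b))"
    unfolding f1_def f2_def
    by (intro has_fps_expansion_scale eval_fps_has_fps_expansion pos c_pow ab_pow)+
  have "(\<lambda>x. qpoch_inf (\<beta> / a * (a * x)) q / qpoch_inf (a
      * x) q) has_fps_expansion fps_scale a (qbin_fps (\<beta> / a))"
    by (rule has_fps_expansion_scale[OF qbin_expansion])
  hence g: "(\<lambda>x. qpoch_inf (\<beta> * x) q / qpoch_inf (a * x) q) has_fps_expansion fps_scale a (qbin_fps (\<beta> / a))"
    using nz by simp
  have "fps_scale \<beta> (qbin_fps (a / \<beta>) * fps_scale (a / \<beta>) (qbin_fps (1 / (a / \<beta>)))) = fps_scale \<beta> 1"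
    using nz by (subst qbin_fps_inverse) auto
  hence inv: "fps_scale \<beta> (qbin_fps (a / \<beta>)) * fps_scale a (qbin_fps (\<beta> / a)) = fps_scale \<beta> 1"
    using nz by (simp add: fps_scale_mult fps_scale_scale)
  have one: "fps_scale \<beta> 1 = 1" by (rule fps_ext) simp
  have "hyp_fps a b (\<beta> * b) = qbin_fps (a * b / (\<beta> * b)) * fps_scale (a * b / (\<beta>
      * b)) (hyp_fps (\<beta> * b / a) (\<beta> * b / b) (\<beta> * b))"
    using nz c_pow by (intro euler_transformation_fps) auto
  hence "fps_scale \<beta> (hyp_fps a b (\<beta> * b)) = fps_scale \<beta> (qbin_fps (a / \<beta>))
      * fps_scale a (hyp_fps (\<beta> * b / a) \<beta> (\<beta> * b))"
    using nz by (simp add: fps_scale_mult fps_scale_scale)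
  hence "fps_scale \<beta> (hyp_fps a b (\<beta> * b)) * fps_scale \<beta> (hyp_fps a (q * a / (\<beta> * b)) (q
      * a / b)) * fps_scale a (qbin_fps (\<beta> / a))
     = (fps_scale \<beta> (qbin_fps (a / \<beta>)) * fps_scale a (qbin_fps (\<beta> / a))) *
       (fps_scale a (hyp_fps (\<beta> * b / a) \<beta> (\<beta> * b)) * fps_scale \<beta> (hyp_fps a (q
           * a / (\<beta> * b)) (q * a / b)))"
    by (simp only: mult_ac)
  also have "\<dots> = fps_scale a (hyp_fps (\<beta> * b / a) \<beta> (\<beta> * b))
      * fps_scale \<beta> (hyp_fps a (q * a / (\<beta> * b)) (q * a / b))"
    unfolding inv one by simp
  finally have eq: "fps_scale \<beta> (hyp_fps a b (\<beta> * b)) * fps_scale \<beta> (hyp_fps a (q * a / (\<beta>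
      * b)) (q * a / b)) * fps_scale a (qbin_fps (\<beta> / a))
     = fps_scale a (hyp_fps (\<beta> * b / a) \<beta> (\<beta> * b)) * fps_scale \<beta> (hyp_fps a (q
         * a / (\<beta> * b)) (q * a / b))" .
  show ?thesis
    unfolding quotE_def[abs_def] eq[symmetric] by (intro has_fps_expansion_mult f g)
qed

text \<open>\<open>Dk k\<close> starts at x^k, so for n < M the coefficient of x^n involves only k
  <= n, where \<open>product_coeff\<close> applies.\<close>

lemma Dk_minus_quotE_bigo:
  "\<exists>C. eventually (\<lambda>x. norm ((\<Sum>k<M. Dk k x) - quotE x) \<le> C * norm x ^ M) (nhds 0)"
proof (rule has_fps_expansion_bigo)
  let ?FD = "\<lambda>k. fps_const (\<delta> k) * fps_X ^ k * fps_scale (1 / q ^ k) (qbin_fps (\<alpha> * q ^ (2 * k)))"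
  let ?FE = "fps_scale a (hyp_fps (\<beta> * b / a) \<beta> (\<beta> * b)) * fps_scale \<beta> (hyp_fps a (q
      * a / (\<beta> * b)) (q * a / b))"
  show "(\<lambda>x. (\<Sum>k<M. Dk k x) - quotE x) has_fps_expansion (\<Sum>k<M. ?FD k) - ?FE"
    by (intro has_fps_expansion_diff has_fps_expansion_sum Dk_expansion quotE_expansion)
  fix n assume n: "n < M"
  have nth: "fps_nth (?FD k) n = (if k \<le> n then \<delta> k * ((1 / q ^ k) ^ (n - k) * qbin (\<alpha> * q ^ (2
      * k)) (n - k)) else 0)" for k
    by (simp add: mult.assoc fps_X_power_mult_nth)
  have "fps_nth (\<Sum>k<M. ?FD k) n = (\<Sum>k<M. fps_nth (?FD k) n)" by (rule fps_sum_nth)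
  also have "\<dots> = (\<Sum>k\<le>n. fps_nth (?FD k) n)"
    by (rule sum.mono_neutral_right) (use n nth in auto)
  also have "\<dots> = (\<Sum>k\<le>n. d k * (- 1) ^ k / q ^ (\<Sum>{..<k}) * ((1 / q ^ k) ^ (n - k)
      * qbin (\<alpha> * q ^ (2 * k)) (n - k)))"
    by (intro sum.cong refl) (subst nth, simp add: \<delta>_def)
  also have "\<dots> = (\<Sum>k\<le>n. hyp (\<beta> * b / a) \<beta> (\<beta> * b) k * a ^ k * (hyp a (q
      * a / (\<beta> * b)) (q * a / b) (n - k) * \<beta> ^ (n - k)))"
    by (rule product_coeff[symmetric]) (use nz \<beta>_pow c_pow ab_pow \<alpha>_pow in auto)
  also have "\<dots> = fps_nth ?FE n"
    unfolding fps_mult_nth atMost_atLeast0 by (intro sum.cong refl) (simp add: mult_ac)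
  finally show "fps_nth ((\<Sum>k<M. ?FD k) - ?FE) n = 0" by simp
qed

lemma theta_mult_Dk:
  assumes x: "x \<noteq> 0" and theta: "qtheta x q \<noteq> 0"
  shows "qtheta x q * Dk k x = q ^ k * t1 k x"
proof -
  have 1: "qpoch_inf (1 / q ^ k * x) q = (- x) ^ k * qpoch (q / x) q k / q ^ (\<Sum>{..k}) * qpoch_inf x q"
  proof -
    have "qpoch_inf (x / q ^ k) q = qpoch (x / q ^ k) q k * qpoch_inf (x / q ^ k * q ^ k) q"
      by (rule qpoch_inf_split)
    also have "x / q ^ k * q ^ k = x" using q_nz by simp
    finally show ?thesis by (simp add: qpoch_reverse[OF x])
  qed
  have 2: "qpoch_inf (q / x) q = qpoch (q / x) q k * qpoch_inf (q / x * q ^ k) q" by (rule qpoch_inf_split)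
  have nz': "qpoch_inf x q \<noteq> 0" "qpoch (q / x) q k \<noteq> 0" using theta by (auto simp: qtheta_eq 2)
  have e: "\<alpha> * q ^ (2 * k) * (1 / q ^ k * x) = \<alpha> * x * q ^ k" using q_nz by (simp add: mult_2 power_add)
  have s: "q ^ (\<Sum>{..k}) = q ^ (\<Sum>{..<k}) * q ^ k"
    by (simp flip: power_add lessThan_Suc_atMost)
  have m: "(- x) ^ k = (- 1) ^ k * x ^ k" by (rule power_minus)
  have alg: "X * (P * Q) * (D * e / S * xk * (A / (e * xk * P / (S * K) * X))) = K * (D * (A * Q))"
    if "X \<noteq> 0" "P \<noteq> 0" "e \<noteq> 0" "xk \<noteq> 0" "S \<noteq> 0" "K \<noteq> 0"
        for X P Q D e S xk A K :: complex
    using that by simp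
  show ?thesis
    unfolding qtheta_eq Dk_def t1_def \<delta>_def e 1 2 s m
    by (rule alg) (use nz' x q_nz in auto)
qed

text \<open>The quotient of the defect by theta has three parts, matching the three summands of
  \<open>C\<close>. The first M terms of \<open>W1\<close> minus \<open>quotE\<close> are small by
  the expansion at 0, the other terms of \<open>W1\<close> by \<open>norm_tail_theta_le\<close>, and
  the bounded \<open>W2\<close> is divided by a theta that is large by
  \<open>one_le_theta_circle\<close>.\<close>

lemma flat_quotient:
  fixes h :: "complex \<Rightarrow> complex" and r \<rho> :: real
  assumes r: "norm q < r" "r < 1" and \<rho>: "0 < \<rho>" "\<rho> \<le> 1"
    and h: "\<And>x. x \<in> ball 0 \<rho> - {0} \<Longrightarrow> defect x = qtheta x q * h x"
  shows "\<exists>C. \<forall>\<^sub>F n in sequentially. \<forall>x. norm x = r * norm q ^ n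
      \<longrightarrow> norm (h x) \<le> C * (norm q ^ n) ^ M"
proof -
  define p where "p = norm q"
  have p: "0 < p" "p < 1" using norm_q q_nz by (simp_all add: p_def)
  have r0: "0 < r" using p(1) r(1) unfolding p_def by (rule less_trans)
  obtain C1 where C1: "eventually (\<lambda>x. norm ((\<Sum>k<M. Dk k x) - quotE x) \<le> C1 * norm x ^ M) (nhds 0)"
    using Dk_minus_quotE_bigo by blast
  obtain C2 where C2: "\<And>n x k. norm x = r * p ^ n \<Longrightarrow> M \<le> k \<Longrightarrow>
      norm (qpoch_inf (q / x * q ^ k) q) \<le> C2 * (p ^ n) ^ M * norm (qtheta x q)"
    using norm_tail_theta_le[OF r, of M] unfolding p_def by blast
  obtain C3 where C3: "\<And>n x. norm x = r * p ^ n \<Longrightarrow> 1 \<le> C3 * (p ^ n) ^ M * norm (qtheta x q)"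
    using one_le_theta_circle[OF r, of M] unfolding p_def by blast
  obtain Kd where Kd: "\<And>k. norm (d k) \<le> Kd" using d_bounded by metis
  have Kd0: "0 \<le> Kd" using Kd[of 0] norm_ge_zero order_trans by blast
  have "compact (W2 ` cball 0 1)"
    by (intro compact_continuous_image holomorphic_on_imp_continuous_on holomorphic_on_subset[OF W2_holomorphic]) auto
  from compact_imp_bounded[OF this] obtain Kw where Kw: "Kw > 0" "\<forall>y\<in>W2 ` cball 0 1. norm y \<le> Kw"
    unfolding bounded_pos by blast
  define ca cb cc where "ca = exp (norm a / (1 - norm q))" and "cb = exp (norm \<beta> / (1 - norm q))" and "cc
      = exp (norm \<alpha> / (1 - norm q))"
  have pos: "ca > 0" "cb > 0" "cc > 0" by (simp_all add: ca_def cb_def cc_def)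
  define T where "T = Kd * (cc * C2)"
  define C where "C = ca * cb * \<bar>C1\<bar> + ca * cb * (\<bar>T\<bar> / (1 - p)) + norm lam * Kw * C3"
  have lim0: "(\<lambda>n. r * p ^ n) \<longlonglongrightarrow> 0"
    by (intro tendsto_mult_right_zero LIMSEQ_power_zero) (use p in auto)
  have ev_a: "eventually (\<lambda>x. qpoch_inf (a * x) q \<noteq> 0) (nhds 0)"
  proof -
    have "((\<lambda>x. qpoch_inf (a * x) q) \<longlongrightarrow> qpoch_inf (a * 0) q) (nhds 0)"
      by (intro tendsto_intros filterlim_ident)
    thus ?thesis by (rule tendsto_imp_eventually_ne) simp
  qed
  from C1 ev_a have "eventually (\<lambda>x. norm ((\<Sum>k<M. Dk k x) - quotE x) \<le> C1
      * norm x ^ M \<and> qpoch_inf (a * x) q \<noteq> 0) (nhds 0)"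
    by eventually_elim auto
  then obtain e where e: "e > 0" "\<And>x. norm x < e \<Longrightarrow> norm ((\<Sum>k<M. Dk k x) - quotE x)
      \<le> C1 * norm x ^ M \<and> qpoch_inf (a * x) q \<noteq> 0"
    unfolding eventually_nhds_metric by (auto simp: dist_norm)
  have "\<forall>\<^sub>F n in sequentially. \<forall>x. norm x = r * p ^ n \<longrightarrow> norm (h x) \<le> C * (p ^ n) ^ M"
    using order_tendstoD(2)[OF lim0 \<rho>(1)] order_tendstoD(2)[OF lim0 e(1)]
  proof eventually_elim
    case (elim n)
    show ?case
    proof (intro allI impI)
      fix x :: complex assume nx: "norm x = r * p ^ n"
      have x0: "x \<noteq> 0" using nx r0 p by auto
      have x1: "norm x \<le> 1" using nx elim(1) \<rho> by linarith
      have xb: "x \<in> ball 0 \<rho> - {0}" using nx elim(1) x0 by simp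
      let ?th = "qtheta x q" and ?P = "(p ^ n) ^ M"
      have th0: "?th \<noteq> 0" using C3[OF nx] by auto
      have P0: "?P > 0" using p by simp
      have na: "norm (qpoch_inf (a * x) q) \<le> ca" unfolding ca_def
        by (rule norm_qpoch_inf_le') (use x1 in \<open>simp add: norm_mult mult_left_le\<close>)
      have nb: "norm (qpoch_inf (\<beta> * x) q) \<le> cb" unfolding cb_def
        by (rule norm_qpoch_inf_le') (use x1 in \<open>simp add: norm_mult mult_left_le\<close>)
      have a0: "qpoch_inf (a * x) q \<noteq> 0" using e(2)[of x] nx elim(2) by simp
      define tail where "tail = (\<Sum>k. q ^ (k + M) * t1 (k + M) x)"
      have W1: "W1 x = (\<Sum>k<M. q ^ k * t1 k x) + tail"
        unfolding W1_def tail_def using suminf_split_initial_segment[OF summable_t1[OF x0], of M] by simp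
      have "(\<Sum>k<M. q ^ k * t1 k x) = ?th * (\<Sum>k<M. Dk k x)"
        unfolding sum_distrib_left by (intro sum.cong refl) (simp add: theta_mult_Dk[OF x0 th0])
      with W1 have W1': "W1 x = ?th * (\<Sum>k<M. Dk k x) + tail" by simp
      have t1_le: "norm (q ^ (k + M) * t1 (k + M) x) \<le> p ^ k * (\<bar>T\<bar> * ?P * norm ?th)" for k
      proof -
        have "norm (\<alpha> * x * q ^ (k + M)) \<le> norm \<alpha>"
          by (rule norm_mult_q_power_le) (use x1 in \<open>simp add: norm_mult mult_left_le\<close>)
        hence "norm (qpoch_inf (\<alpha> * x * q ^ (k + M)) q) \<le> cc"
          unfolding cc_def by (rule norm_qpoch_inf_le')
        hence "norm (t1 (k + M) x) \<le> Kd * (cc * (C2 * ?P * norm ?th))"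
          unfolding t1_def norm_mult using Kd0 pos by (intro mult_mono Kd C2 nx) auto
        also have "\<dots> = T * (?P * norm ?th)" by (simp add: T_def mult_ac)
        also have "\<dots> \<le> \<bar>T\<bar> * (?P * norm ?th)" using P0 by (intro mult_right_mono) auto
        finally have "norm (t1 (k + M) x) \<le> \<bar>T\<bar> * ?P * norm ?th" by (simp only: mult.assoc)
        moreover have "norm (q ^ (k + M)) \<le> p ^ k"
          unfolding norm_power p_def[symmetric] using p by (intro power_decreasing) auto
        ultimately show ?thesis unfolding norm_mult using p by (intro mult_mono) auto
      qed
      have "norm tail \<le> (\<Sum>k. p ^ k * (\<bar>T\<bar> * ?P * norm ?th))"
        unfolding tail_def by (intro norm_suminf_le t1_le summable_mult2) (use p in simp)
      also have "\<dots> = \<bar>T\<bar> / (1 - p) * ?P * norm ?th"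
        using p by (subst suminf_mult2[symmetric]) (auto simp: suminf_geometric)
      finally have ntail: "norm tail \<le> \<bar>T\<bar> / (1 - p) * ?P * norm ?th" .
      have nW2: "norm (W2 x) \<le> Kw" using Kw(2) x1 by auto
      have xM: "norm x ^ M \<le> ?P"
        unfolding nx using r r0 p by (intro power_mono) (auto simp: mult_left_le_one_le)
      have nE: "norm ((\<Sum>k<M. Dk k x) - quotE x) \<le> \<bar>C1\<bar> * ?P"
      proof -
        have "norm ((\<Sum>k<M. Dk k x) - quotE x) \<le> C1 * norm x ^ M" using e(2)[of x] nx elim(2) by simp
        also have "\<dots> \<le> \<bar>C1\<bar> * norm x ^ M" by (intro mult_right_mono) auto
        also have "\<dots> \<le> \<bar>C1\<bar> * ?P" using xM by (intro mult_left_mono) auto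
        finally show ?thesis .
      qed
      let ?a = "qpoch_inf (a * x) q" and ?b = "qpoch_inf (\<beta> * x) q"
      have dec: "defect x = ?a * ?b * (((\<Sum>k<M. Dk k x) - quotE x) * ?th) + ?a * ?b * tail - lam * x * W2 x"
      proof -
        have e1: "?b\<^sup>2 * f1 (\<beta> * x) * f2 (\<beta> * x) = ?a * ?b * quotE x"
          using a0 by (simp add: quotE_def power2_eq_square)
        have "qtheta x q * ?b ^ 2 * f1 (\<beta> * x) * f2 (\<beta> * x) = qtheta x q * (?b\<^sup>2 * f1 (\<beta>
            * x) * f2 (\<beta> * x))"
          by (simp only: mult.assoc)
        also have "\<dots> = ?a * ?b * quotE x * qtheta x q" unfolding e1 by (rule mult.commute)
        finally have e2: "qtheta x q * ?b ^ 2 * f1 (\<beta> * x) * f2 (\<beta> * x) = ?a * ?b * quotE x * qtheta x q" .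
        show ?thesis unfolding defect_def W1' e2 by (simp add: algebra_simps)
      qed
      have "norm (defect x) \<le> norm (?a * ?b * (((\<Sum>k<M. Dk k x) - quotE x) * ?th)) + norm (?a * ?b * tail)
          + norm (lam * x * W2 x)"
        unfolding dec by (intro order.trans[OF norm_triangle_ineq4] add_mono norm_triangle_ineq) auto
      also have "norm (?a * ?b * (((\<Sum>k<M. Dk k x) - quotE x) * ?th)) \<le> ca * cb * (\<bar>C1\<bar> * ?P * norm ?th)"
        unfolding norm_mult using pos p by (intro mult_mono na nb nE) auto
      also have "norm (?a * ?b * tail) \<le> ca * cb * (\<bar>T\<bar> / (1 - p) * ?P * norm ?th)"
        unfolding norm_mult using pos p by (intro mult_mono na nb ntail) auto
      also have "norm (lam * x * W2 x) \<le> norm lam * Kw * (C3 * ?P * norm ?th)"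
      proof -
        have "norm (lam * x * W2 x) \<le> norm lam * 1 * Kw"
          unfolding norm_mult using Kw by (intro mult_mono nW2 x1) auto
        also have "\<dots> = norm lam * Kw * 1" by simp
        also have "\<dots> \<le> norm lam * Kw * (C3 * ?P * norm ?th)"
          using Kw by (intro mult_left_mono C3[OF nx]) auto
        finally show ?thesis .
      qed
      also have "ca * cb * (\<bar>C1\<bar> * ?P * norm ?th) + ca * cb * (\<bar>T\<bar> / (1 - p) * ?P * norm ?th)
          + norm lam * Kw * (C3 * ?P * norm ?th)
          = norm ?th * (C * ?P)"
        unfolding C_def by (simp add: distrib_left distrib_right mult_ac)
      finally have "norm (defect x) \<le> norm ?th * (C * ?P)" by simp
      hence "norm ?th * norm (h x) \<le> norm ?th * (C * ?P)" by (simp add: h[OF xb] norm_mult)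
      thus "norm (h x) \<le> C * ?P" using th0 by simp
    qed
  qed
  thus ?thesis unfolding p_def by blast
qed

text \<open>The radius \<open>\<rho>\<close> is at most 1, so theta vanishes in the punctured ball
  only at q^m with m > 0, where the defect vanishes too. From a neighbourhood of 0 the result
  spreads by analytic continuation.\<close>

theorem defect_eq_0:
  assumes "x \<noteq> 0" "norm (\<beta> * x) < 1"
  shows "defect x = 0"
proof -
  define S where "S = {x. x \<noteq> 0 \<and> norm (\<beta> * x) < 1}"
  define \<rho> where "\<rho> = min 1 (1 / norm \<beta>)"
  \<comment> \<open>Any value strictly between |q| and 1 keeps the circles of radius r |q|^n off the
    zeros of theta.\<close>
  define r where "r = (norm q + 1) / 2"
  have r: "norm q < r" "r < 1" using norm_q by (simp_all add: r_def)
  have r0: "0 < r" by (simp add: r_def add_nonneg_pos)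
  have \<rho>: "0 < \<rho>" "\<rho> \<le> 1" using nz by (simp_all add: \<rho>_def)
  have S: "S = ball 0 (1 / norm \<beta>) - {0}"
    using nz by (auto simp: S_def norm_mult field_simps)
  have sub: "ball 0 \<rho> - {0} \<subseteq> S" unfolding S by (auto simp: \<rho>_def)
  have hol: "defect holomorphic_on S" unfolding S_def by (rule defect_holomorphic)
  have opn: "open (ball 0 \<rho> - {0 :: complex})" by (intro open_Diff) auto
  have th: "(\<lambda>x. qtheta x q) holomorphic_on (ball 0 \<rho> - {0})"
    unfolding qtheta_eq by (intro holomorphic_intros) auto
  have zeros: "defect z = 0 \<and> deriv (\<lambda>x. qtheta x q) z \<noteq> 0" if z: "z \<in> ball 0 \<rho> - {0}"
      "qtheta z q = 0" for z
  proof -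
    have "norm z < 1" "z \<noteq> 0" using z \<rho> by auto
    then obtain m where "m > 0" "z = q ^ m" using theta_eq_0_imp[OF _ _ z(2)] by metis
    thus ?thesis using defect_vanishes deriv_theta_nonzero by simp
  qed
  obtain h where h: "h holomorphic_on (ball 0 \<rho> - {0})" "\<And>z. z \<in> ball 0 \<rho> - {0}
      \<Longrightarrow> defect z = qtheta z q * h z"
    using holomorphic_quotient_simple_zeros[OF opn holomorphic_on_subset[OF hol sub] th zeros] by blast
  have "\<exists>R>0. R \<le> \<rho> \<and> (\<forall>z. 0 < norm z \<and> norm z < R \<longrightarrow> h z = 0)"
  proof (rule holomorphic_flat_on_circles_eq_0[OF h(1)])
    show "0 < norm q" "norm q < 1" using norm_q q_nz by simp_all
    show "0 < r" "0 < \<rho>" by fact+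
    show "\<exists>C. \<forall>\<^sub>F n in sequentially. \<forall>z. norm z = r * norm q ^ n
        \<longrightarrow> norm (h z) \<le> C * (norm q ^ n) ^ M" for M
      by (rule flat_quotient[OF r \<rho> h(2)])
  qed
  then obtain R where R: "0 < R" "R \<le> \<rho>" "\<And>z. 0 < norm z \<Longrightarrow> norm z < R
      \<Longrightarrow> h z = 0" by blast
  show ?thesis
  proof (rule analytic_continuation_open[of "ball 0 R - {0}" S defect "\<lambda>_. 0"])
    show "open (ball 0 R - {0 :: complex})" "open S" unfolding S by (intro open_Diff; auto)+
    show "ball 0 R - {0 :: complex} \<noteq> {}"
    proof -
      have "of_real (R / 2) \<in> ball 0 R - {0 :: complex}" using R by auto
      thus ?thesis by blast
    qed
    show "connected S" unfolding S by (rule connected_punctured_ball) simp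
    have "ball 0 R - {0} \<subseteq> ball (0 :: complex) \<rho> - {0}" using R by auto
    thus "ball 0 R - {0} \<subseteq> S" using sub by (rule subset_trans)
    show "defect z = 0" if "z \<in> ball 0 R - {0}" for z
      using h(2)[of z] R that by auto
    show "x \<in> S" using assms by (simp add: S_def)
  qed (use hol in auto)
qed

end

section \<open>Bounded coefficient sequences and the splitting of factorials at square roots\<close>

context qbase
begin

lemma Bseq_qpoch: "Bseq (\<lambda>k. qpoch c q (m k))"
  by (rule BseqI'[of _ "exp (norm c / (1 - norm q))"]) (rule norm_qpoch_le)

lemma Bseq_inverse_qpoch:
  assumes "\<And>n. c * q ^ n \<noteq> 1"
  shows "Bseq (\<lambda>k. inverse (qpoch c q (m k)))"
proof -
  obtain K where K: "\<And>k m. norm (inverse (qpoch (c * q ^ k) q m)) \<le> K"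
    using inverse_qpoch_bounded[OF assms] by metis
  show ?thesis by (rule BseqI'[of _ K]) (use K[of 0] in simp)
qed

lemma Bseq_prod:
  fixes f :: "'i \<Rightarrow> nat \<Rightarrow> complex"
  shows "(\<And>i. i \<in> I \<Longrightarrow> Bseq (f i)) \<Longrightarrow> Bseq (\<lambda>k. \<Prod>i\<in>I. f i k)"
  by (induction I rule: infinite_finite_induct) (auto intro: Bseq_mult)

lemma summable_geometric_Bseq:
  assumes "Bseq f" shows "summable (\<lambda>k. q ^ k * f k)"
proof -
  from assms obtain K where K: "norm (f k) \<le> K" for k unfolding Bseq_def by blast
  show ?thesis
  proof (rule summable_comparison_test')
    show "summable (\<lambda>k. norm q ^ k * K)" using norm_q by (intro summable_mult2) simp
    show "norm (q ^ k * f k) \<le> norm q ^ k * K" for k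
      using K[of k] by (simp add: norm_mult norm_power mult_left_mono)
  qed
qed

text \<open>The factors with y and - y give 1 - y^2 q^(2k), those with \<open>rq\<close> give 1 -
  y^2 q^(2k+1): the even and odd factors of the long factorial.\<close>

lemma qpoch_quadruple:
  assumes "rq\<^sup>2 = q"
  shows "qpoch y q k * qpoch (- y) q k * qpoch (rq * y) q k * qpoch (- (rq * y)) q k = qpoch (y\<^sup>2) q (2 * k)"
proof (induction k)
  case (Suc k)
  have alg: "(1 - y * Q) * (1 - - y * Q) * (1 - r * y * Q) * (1 - - (r * y) * Q)
      = (1 - y\<^sup>2 * (Q * Q)) * (1 - y\<^sup>2 * (r\<^sup>2 * (Q * Q)))" for Q r :: complex
    by (simp add: power2_eq_square algebra_simps)
  have "qpoch y q (Suc k) * qpoch (- y) q (Suc k) * qpoch (rq * y) q (Suc k) * qpoch (- (rq * y)) q (Suc k)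
      = (qpoch y q k * qpoch (- y) q k * qpoch (rq * y) q k * qpoch (- (rq * y)) q k)
        * ((1 - y * q ^ k) * (1 - - y * q ^ k) * (1 - rq * y * q ^ k) * (1 - - (rq * y) * q ^ k))"
    unfolding qpoch_Suc by (simp only: mult_ac)
  also have "\<dots> = qpoch (y\<^sup>2) q (2 * k) * (1 - y\<^sup>2 * q ^ (2 * k)) * (1 - y\<^sup>2 * q ^ Suc (2 * k))"
    unfolding Suc alg assms by (simp add: mult_2 power_add)
  also have "\<dots> = qpoch (y\<^sup>2) q (2 * Suc k)" by (simp add: qpoch_Suc)
  finally show ?case .
qed auto

lemma qpoch_inf_quadruple:
  assumes "rq\<^sup>2 = q"
  shows "qpoch_inf y q * qpoch_inf (- y) q * qpoch_inf (rq * y) q * qpoch_inf (- (rq * y)) q = qpoch_inf (y\<^sup>2) q"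
proof (rule LIMSEQ_unique)
  show "(\<lambda>k. qpoch (y\<^sup>2) q (2 * k)) \<longlonglongrightarrow> qpoch_inf y q * qpoch_inf (- y) q
      * qpoch_inf (rq * y) q * qpoch_inf (- (rq * y)) q"
    unfolding qpoch_quadruple[OF assms, symmetric] by (intro tendsto_intros qpoch_LIMSEQ)
  have "strict_mono (\<lambda>k::nat. 2 * k)" by (auto simp: strict_mono_def)
  from LIMSEQ_subseq_LIMSEQ[OF qpoch_LIMSEQ this, of "y\<^sup>2"]
  show "(\<lambda>k. qpoch (y\<^sup>2) q (2 * k)) \<longlonglongrightarrow> qpoch_inf (y\<^sup>2) q" by (simp add: o_def)
qed

end

section \<open>The product as a sum of six residue sums\<close>

text \<open>
  The paper's a, c/b and bz/c are s * t, s / t and x; thus s and t are square roots of ac/b and ab/c.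
\<close>

locale qgen = qbase +
  fixes rq s t b x h :: complex
  assumes rq: "rq\<^sup>2 = q"
    and nz': "s \<noteq> 0" "t \<noteq> 0" "b \<noteq> 0" "x \<noteq> 0" "h \<noteq> 0"
    and generic: "\<And>y k. y \<in> {t, t * t, s, s * x, s * t, s / t, s * s, x, s * t * x, s / t * b, s
        * t / b} \<Longrightarrow> norm y \<noteq> norm rq powi (k :: int)"
    and norm_z: "norm (s / t * x) < 1"
begin

lemma rq_nz: "rq \<noteq> 0" using rq q_nz by auto

text \<open>The norms in question form the group generated by the norm of \<open>rq\<close>. If
  \<open>y\<close> is outside and \<open>u\<close> is inside, then \<open>y * u\<close> is outside
  and in particular not 1; this settles most nonvanishing conditions.\<close>

definition pw :: "complex \<Rightarrow> bool" where
  "pw u \<longleftrightarrow> (\<exists>k::int. norm u = norm rq powi k)"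

lemma pw_1: "pw 1" unfolding pw_def by (rule exI[of _ 0]) simp
lemma pw_rq: "pw rq" unfolding pw_def by (rule exI[of _ 1]) simp
lemma pw_uminus: "pw u \<Longrightarrow> pw (- u)" by (simp add: pw_def)
lemma pw_mult: "pw u \<Longrightarrow> pw v \<Longrightarrow> pw (u * v)"
proof -
  assume "pw u" "pw v"
  then obtain k l where "norm u = norm rq powi k" "norm v = norm rq powi l" unfolding pw_def by blast
  thus "pw (u * v)" unfolding pw_def using rq_nz by (intro exI[of _ "k + l"]) (simp add: norm_mult power_int_add)
qed
lemma pw_inverse: "pw u \<Longrightarrow> pw (inverse u)"
proof -
  assume "pw u"
  then obtain k where "norm u = norm rq powi k" unfolding pw_def by blast
  thus "pw (inverse u)" unfolding pw_def
    by (intro exI[of _ "- k"]) (simp add: norm_inverse power_int_minus)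
qed
lemma pw_divide: "pw u \<Longrightarrow> pw v \<Longrightarrow> pw (u / v)"
  unfolding divide_inverse by (intro pw_mult pw_inverse)
lemma pw_power: "pw u \<Longrightarrow> pw (u ^ n)"
  by (induction n) (auto intro: pw_1 pw_mult)
lemma pw_q: "pw q" using pw_power[OF pw_rq, of 2] by (simp add: rq)

lemmas pw_intros = pw_1 pw_rq pw_uminus pw_mult pw_divide pw_power pw_q

lemma not_pw: "y \<in> {t, t * t, s, s * x, s * t, s / t, s * s, x, s * t * x, s / t * b, s
    * t / b} \<Longrightarrow> \<not> pw y"
  using generic unfolding pw_def by blast

lemma not_pw_mult: "\<not> pw y \<Longrightarrow> pw u \<Longrightarrow> u \<noteq> 0 \<Longrightarrow> \<not> pw (y * u)"
proof
  assume *: "\<not> pw y" "pw u" "u \<noteq> 0" "pw (y * u)"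
  have "pw (y * u / u)" by (intro pw_divide *)
  thus False using * by simp
qed

lemma generic_neq: "\<not> pw y \<Longrightarrow> y * q ^ n \<noteq> 1"
  using not_pw_mult[of y "q ^ n"] pw_power[OF pw_q, of n] pw_1 q_nz by auto

sublocale qprod q "s * t" b "s / t"
proof
  show "s * t \<noteq> 0" "b \<noteq> 0" "s / t \<noteq> 0" using nz' by simp_all
  show "s / t * q ^ m \<noteq> q ^ n" for m n
    using not_pw_mult[of "s / t" "q ^ m"] not_pw[of "s / t"] pw_power[OF pw_q] q_nz by auto
  show "s / t * b * q ^ n \<noteq> 1" "s * t * q ^ n \<noteq> 1" for n by (intro generic_neq not_pw; simp)+
  have "\<not> pw (s * t / b * q)" by (intro not_pw_mult not_pw pw_q q_nz) simp
  from generic_neq[OF this] show "q * (s * t) / b * q ^ n \<noteq> 1" for n by (simp add: mult_ac)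
  have "\<not> pw (s * t * (s / t))" using not_pw[of "s * s"] nz' by simp
  from generic_neq[OF this] show "s * t * (s / t) * q ^ n \<noteq> 1" for n .
qed

text \<open>In the function u whose residues are summed, the entries q / h and h / x, with those of
  \<open>Bs\<close>, form theta(h / u) theta(h u / x). Replacing u by q u multiplies this by x / (q
  u^2), which is free of h. Hence h leaves every residue sum as a constant theta factor.\<close>

definition As :: "nat \<Rightarrow> complex" where
  "As i = [q * (s * t) / b, s / t * b, s * s, s * s * x, q / h, h / x] ! i"
text \<open>The last four entries represent (s^2 u^2; q)_inf, split by
  \<open>qpoch_inf_quadruple\<close>.\<close>

definition vs :: "nat \<Rightarrow> complex" where
  "vs i = [s * t, s / t, s, - s, rq * s, - (rq * s)] ! i"
definition Bs :: "nat \<Rightarrow> complex" where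
  "Bs i = [h, q * x / h] ! i"
definition ws :: "nat \<Rightarrow> complex" where
  "ws i = [1, x] ! i"

lemma lessThan_6: "{..<6::nat} = {0, 1, 2, 3, 4, 5}" by auto
lemma lessThan_2: "{..<2::nat} = {0, 1}" by auto

lemma vs_nz: "i < 6 \<Longrightarrow> vs i \<noteq> 0"
proof -
  assume "i < 6"
  hence "i \<in> {0, 1, 2, 3, 4, 5}" by auto
  thus ?thesis using nz' rq_nz by (auto simp: vs_def)
qed

text \<open>After division by s the entries are t, 1/t, 1, -1, rq, - rq. The first two lie outside
  the group of \<open>pw\<close>, the others inside, so the classes cannot mix. Among the first two,
  t^2 is generic. Among the others, q^n is an even power of \<open>rq\<close> in norm, which
  separates 1, -1 from rq, - rq; equal parity forces n = 0.\<close>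

lemma vs_distinct:
  assumes "i < 6" "i' < 6" "i \<noteq> i'"
  shows "vs i' * q ^ n \<noteq> vs i"
proof
  define u where "u = (\<lambda>i. [t, 1 / t, 1, - 1, rq, - rq] ! i)"
  have mem: "i \<in> {0, 1, 2, 3, 4, 5}" "i' \<in> {0, 1, 2, 3, 4, 5}" using assms by auto
  have vs: "vs i = s * u i" if "i \<in> {0, 1, 2, 3, 4, 5}" for i
    using that by (auto simp: vs_def u_def)
  assume "vs i' * q ^ n = vs i"
  hence eq: "u i' * q ^ n = u i" using vs[OF mem(1)] vs[OF mem(2)] nz' by simp
  have pt: "\<not> pw t" "\<not> pw (t * t)" "\<not> pw (1 / t)" "\<not> pw (1 / t / t)"
  proof -
    show t: "\<not> pw t" "\<not> pw (t * t)" by (intro not_pw; simp)+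
    show "\<not> pw (1 / t)" using t pw_divide[OF pw_1, of "1 / t"] nz' by auto
    show "\<not> pw (1 / t / t)" using t pw_divide[OF pw_1, of "1 / t / t"] nz' by auto
  qed
  have pc: "pw (u i)" if "i \<in> {2, 3, 4, 5}" for i
    using that by (auto simp: u_def intro!: pw_intros)
  have qn: "pw (q ^ n)" "q ^ n \<noteq> 0" using q_nz by (auto intro!: pw_intros)
  have npc: "\<not> pw (u i)" if "i \<in> {0, 1}" for i using that pt by (auto simp: u_def)
  have in0: "i \<in> {2, 3, 4, 5}" if "i' \<in> {2, 3, 4, 5}"
    using npc[of i] pc[OF that] eq pw_mult[OF pc[OF that] qn(1)] mem by auto
  have in1: "i' \<in> {2, 3, 4, 5}" if "i \<in> {2, 3, 4, 5}"
    using not_pw_mult[OF npc[of i'] qn] pc[OF that] eq mem by auto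
  have both: "i \<in> {0, 1} \<and> i' \<in> {0, 1} \<or> i \<in> {2, 3, 4, 5} \<and> i' \<in> {2, 3, 4, 5}"
    using in0 in1 mem by auto
  have nq: "norm q = norm rq * norm rq" using rq by (metis norm_mult power2_eq_square)
  have nr: "0 < norm rq" "norm rq < 1"
  proof -
    show "0 < norm rq" using rq_nz by simp
    show "norm rq < 1" using norm_q unfolding rq[symmetric] norm_power by (simp add: power2_less_1_iff abs_less_iff)
  qed
  have n1: "norm rq ^ m \<noteq> 1" if "m > 0" for m
    using nr that by (metis power_Suc_less_one less_irrefl gr0_implies_Suc power_Suc_le_self order_less_le)
  show False
  proof (cases "i \<in> {0, 1}")
    case True
    with both have "i' \<in> {0, 1}" by auto
    hence "t * q ^ n = 1 / t \<or> 1 / t * q ^ n = t" using True assms(3) eq by (auto simp: u_def)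
    hence "t * t * q ^ n = 1 \<or> 1 / t / t * q ^ n = 1" using nz' by (auto simp: field_simps)
    thus False using generic_neq pt by blast
  next
    case False
    with both have m: "i \<in> {2, 3, 4, 5}" "i' \<in> {2, 3, 4, 5}" by auto
    have nu: "norm (u i) = (if i \<in> {2, 3} then 1 else norm rq)" if "i \<in> {2, 3, 4, 5}" for i
      using that by (auto simp: u_def)
    have nqn: "norm (q ^ n) = norm rq ^ (2 * n)"
      by (simp add: norm_power nq power_mult power2_eq_square)
    have e: "norm (u i') * norm rq ^ (2 * n) = norm (u i)"
      using arg_cong[OF eq, of norm] by (simp only: norm_mult nqn)
    show False
    proof (cases "i \<in> {2, 3} \<longleftrightarrow> i' \<in> {2, 3}")
      case True
      hence "norm rq ^ (2 * n) = 1" using e nu m rq_nz by (auto split: if_splits)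
      hence "n = 0" using n1[of "2 * n"] by auto
      thus False using eq m True assms(3) rq_nz by (auto simp: u_def eq_neg_iff_add_eq_0)
    next
      case False
      hence "norm rq ^ (2 * n) = norm rq \<or> norm rq * norm rq ^ (2 * n) = 1" using e nu m by (auto split: if_splits)
      moreover have "norm rq * norm rq ^ (2 * n) \<noteq> 1" using n1[of "Suc (2 * n)"] by simp
      moreover have "norm rq ^ (2 * n) \<noteq> norm rq"
      proof (cases n)
        case (Suc k)
        thus ?thesis using n1[of "Suc (2 * k)"] rq_nz by auto
      qed (use nr in auto)
      ultimately show False by blast
    qed
  qed
qed

lemma vs_ws: assumes "i < 6" "j < 2" shows "vs i * ws j * q ^ n \<noteq> 1"
proof -
  have mem: "i \<in> {0, 1, 2, 3, 4, 5}" "j \<in> {0, 1}" using assms by auto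
  have g: "y * u * q ^ n \<noteq> 1" if "\<not> pw y" "pw u" "u \<noteq> 0" for y u
    by (intro generic_neq not_pw_mult that)
  \<comment> \<open>This monomial is z. It is not in the list of generic ones, but its norm is below
    1.\<close>
  have "s / t * x * q ^ n \<noteq> 1"
  proof
    assume "s / t * x * q ^ n = 1"
    hence "norm (s / t * x) * norm (q ^ n) = 1" by (metis norm_mult norm_one)
    moreover have "norm (s / t * x) * norm (q ^ n) \<le> norm (s / t * x)"
      using norm_q_power_le_1[of n] by (intro mult_left_le) auto
    ultimately show False using norm_z by linarith
  qed
  moreover note g[of "s * t" 1] g[of "s / t" 1] g[of s 1] g[of s "- 1"] g[of s rq] g[of s "- rq"]
    g[of "s * t * x" 1] g[of "s * x" 1] g[of "s * x" "- 1"] g[of "s * x" rq] g[of "s * x" "- rq"]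
  ultimately show ?thesis
    using mem not_pw[of "s * t"] not_pw[of "s / t"] not_pw[of s] not_pw[of "s * t * x"] not_pw[of "s
        * x"] rq_nz pw_1 pw_rq pw_uminus[OF pw_1] pw_uminus[OF pw_rq]
    by (auto simp: vs_def ws_def mult_ac)
qed

lemma x_pow: "x * q ^ n \<noteq> 1" "q ^ n \<noteq> x"
  using generic_neq[OF not_pw[of x]] not_pw[of x] pw_power[OF pw_q] by auto

text \<open>This quotient and the next are both q, so all eight residue series converge and have
  argument q.\<close>

lemma ratio_As: "(\<Prod>i<6. As i) / (\<Prod>i<6. vs i) = q"
  using nz' rq_nz q_nz rq unfolding lessThan_6 by (simp add: As_def vs_def power2_eq_square field_simps)

lemma ratio_Bs: "(\<Prod>i<2. Bs i) / (\<Prod>i<2. ws i) = q"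
  using nz' unfolding lessThan_2 by (simp add: Bs_def ws_def)

lemma residue_identity:
  "(\<Sum>j<2. residue_sum 2 Bs ws 6 As vs j) = (\<Sum>i<6. residue_sum 6 As vs 2 Bs ws i)"
proof (rule residue_sums_eq)
  show "As i \<noteq> 0" if "i < 6" for i
  proof -
    have "i \<in> {0, 1, 2, 3, 4, 5}" using that by auto
    thus ?thesis using nz' q_nz by (auto simp: As_def)
  qed
  show "Bs j \<noteq> 0" "ws j \<noteq> 0" if "j < 2" for j
  proof -
    have "j \<in> {0, 1}" using that by auto
    thus "Bs j \<noteq> 0" "ws j \<noteq> 0" using nz' q_nz by (auto simp: Bs_def ws_def)
  qed
  show "ws j' * q ^ n \<noteq> ws j" if "j < 2" "j' < 2" "j \<noteq> j'" for j j' n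
  proof -
    have "j \<in> {0, 1}" "j' \<in> {0, 1}" using that by auto
    thus ?thesis using that(3) x_pow[of n] by (auto simp: ws_def)
  qed
qed (use vs_nz vs_distinct vs_ws norm_q in \<open>auto simp: ratio_As ratio_Bs\<close>)

lemma alpha_eq: "s * t * (s / t) = s * s"
  using nz' by simp

lemma qpoch_inf_quad_shift:
  "qpoch_inf (s * y) q * qpoch_inf (- s * y) q * qpoch_inf (rq * s * y) q * qpoch_inf (- (rq * s) * y) q
     = qpoch_inf (s * s * y\<^sup>2) q"
  using qpoch_inf_quadruple[OF rq, of "s * y"] by (simp add: power2_eq_square mult_ac)

lemma vs_qpow_nz: "i < 6 \<Longrightarrow> qpoch_inf (vs i * q ^ k) q \<noteq> 0"
  "i < 6 \<Longrightarrow> qpoch_inf (vs i * x * q ^ k) q \<noteq> 0"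
proof -
  assume i: "i < 6"
  show "qpoch_inf (vs i * q ^ k) q \<noteq> 0"
    using vs_ws[OF i, of 0 "k + n" for n] by (intro qpoch_inf_nonzero) (simp add: ws_def power_add mult.assoc)
  show "qpoch_inf (vs i * x * q ^ k) q \<noteq> 0"
    using vs_ws[OF i, of 1 "k + n" for n] by (intro qpoch_inf_nonzero) (simp add: ws_def power_add mult.assoc)
qed

lemma vs_simps: "vs 0 = s * t" "vs (Suc 0) = s / t" "vs 1 = s / t" "vs 2 = s" "vs 3 = - s" "vs 4 = rq * s" "vs 5 = - (rq * s)"
  by (simp_all add: vs_def)

lemma As_simps: "As 0 = q * (s * t) / b" "As (Suc 0) = s / t * b" "As 1 = s / t * b" "As 2 = s * s" "As 3 = s * s
    * x" "As 4 = q / h" "As 5 = h / x"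
  by (simp_all add: As_def)

lemma Bs_simps: "Bs 0 = h" "Bs (Suc 0) = q * x / h" "Bs 1 = q * x / h"
  by (simp_all add: Bs_def)

lemma ws_simps: "ws 0 = 1" "ws (Suc 0) = x" "ws 1 = x"
  by (simp_all add: ws_def)

lemma theta_x_nz: "qtheta x q \<noteq> 0"
proof -
  have "q / x * q ^ n \<noteq> 1" for n using x_pow(2)[of "Suc n"] nz' by (auto simp: field_simps)
  thus ?thesis using x_pow(1) by (simp add: qtheta_eq qpoch_inf_nonzero)
qed

lemma infinite_nz: "qpoch_inf (s * t) q \<noteq> 0" "qpoch_inf (s / t) q \<noteq> 0" "qpoch_inf (q * (s * t) / b) q \<noteq> 0"
  "qpoch_inf (s / t * b) q \<noteq> 0" "qpoch_inf (s * s) q \<noteq> 0" "qpoch_inf q q \<noteq> 0"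
  "qpoch_inf (s * t * x) q \<noteq> 0" "qpoch_inf (s / t * x) q \<noteq> 0"
proof -
  show "qpoch_inf (s * t * x) q \<noteq> 0" "qpoch_inf (s / t * x) q \<noteq> 0"
    using vs_qpow_nz(2)[of 0 0] vs_qpow_nz(2)[of 1 0] by (simp_all add: vs_simps)
  have "qpoch_inf (s * t * (s / t)) q \<noteq> 0" by (intro qpoch_inf_nonzero \<alpha>_pow)
  thus "qpoch_inf (s * s) q \<noteq> 0" unfolding alpha_eq .
qed (intro qpoch_inf_nonzero a_pow \<beta>_pow1 ab_pow c_pow q_mult_power_neq_1)+

lemma lam_nz: "lam \<noteq> 0"
  unfolding lam_def using infinite_nz by simp

lemma qpoch_as_quotient: "qpoch_inf c q \<noteq> 0 \<Longrightarrow> qpoch c q k = qpoch_inf c q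
    * inverse (qpoch_inf (c * q ^ k) q)"
proof -
  assume c: "qpoch_inf c q \<noteq> 0"
  have "qpoch_inf c q = qpoch c q k * qpoch_inf (c * q ^ k) q" by (rule qpoch_inf_split)
  moreover from this c have "qpoch_inf (c * q ^ k) q \<noteq> 0" by auto
  ultimately show ?thesis by simp
qed

text \<open>Puts \<open>d k\<close> into the shape in which it occurs in the residues at u = q^k,
  with infinite factorials starting at multiples of q^k and (q^k)^2.\<close>

lemma d_coeff_eq:
  "d k = lam * (qpoch_inf (q * (s * t) / b * q ^ k) q * inverse (qpoch_inf (s * t * q ^ k) q)
     * (qpoch_inf (s / t * b * q ^ k) q * inverse (qpoch_inf (s / t * q ^ k) q))
     * (qpoch_inf (s * s * q ^ k) q * inverse (qpoch_inf (s * s * (q ^ k)\<^sup>2) q)) * inverse (qpoch q q k))"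
proof -
  have i2: "inverse (inverse u) = u" for u :: complex by simp
  have p: "s * s * q ^ (2 * k) = s * s * (q ^ k)\<^sup>2" by (simp add: power_mult[symmetric] mult.commute)
  have alg: "A * iA' * (B * iB') * (S * iS2) / (Q * (C * iC') * (D * iD') * (S * iS'))
     = A * B / (C * D) * (inverse iC' * iA' * (inverse iD' * iB') * (inverse iS' * iS2) * inverse Q)"
    if "S \<noteq> 0" for A iA' B iB' S iS2 Q C iC' D iD' iS' :: complex
    using that by (simp add: divide_inverse mult_ac)
  show ?thesis
    unfolding d_coeff_def lam_def alpha_eq
      qpoch_as_quotient[OF infinite_nz(1), of k] qpoch_as_quotient[OF infinite_nz(2), of k]
      qpoch_as_quotient[OF infinite_nz(3), of k] qpoch_as_quotient[OF infinite_nz(4), of k]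
      qpoch_as_quotient[OF infinite_nz(5)] p
      alg[OF infinite_nz(5)] i2 ..
qed

text \<open>For every k the finite and infinite factorials with h recombine to the same two theta
  values. The four root factors combine to the factorial at s^2 q^(2k), which belongs to
  \<open>d k\<close>.\<close>

lemma residue_w0:
  "residue_sum 2 Bs ws 6 As vs 0 = qtheta h q * qtheta (h / x) q / (qtheta x q * qpoch_inf q q * lam) * W1 x"
proof -
  have trm: "residue_coeff 2 Bs ws 6 As vs 0 k = qtheta h q * qtheta (h / x) q / (qtheta x q * qpoch_inf q q * lam)
      * t1 k x" for k
  proof -
    have d01: "{0, 1} - {0} = {1 :: nat}" by auto
    have th: "qtheta h q = qpoch_inf h q * (qpoch (q / h) q k * qpoch_inf (q / h * q ^ k) q)"
      unfolding qtheta_eq using qpoch_inf_split[of "q / h" k] by simp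
    have thx: "qtheta (h / x) q = qpoch (h / x) q k * qpoch_inf (h / x * q ^ k) q * qpoch_inf (q * x / h) q"
      unfolding qtheta_eq using qpoch_inf_split[of "h / x" k] by simp
    have tx: "qtheta x q = qpoch_inf x q * (qpoch (q / x) q k * qpoch_inf (q / x * q ^ k) q)"
      unfolding qtheta_eq using qpoch_inf_split[of "q / x" k] by simp
    have nzx: "qpoch_inf (q / x * q ^ k) q \<noteq> 0" using theta_x_nz unfolding tx by auto
    have Q: "inverse (qpoch_inf (s * s * (q ^ k)\<^sup>2) q) = inverse (qpoch_inf (s * q ^ k) q)
        * inverse (qpoch_inf (- s * q ^ k) q)
        * inverse (qpoch_inf (rq * s * q ^ k) q) * inverse (qpoch_inf (- (rq * s) * q ^ k) q)"
      unfolding qpoch_inf_quad_shift[symmetric] by simp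
    have arg: "q * 1 / h = q / h" "h / 1 = h" "q * 1 / (q * x / h) = h / x" "q * x / h / 1 = q * x / h" "q * 1 / x
        = q / x" "x / 1 = x"
       "\<And>y. y * 1 * q ^ k = y * q ^ k" "s * t * (s / t) * x * q ^ k = s * s * x * q ^ k"
      using q_nz nz' by simp_all
    have alg: "Hk * H * (Gk * G) * (inverse Xk * inverse X) * (inverse Qk * inverse Q) *
       (A0 * v0 * (A1 * v1 * (A2 * v2 * (A3 * v3 * (Hq * v4 * (Gq * v5))))))
      = H * (Hk * Hq) * (Gk * Gq * G) / (X * (Xk * Xq) * Q * L) * (L * (A0 * v0 * (A1 * v1) * (A2 * (v2 * v3 * v4
          * v5)) * inverse Qk) * (A3 * Xq))"
      if "Xq \<noteq> 0" "L \<noteq> 0" for Hk H Gk G Xk X Qk Q A0 v0 A1 v1 A2 v2 A3 v3 Hq v4 Gq v5 L Xq :: complex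
      using that by (simp add: divide_inverse mult_ac) (auto simp: field_simps)
    have E: "residue_coeff 2 Bs ws 6 As vs 0 k =
       qpoch (q / h) q k * qpoch_inf h q * (qpoch (h / x) q k * qpoch_inf (q * x / h) q)
       * (inverse (qpoch (q / x) q k) * inverse (qpoch_inf x q)) * (inverse (qpoch q q k) * inverse (qpoch_inf q q))
       * (qpoch_inf (q * (s * t) / b * q ^ k) q * inverse (qpoch_inf (s * t * q ^ k) q)
         * (qpoch_inf (s / t * b * q ^ k) q * inverse (qpoch_inf (s / t * q ^ k) q)
         * (qpoch_inf (s * s * q ^ k) q * inverse (qpoch_inf (s * q ^ k) q)
         * (qpoch_inf (s * s * x * q ^ k) q * inverse (qpoch_inf (- s * q ^ k) q)
         * (qpoch_inf (q / h * q ^ k) q * inverse (qpoch_inf (rq * s * q ^ k) q)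
         * (qpoch_inf (h / x * q ^ k) q * inverse (qpoch_inf (- (rq * s) * q ^ k) q)))))))"
      unfolding residue_coeff_def lessThan_2 lessThan_6 d01
      using q_nz nz' by (simp add: Bs_simps ws_simps As_simps vs_simps arg)
    show ?thesis
      unfolding E t1_def d_coeff_eq Q th thx tx arg(8)
      by (rule alg[OF nzx lam_nz])
  qed
  have "summable (\<lambda>k. q ^ k * t1 k x)" by (rule summable_t1) (use nz' in simp)
  thus ?thesis
    unfolding residue_sum_def ratio_Bs W1_def trm
    by (subst suminf_mult[symmetric]) (simp_all add: mult_ac)
qed

text \<open>At u = x q^k the two theta factors exchange their roles, so the same constant appears.
  The minus sign and the factor x arise from writing theta(x) as - x times (1/x; q)_inf (q x;
  q)_inf.\<close>

lemma residue_w1: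
  "residue_sum 2 Bs ws 6 As vs 1 = - (qtheta h q * qtheta (h / x) q * x / (qtheta x q * qpoch_inf q q
      * qpoch_inf (s * t * x) q * qpoch_inf (s / t * x) q)) * W2 x"
proof -
  let ?A = "qpoch_inf (s * t * x) q" and ?B = "qpoch_inf (s / t * x) q"
  have trm: "residue_coeff 2 Bs ws 6 As vs 1 k = - (qtheta h q * qtheta (h / x) q * x / (qtheta x q * qpoch_inf q q
      * ?A * ?B)) * t2 k x" for k
  proof -
    have d01: "{0, 1} - {1} = {0 :: nat}" by auto
    have th: "qtheta h q = qpoch h q k * qpoch_inf (h * q ^ k) q * qpoch_inf (q / h) q"
      unfolding qtheta_eq using qpoch_inf_split[of h k] by simp
    have thx: "qtheta (h / x) q = qpoch_inf (h / x) q * (qpoch (q * x / h) q k * qpoch_inf (q * x / h * q ^ k) q)"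
      unfolding qtheta_eq using qpoch_inf_split[of "q * x / h" k] by simp
    have tx: "qtheta x q = - x * (qpoch_inf (1 / x) q * (qpoch (q * x) q k * qpoch_inf (q * x * q ^ k) q))"
    proof -
      have e1: "qpoch_inf (1 / x) q = (1 - 1 / x) * qpoch_inf (q / x) q" using qpoch_inf_Suc[of "1 / x"] by simp
      have e2: "qpoch_inf x q = (1 - x) * qpoch_inf (q * x) q" using qpoch_inf_Suc[of x] by (simp add: mult.commute)
      show ?thesis
        unfolding qtheta_eq qpoch_inf_split[of "q * x" k, symmetric] e1 e2 using nz' by (simp add: field_simps)
    qed
    have nz2: "qpoch_inf (q * x * q ^ k) q \<noteq> 0" using theta_x_nz unfolding tx by auto
    have A: "?A = qpoch (s * t * x) q k * qpoch_inf (s * t * x * q ^ k) q" by (rule qpoch_inf_split)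
    have B: "?B = qpoch (s / t * x) q k * qpoch_inf (s / t * x * q ^ k) q" by (rule qpoch_inf_split)
    have nzAB: "qpoch (s * t * x) q k \<noteq> 0" "qpoch (s / t * x) q k \<noteq> 0" using infinite_nz(7,8) unfolding A B by auto
    have nz4: "qpoch_inf (s * x * q ^ k) q \<noteq> 0" "qpoch_inf (- s * x * q ^ k) q \<noteq> 0" "qpoch_inf (rq
        * s * x * q ^ k) q \<noteq> 0" "qpoch_inf (- (rq * s) * x * q ^ k) q \<noteq> 0"
      using vs_qpow_nz(2)[of 2 k] vs_qpow_nz(2)[of 3 k] vs_qpow_nz(2)[of 4 k] vs_qpow_nz(2)[of 5 k] by (simp_all add: vs_simps)
    have Q: "qpoch_inf (s * s * x * x * q ^ k) q = qpoch (s * s * x\<^sup>2 * q ^ k) q k *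
        (qpoch_inf (s * x * q ^ k) q * qpoch_inf (- s * x * q ^ k) q * qpoch_inf (rq * s * x * q ^ k) q
            * qpoch_inf (- (rq * s) * x * q ^ k) q)"
    proof -
      have "qpoch_inf (s * s * x\<^sup>2 * q ^ k) q = qpoch (s * s * x\<^sup>2 * q ^ k) q k * qpoch_inf (s * s
          * x\<^sup>2 * q ^ k * q ^ k) q"
        by (rule qpoch_inf_split)
      also have "s * s * x\<^sup>2 * q ^ k * q ^ k = s * s * (x * q ^ k)\<^sup>2" by (simp add: power2_eq_square mult_ac)
      finally show ?thesis
        unfolding qpoch_inf_quad_shift[symmetric] by (simp add: power2_eq_square mult_ac)
    qed
    have arg: "q * x / (q * x / h) = h" "q * x / h / x = q / h" "q * x / 1 = q * x" "q / h * x = q * x / h" "h / x * x = h"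
      using q_nz nz' by simp_all
    have alg: "Hk * H * (Gk * G) * (inverse Xk * inverse X) * (inverse Qk * inverse Q) *
       (A0 * inverse v0 * (A1 * inverse v1 * (A2 * inverse v2 * (P * (v2 * v3 * v4 * v5) * inverse v3 * (Hq
           * inverse v4 * (Gq * inverse v5))))))
      = - ((Gk * Gq * G) * (H * (Hk * Hq)) * x / (- x * (X * (Xk * Xq)) * Q * (a0 * v0) * (a1 * v1)))
         * (Xq * A0 * A1 * A2 * P * a0 * a1 * inverse Qk)"
      if "Xq \<noteq> 0" "a0 \<noteq> 0" "a1 \<noteq> 0" "v2 \<noteq> 0" "v3 \<noteq> 0" "v4 \<noteq> 0"
          "v5 \<noteq> 0" "x \<noteq> 0"
      for Hk H Gk G Xk X Qk Q A0 v0 A1 v1 A2 v2 v3 Hq v4 Gq v5 P Xq a0 a1 x :: complex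
      using that by (simp add: divide_inverse mult_ac) (auto simp: field_simps)
    have E: "residue_coeff 2 Bs ws 6 As vs 1 k =
       qpoch (q * x / h) q k * qpoch_inf (h / x) q * (qpoch h q k * qpoch_inf (q / h) q)
       * (inverse (qpoch (q * x) q k) * inverse (qpoch_inf (1 / x) q)) * (inverse (qpoch q q k) * inverse (qpoch_inf q q))
       * (qpoch_inf (q * (s * t) / b * x * q ^ k) q * inverse (qpoch_inf (s * t * x * q ^ k) q)
         * (qpoch_inf (s / t * b * x * q ^ k) q * inverse (qpoch_inf (s / t * x * q ^ k) q)
         * (qpoch_inf (s * s * x * q ^ k) q * inverse (qpoch_inf (s * x * q ^ k) q)
         * (qpoch_inf (s * s * x * x * q ^ k) q * inverse (qpoch_inf (- s * x * q ^ k) q)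
         * (qpoch_inf (q * x / h * q ^ k) q * inverse (qpoch_inf (rq * s * x * q ^ k) q)
         * (qpoch_inf (h * q ^ k) q * inverse (qpoch_inf (- (rq * s) * x * q ^ k) q)))))))"
      unfolding residue_coeff_def lessThan_2 lessThan_6 d01
      using q_nz nz' by (simp add: Bs_simps ws_simps As_simps vs_simps arg)
    show ?thesis
      unfolding E Q t2_def th thx tx A B alpha_eq
      by (rule alg[OF nz2 nzAB nz4 nz'(4)])
  qed
  have "summable (\<lambda>k. q ^ k * t2 k x)"
  proof -
    obtain C where "eventually (\<lambda>y. \<forall>k. norm (t2 k y) \<le> C) (nhds x)"
      using t2_bounded unfolding locally_unif_bounded_def by auto
    from eventually_nhds_x_imp_x[OF this] have "Bseq (\<lambda>k. t2 k x)" by (intro BseqI') blast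
    thus ?thesis by (rule summable_geometric_Bseq)
  qed
  thus ?thesis
    unfolding residue_sum_def ratio_Bs W2_def trm
    by (subst suminf_mult[symmetric]) (simp_all add: mult_ac)
qed

text \<open>Since both residue sums carry the same theta values, they enter in exactly the
  combination of \<open>W1\<close> and \<open>W2\<close> that \<open>defect_eq_0\<close>
  evaluates.\<close>

theorem product_as_residues:
  "qtheta h q * qtheta (h / x) q * (f1 (s / t * x) * f2 (s / t * x))
     = lam * qpoch_inf q q * qpoch_inf (s * t * x) q / qpoch_inf (s / t * x) q
       * (\<Sum>i<6. residue_sum 6 As vs 2 Bs ws i)"
proof -
  have "(\<Sum>i<6. residue_sum 6 As vs 2 Bs ws i) = residue_sum 2 Bs ws 6 As vs 0 + residue_sum 2 Bs ws 6 As vs 1"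
    unfolding residue_identity[symmetric] lessThan_2 by simp
  note S = this[unfolded residue_w0 residue_w1]
  have "defect x = 0" using nz' norm_z by (intro defect_eq_0) auto
  hence D: "qpoch_inf (s * t * x) q * qpoch_inf (s / t * x) q * W1 x - lam * x * W2 x
     = qtheta x q * (qpoch_inf (s / t * x) q * (qpoch_inf (s / t * x) q * (f1 (s / t * x) * f2 (s / t * x))))"
    unfolding defect_def power2_eq_square eq_iff_diff_eq_0[symmetric] by (simp only: mult.assoc)
  have alg: "L * Q * A / B * (TT / (X * Q * L) * w1 + - (TT * x / (X * Q * A * B)) * w2) = TT / (X * B * B) * (A
      * B * w1 - L * x * w2)"
    if "L \<noteq> 0" "Q \<noteq> 0" "A \<noteq> 0" "B \<noteq> 0" "X \<noteq> 0" for L Q A B TT X w1 w2 :: complex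
    using that by (simp add: field_simps)
  show ?thesis
    unfolding S alg[OF lam_nz infinite_nz(6-8) theta_x_nz] D
    using theta_x_nz infinite_nz by simp
qed

text \<open>At u = 1 / (v q^k) the entries with h again recombine to theta values independent of k.
  The remaining k-dependent factors have six parameters above and five below besides (q; q)_k, the
  shape of a 6phi5.\<close>

lemma residue_v:
  assumes i: "i < 6"
  defines "vv \<equiv> vs i"
  shows "residue_sum 6 As vs 2 Bs ws i =
    qtheta (h * vv) q * qtheta (h / (x * vv)) q
    * (qpoch_inf (As 0 / vv) q * qpoch_inf (As 1 / vv) q * qpoch_inf (As 2 / vv) q * qpoch_inf (As 3 / vv) q)
    * (\<Prod>i'\<in>{..<6} - {i}. inverse (qpoch_inf (vs i' / vv) q))
    * inverse (qpoch_inf q q * qpoch_inf vv q * qpoch_inf (x * vv) q)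
    * (\<Sum>k. q ^ k * (qpoch (q * vv / As 0) q k * qpoch (q * vv / As 1) q k * qpoch (q * vv / As 2) q k
        * qpoch (q * vv / As 3) q k
        * qpoch vv q k * qpoch (x * vv) q k * (\<Prod>i'\<in>{..<6} - {i}. inverse (qpoch (q * vv / vs i') q k))
            * inverse (qpoch q q k)))"
proof -
  let ?J = "{..<6} - {i}"
  define C where "C = qtheta (h * vv) q * qtheta (h / (x * vv)) q
    * (qpoch_inf (As 0 / vv) q * qpoch_inf (As 1 / vv) q * qpoch_inf (As 2 / vv) q * qpoch_inf (As 3 / vv) q)
    * (\<Prod>i'\<in>?J. inverse (qpoch_inf (vs i' / vv) q))
    * inverse (qpoch_inf q q * qpoch_inf vv q * qpoch_inf (x * vv) q)"
  define T where "T = (\<lambda>k. qpoch (q * vv / As 0) q k * qpoch (q * vv / As 1) q k * qpoch (q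
      * vv / As 2) q k * qpoch (q * vv / As 3) q k
        * qpoch vv q k * qpoch (x * vv) q k * (\<Prod>i'\<in>?J. inverse (qpoch (q * vv / vs i') q k)) * inverse (qpoch q q k))"
  have vv0: "vv \<noteq> 0" using vs_nz[OF i] by (simp add: vv_def)
  have trm: "residue_coeff 6 As vs 2 Bs ws i k = C * T k" for k
  proof -
    have arg: "q * vv / (q / h) = h * vv" "q / h / vv = q / (h * vv)" "q * vv / (h / x) = q * x / h * vv"
        "h / x / vv = h / (x * vv)"
      "1 * vv * q ^ k = vv * q ^ k"
      using nz' q_nz vv0 by simp_all
    have E: "residue_coeff 6 As vs 2 Bs ws i k =
       qpoch (q * vv / As 0) q k * qpoch_inf (As 0 / vv) q * (qpoch (q * vv / As 1) q k * qpoch_inf (As 1 / vv) q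
        * (qpoch (q * vv / As 2) q k * qpoch_inf (As 2 / vv) q * (qpoch (q * vv / As 3) q k * qpoch_inf (As 3 / vv) q
        * (qpoch (h * vv) q k * qpoch_inf (q / (h * vv)) q * (qpoch (q * x / h * vv) q k * qpoch_inf (h / (x * vv)) q)))))
       * ((\<Prod>i'\<in>?J. inverse (qpoch (q * vv / vs i') q k)) * (\<Prod>i'\<in>?J. inverse (qpoch_inf (vs i' / vv) q)))
       * (inverse (qpoch q q k) * inverse (qpoch_inf q q))
       * (qpoch_inf (h * vv * q ^ k) q * inverse (qpoch_inf (vv * q ^ k) q)
         * (qpoch_inf (q * x / h * vv * q ^ k) q * inverse (qpoch_inf (x * vv * q ^ k) q)))"
    proof -
      have 1: "(\<Prod>i'<6. qpoch (q * vv / As i') q k * qpoch_inf (As i' / vv) q) =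
         qpoch (q * vv / As 0) q k * qpoch_inf (As 0 / vv) q * (qpoch (q * vv / As 1) q k * qpoch_inf (As 1 / vv) q
        * (qpoch (q * vv / As 2) q k * qpoch_inf (As 2 / vv) q * (qpoch (q * vv / As 3) q k * qpoch_inf (As 3 / vv) q
        * (qpoch (q * vv / As 4) q k * qpoch_inf (As 4 / vv) q * (qpoch (q * vv / As 5) q k * qpoch_inf (As 5 / vv) q)))))"
        unfolding lessThan_6 by simp
      have 2: "(\<Prod>j<2. qpoch_inf (Bs j * vv * q ^ k) q * inverse (qpoch_inf (ws j * vv * q ^ k) q)) =
         qpoch_inf (Bs 0 * vv * q ^ k) q * inverse (qpoch_inf (ws 0 * vv * q ^ k) q) *
         (qpoch_inf (Bs 1 * vv * q ^ k) q * inverse (qpoch_inf (ws 1 * vv * q ^ k) q))"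
        unfolding lessThan_2 by simp
      have As45: "As 4 = q / h" "As 5 = h / x" by (simp_all add: As_simps)
      show ?thesis
        unfolding residue_coeff_def vv_def[symmetric] 1 2 As45 arg Bs_simps ws_simps
          prod.distrib[of _ _ ?J] ..
    qed
    have th: "qtheta (h * vv) q = qpoch (h * vv) q k * qpoch_inf (h * vv * q ^ k) q * qpoch_inf (q / (h * vv)) q"
      unfolding qtheta_eq using qpoch_inf_split[of "h * vv" k] by simp
    have e: "q / (h / (x * vv)) = q * x / h * vv" using nz' vv0 by simp
    have thx: "qtheta (h / (x * vv)) q = qpoch_inf (h / (x * vv)) q * (qpoch (q * x / h * vv) q k * qpoch_inf (q
        * x / h * vv * q ^ k) q)"
      unfolding qtheta_eq e qpoch_inf_split[of "q * x / h * vv" k] ..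
    have inf: "qpoch_inf vv q = qpoch vv q k * qpoch_inf (vv * q ^ k) q" "qpoch_inf (x * vv) q = qpoch (x * vv) q k
        * qpoch_inf (x * vv * q ^ k) q"
      by (rule qpoch_inf_split)+
    have "qpoch_inf vv q \<noteq> 0" "qpoch_inf (x * vv) q \<noteq> 0"
      using vs_qpow_nz[OF i, of 0] by (simp_all add: vv_def mult.commute)
    hence n: "qpoch vv q k \<noteq> 0" "qpoch (x * vv) q k \<noteq> 0" unfolding inf by auto
    have alg: "a0 * A0 * (a1 * A1 * (a2 * A2 * (a3 * A3 * (Hk * H * (Gk * G))))) * (P * PI) * (iq * inverse Q)
        * (Hq * inverse w0 * (Gq * inverse w1))
      = Hk * Hq * H * (G * (Gk * Gq)) * (A0 * A1 * A2 * A3) * PI * inverse (Q * (v0 * w0) * (v1 * w1)) * (a0 * a1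
          * a2 * a3 * v0 * v1 * P * iq)"
      if "v0 \<noteq> 0" "v1 \<noteq> 0" for a0 A0 a1 A1 a2 A2 a3 A3 Hk H Gk G P PI iq Q Hq w0 Gq w1 v0 v1 :: complex
      using that by (simp add: mult_ac) (auto simp: field_simps)
    show ?thesis unfolding C_def T_def E th thx inf by (rule alg[OF n])
  qed
  have "Bseq T"
  proof -
    have "q * vv / vs i' * q ^ n \<noteq> 1" if "i' \<in> ?J" for i' n
      using vs_distinct[of i' i "Suc n"] vs_nz[of i'] that i by (auto simp: vv_def field_simps)
    thus ?thesis unfolding T_def
      by (intro Bseq_mult Bseq_prod Bseq_qpoch Bseq_inverse_qpoch q_mult_power_neq_1)
  qed
  hence "(\<Sum>k. C * (q ^ k * T k)) = C * (\<Sum>k. q ^ k * T k)"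
    by (intro suminf_mult summable_geometric_Bseq)
  moreover have "residue_sum 6 As vs 2 Bs ws i = (\<Sum>k. C * (q ^ k * T k))"
    unfolding residue_sum_def ratio_As trm by (simp only: mult_ac)
  ultimately show ?thesis by (simp only: C_def T_def)
qed

end

section \<open>The theorem for generic parameters\<close>

text \<open>The list in \<open>generic_norms\<close> is that of \<open>qgen\<close>, entry by entry,
  translated by the dictionary \<open>monomials\<close>.\<close>

locale qparams = qbase +
  fixes z a b c h rq ra rb rc :: complex
  assumes nonzero: "z \<noteq> 0" "a \<noteq> 0" "b \<noteq> 0" "c \<noteq> 0" "h \<noteq> 0"
    and z_lt_1: "norm z < 1"
    and roots: "rq\<^sup>2 = q" "ra\<^sup>2 = a" "rb\<^sup>2 = b" "rc\<^sup>2 = c"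
    and generic_norms: "\<And>y k. y \<in> {ra * rb / rc, a * b / c, ra * rc / rb, ra * rb * z / rc, a, c / b, a
        * c / b, b * z / c, a * b * z / c, c, a / b}
        \<Longrightarrow> norm y \<noteq> norm rq powi (k :: int)"
begin

lemma root_nz: "rq \<noteq> 0" "ra \<noteq> 0" "rb \<noteq> 0" "rc \<noteq> 0"
  using roots nonzero q_nz by auto

lemma monomials:
  "ra * rc / rb * (ra * rb / rc) = a" "ra * rc / rb / (ra * rb / rc) = c / b"
  "ra * rb / rc * (ra * rb / rc) = a * b / c" "ra * rc / rb * (b * z / c) = ra * rb * z / rc"
  "ra * rc / rb * (ra * rc / rb) = a * c / b" "c / b * b = c" "c / b * (b * z / c) = z" "a * (b * z / c) = a * b * z / c"
  "q * a / (c / b * b) = q * a / c" "h / (b * z / c) = h * (c / (b * z))"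
  using root_nz nonzero unfolding roots(2-4)[symmetric] by (simp_all add: field_simps power2_eq_square)

sublocale qgen q rq "ra * rc / rb" "ra * rb / rc" b "b * z / c" h
proof
  show "rq\<^sup>2 = q" by (rule roots)
  show "ra * rc / rb \<noteq> 0" "ra * rb / rc \<noteq> 0" "b \<noteq> 0" "b * z / c \<noteq> 0" "h \<noteq> 0"
    using root_nz nonzero by simp_all
  show "norm (ra * rc / rb / (ra * rb / rc) * (b * z / c)) < 1"
    unfolding monomials by (rule z_lt_1)
  fix y and k :: int
  assume "y \<in> {ra * rb / rc, ra * rb / rc * (ra * rb / rc), ra * rc / rb, ra * rc / rb * (b * z / c),
      ra * rc / rb * (ra * rb / rc), ra * rc / rb / (ra * rb / rc), ra * rc / rb * (ra * rc / rb), b * z / c,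
      ra * rc / rb * (ra * rb / rc) * (b * z / c), ra * rc / rb / (ra * rb / rc) * b, ra * rc / rb * (ra * rb / rc) / b}"
  thus "norm y \<noteq> norm rq powi k"
    unfolding monomials by (rule generic_norms)
qed

lemma f1_eq: "f1 z = qphi [a, b] [c] q z"
  and f2_eq: "f2 z = qphi [a, q * a / c] [q * a / b] q z"
  unfolding f1_def f2_def eval_fps_def hyp_fps_nth qphi_def unfolding monomials
  by (simp_all add: hyp_def qpochs_def mult_ac)

lemma lam_eq: "lam = qpoch_inf a q * qpoch_inf (c / b) q / (qpoch_inf (q * a / b) q * qpoch_inf c q)"
  unfolding lam_def unfolding monomials ..

lemmas vs_eqs = vs_simps[unfolded monomials]
lemmas As_eqs = As_simps[unfolded monomials]
lemmas inf_nz = infinite_nz[unfolded monomials]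
lemmas lists = qthetas_Nil_Cons qpochs_inf_Nil_Cons mult_1_right
lemmas expand = roots[symmetric] power2_eq_square power3_eq_cube field_simps

abbreviation "R \<equiv> residue_sum 6 As vs 2 Bs ws"
abbreviation "pre \<equiv> lam * qpoch_inf q q * qpoch_inf (a * b * z / c) q / qpoch_inf z q"

lemma qphi_6_5:
  "qphi [a1, a2, a3, a4, a5, a6] [b1, b2, b3, b4, b5] q q
    = (\<Sum>k. q ^ k * (qpoch a1 q k * qpoch a2 q k * qpoch a3 q k * qpoch a4 q k * qpoch a5 q k * qpoch a6 q k
        * (inverse (qpoch b1 q k) * inverse (qpoch b2 q k) * inverse (qpoch b3 q k) * inverse (qpoch b4 q k)
            * inverse (qpoch b5 q k))
        * inverse (qpoch q q k)))"
  unfolding qphi_def qpochs_def by (intro suminf_cong) (simp add: divide_inverse mult_ac)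

text \<open>In \<open>U1\<close> and \<open>U2\<close> the four root parameters together give a
  single factorial, at c/(ab) and at ab/c respectively. It is the second copy of the repeated
  denominator factor there.\<close>

lemma quad_den:
  "inverse (qpoch_inf y q) * inverse (qpoch_inf (- y) q) * inverse (qpoch_inf (rq * y) q) * inverse (qpoch_inf (- (rq * y)) q)
    = inverse (qpoch_inf (y\<^sup>2) q)"
  unfolding qpoch_inf_quadruple[OF rq, symmetric] by simp

lemma less6: "(0 :: nat) < 6" "(1 :: nat) < 6"
  by simp_all

text \<open>The poles with v = a. The factor with \<open>As 3 / a\<close> = z cancels the
  denominator of \<open>pre\<close>, while \<open>As 2 / a\<close> = c/b repeats a factor of
  \<open>lam\<close> and makes it a square.\<close>

lemma U1_residue: "pre * R 0 = U1 q z a b c h rq ra rb rc"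
proof -
  let ?t = "ra * rb / rc"
  have d: "{..<6} - {0} = {1, 2, 3, 4, 5 :: nat}" by auto
  have args: "vs 0 = a" "q * a / As 0 = b" "q * a / As 1 = q * a / c" "q * a / As 2 = q * b / c" "q * a / As 3 = q / z"
     "As 0 / a = q / b" "As 1 / a = c / a" "As 2 / a = c / b" "As 3 / a = z"
     "q * a / vs 1 = q * a * b / c" "q * a / vs 2 = q * ?t" "q * a / vs 3 = - (q * ?t)"
     "q * a / vs 4 = rq * ra * rb / rc" "q * a / vs 5 = - (rq * ra * rb / rc)"
     "vs 1 / a = c / (a * b)" "vs 2 / a = rc / (ra * rb)" "vs 3 / a = - (rc / (ra * rb))"
     "vs 4 / a = rq * (rc / (ra * rb))" "vs 5 / a = - (rq * (rc / (ra * rb)))"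
     "b * z / c * a = a * b * z / c" "h / (a * b * z / c) = h * (c / (a * b * z))" "(rc / (ra * rb))\<^sup>2 = c / (a * b)"
    using root_nz nonzero unfolding vs_eqs As_eqs by (simp_all add: expand)
  have S: "(\<Sum>k. q ^ k * (qpoch b q k * qpoch (q * a / c) q k * qpoch (q * b / c) q k * qpoch (q / z) q k
        * qpoch a q k * qpoch (a * b * z / c) q k * (inverse (qpoch (q * a * b / c) q k) * (inverse (qpoch (q * ?t) q k)
        * (inverse (qpoch (- (q * ?t)) q k) * (inverse (qpoch (rq * ra * rb / rc) q k) * inverse (qpoch (- (rq * ra
            * rb / rc)) q k))))) * inverse (qpoch q q k)))
     = qphi [a, b, q * a / c, q * b / c, a * b * z / c, q / z] [q * a * b / c, rq * ra * rb / rc, - (rq * ra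
         * rb / rc), q * ?t, - (q * ?t)] q q"
    unfolding qphi_6_5 by (intro suminf_cong) (simp only: mult_ac)
  have alg: "A * B / (F * C) * Q * X / Z * (T1 * T2 * (A0 * A1 * B * Z) * (inverse D * (i1 * (i2 * (i3 * i4))))
      * inverse (Q * A * X) * S)
      = T1 * T2 * (A0 * (A1 * (B * B))) / (C * (D * (D * F))) * S"
    if "i1 * i2 * i3 * i4 = inverse D" "A \<noteq> 0" "Q \<noteq> 0" "X \<noteq> 0" "Z \<noteq> 0"
        for A B F C Q X Z T1 T2 A0 A1 D i1 i2 i3 i4 S :: complex
  proof -
    have "i1 * (i2 * (i3 * i4)) = inverse D" using that(1) by (simp only: mult_ac)
    thus ?thesis using that(2-) by (simp add: divide_inverse mult_ac) (auto simp: field_simps)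
  qed
  have prod: "(\<Prod>i\<in>{1, 2, 3, 4, 5 :: nat}. g i) = g 1 * (g 2 * (g 3 * (g 4 * g 5)))" for g :: "nat \<Rightarrow> complex"
    by simp
  show ?thesis
    unfolding residue_v[OF less6(1)] d prod args(1) args(2-) S U1_def lam_eq lists
    by (rule alg[OF quad_den[of "rc / (ra * rb)", unfolded args]]) (use inf_nz in simp_all)
qed

text \<open>The poles with v = c/b. The squares in the numerator arise because
  \<open>As 2 / v\<close> = a and \<open>As 3 / v\<close> = abz/c repeat factors of
  \<open>pre\<close>; the one of (z; q)_inf arises because x v = z.\<close>

lemma U2_residue: "pre * R 1 = U2 q z a b c h rq ra rb rc"
proof -
  let ?t = "rc / (ra * rb)" and ?\<beta> = "c / b"
  have d: "{..<6} - {1} = {0, 2, 3, 4, 5 :: nat}" by auto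
  have args: "vs 1 = ?\<beta>" "q * ?\<beta> / As 0 = c / a" "q * ?\<beta> / As 1 = q / b" "q * ?\<beta> / As 2
      = q / a" "q * ?\<beta> / As 3 = q * c / (a * b * z)"
     "As 0 / ?\<beta> = q * a / c" "As 1 / ?\<beta> = b" "As 2 / ?\<beta> = a" "As 3 / ?\<beta> = a * b * z / c"
     "q * ?\<beta> / vs 0 = q * c / (a * b)" "q * ?\<beta> / vs 2 = q * ?t" "q * ?\<beta> / vs 3 = - (q * ?t)"
     "q * ?\<beta> / vs 4 = rq * rc / (ra * rb)" "q * ?\<beta> / vs 5 = - (rq * rc / (ra * rb))"
     "vs 0 / ?\<beta> = a * b / c" "vs 2 / ?\<beta> = ra * rb / rc" "vs 3 / ?\<beta> = - (ra * rb / rc)"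
     "vs 4 / ?\<beta> = rq * (ra * rb / rc)" "vs 5 / ?\<beta> = - (rq * (ra * rb / rc))"
     "b * z / c * ?\<beta> = z" "(ra * rb / rc)\<^sup>2 = a * b / c"
    using root_nz nonzero unfolding vs_eqs As_eqs by (simp_all add: expand)
  have S: "(\<Sum>k. q ^ k * (qpoch (c / a) q k * qpoch (q / b) q k * qpoch (q / a) q k * qpoch (q * c / (a * b * z)) q k
        * qpoch ?\<beta> q k * qpoch z q k * (inverse (qpoch (q * c / (a * b)) q k) * (inverse (qpoch (q * ?t) q k)
        * (inverse (qpoch (- (q * ?t)) q k) * (inverse (qpoch (rq * rc / (ra * rb)) q k) * inverse (qpoch (- (rq
            * rc / (ra * rb))) q k))))) * inverse (qpoch q q k)))
     = qphi [q / a, q / b, c / a, c / b, z, q * c / (a * b * z)] [q * c / (a * b), rq * rc / (ra * rb), - (rq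
         * rc / (ra * rb)), q * ?t, - (q * ?t)] q q"
    unfolding qphi_6_5 by (intro suminf_cong) (simp only: mult_ac)
  have alg: "A * B / (F * C) * Q * X / Z * (T1 * T2 * (A0 * A1 * A * X) * (inverse D * (i1 * (i2 * (i3 * i4))))
      * inverse (Q * B * Z) * S)
      = T1 * T2 * (A * (A * (A1 * (A0 * (X * X))))) / (Z * (Z * (C * (F * (D * D))))) * S"
    if "i1 * i2 * i3 * i4 = inverse D" "B \<noteq> 0" "Q \<noteq> 0" for A B F C Q X Z T1 T2 A0 A1 D i1 i2 i3 i4 S :: complex
  proof -
    have "i1 * (i2 * (i3 * i4)) = inverse D" using that(1) by (simp only: mult_ac)
    thus ?thesis using that(2-) by (simp add: divide_inverse mult_ac) (auto simp: field_simps)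
  qed
  have prod: "(\<Prod>i\<in>{0, 2, 3, 4, 5 :: nat}. g i) = g 0 * (g 2 * (g 3 * (g 4 * g 5)))" for g :: "nat \<Rightarrow> complex"
    by simp
  show ?thesis
    unfolding residue_v[OF less6(2)] d prod args(1) args(2-) S U2_def lam_eq lists
    by (rule alg[OF quad_den[of "ra * rb / rc", unfolded args]]) (use inf_nz in simp_all)
qed

text \<open>The poles with v = s or v = - s. Here \<open>As 2 / v\<close> and
  \<open>As 3 / v\<close> are v and x v and cancel the denominator, while \<open>As 0 / v\<close>
  and \<open>As 1 / v\<close> have product q and form the third theta of \<open>V\<close>.\<close>

lemma V_residue:
  assumes e: "e = 1 \<and> i = 2 \<or> e = - 1 \<and> i = 3"
  shows "pre * R i = V e q z a b c h rq ra rb rc"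
proof -
  let ?s = "ra * rc / rb"
  let ?v = "e * ?s"
  have i: "i < 6" using e by auto
  have e1: "e \<noteq> 0" "e * e = 1" "\<And>y. e * (e * y) = y" using e by auto
  \<comment> \<open>The other five parameters are expressed by \<open>?v\<close>, so that one
    formula serves both signs. Changing the sign only permutes them.\<close>
  have prod: "(\<Prod>i'\<in>{..<6} - {i}. g (vs i')) = g a * (g (c / b) * (g (- ?v) * (g (rq * ?v) * g (- (rq
      * ?v)))))" for g :: "complex \<Rightarrow> complex"
  proof -
    have d: "{..<6} - {2} = {0, 1, 3, 4, 5 :: nat}" "{..<6} - {3} = {0, 1, 2, 4, 5 :: nat}" by auto
    from e show ?thesis
    proof
      assume "e = 1 \<and> i = 2"
      thus ?thesis by (simp add: d vs_eqs)
    next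
      assume "e = - 1 \<and> i = 3"
      thus ?thesis by (simp add: d vs_eqs)
    qed
  qed
  have vi: "vs i = ?v" using e by (auto simp: vs_eqs)
  have args: "q * ?v / As 0 = e * (rb * rc / ra)" "q * ?v / As 1 = e * q * (ra / (rb * rc))"
     "q * ?v / As 2 = e * q * (rb / (ra * rc))" "q * ?v / As 3 = e * q / z * (rc / (ra * rb))"
     "As 0 / ?v = q / (e * (rb * rc / ra))" "As 1 / ?v = e * (rb * rc / ra)" "As 2 / ?v = ?v" "As 3 / ?v = e * z * (ra * rb / rc)"
     "q * ?v / a = e * q * (rc / (ra * rb))" "q * ?v / (c / b) = e * q * (ra * rb / rc)" "q * ?v / - ?v = - q"
     "q * ?v / (rq * ?v) = rq" "q * ?v / - (rq * ?v) = - rq"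
     "a / ?v = e * (ra * rb / rc)" "c / b / ?v = e * (rc / (ra * rb))" "- ?v / ?v = - 1" "rq * ?v / ?v = rq" "- (rq
         * ?v) / ?v = - rq"
     "b * z / c * ?v = e * z * (ra * rb / rc)" "h / (e * z * (ra * rb / rc)) = e * h / z * (rc / (ra * rb))" "h * ?v = e * h * ?s"
    using root_nz nonzero e1 unfolding As_eqs by (simp_all add: expand)
  have S: "(\<Sum>k. q ^ k * (qpoch (e * (rb * rc / ra)) q k * qpoch (e * q * (ra / (rb * rc))) q k * qpoch (e * q
      * (rb / (ra * rc))) q k * qpoch (e * q / z * (rc / (ra * rb))) q k
        * qpoch ?v q k * qpoch (e * z * (ra * rb / rc)) q k * (inverse (qpoch (e * q * (rc / (ra * rb))) q k)
            * (inverse (qpoch (e * q * (ra * rb / rc)) q k)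
        * (inverse (qpoch (- q) q k) * (inverse (qpoch rq q k) * inverse (qpoch (- rq) q k))))) * inverse (qpoch q q k)))
     = qphi [?v, e * (rb * rc / ra), e * q * (ra / (rb * rc)), e * q * (rb / (ra * rc)), e * z * (ra * rb / rc), e
         * q / z * (rc / (ra * rb))]
            [- q, rq, - rq, e * q * (ra * rb / rc), e * q * (rc / (ra * rb))] q q"
    unfolding qphi_6_5 by (intro suminf_cong) (simp only: mult_ac)
  have alg: "A * B / (F * C) * Q * X / Z * (T1 * T2 * (A0 * A1 * P * P') * (inverse D0 * (inverse D1 * (inverse m
      * (inverse r1 * inverse r2)))) * inverse (Q * P * P') * S)
      = T1 * (T2 * (A1 * A0)) * (A * (B * X)) / (m * (r1 * (r2 * (Z * (C * (F * (D1 * D0))))))) * S"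
    if "Q \<noteq> 0" "P \<noteq> 0" "P' \<noteq> 0" for A B F C Q X Z T1 T2 A0 A1 P P' D0 D1 m r1 r2 S :: complex
    using that by (simp add: divide_inverse mult_ac) (auto simp: field_simps)
  have nzv: "qpoch_inf ?v q \<noteq> 0" "qpoch_inf (e * z * (ra * rb / rc)) q \<noteq> 0"
    using vs_qpow_nz[OF i, of 0] unfolding vi args(19)[symmetric] by (simp_all add: mult.commute)
  show ?thesis
    unfolding residue_v[OF i] vi prod[of "\<lambda>u. inverse (qpoch_inf (u / ?v) q)"] prod[of "\<lambda>u. inverse (qpoch (q * ?v / u) q k)" for k]
    unfolding args S V_def lam_eq lists qtheta_eq[of "e * (rb * rc / ra)"]
    by (rule alg[OF _ nzv]) (use inf_nz in simp)
qed

text \<open>The poles with v = rq s or v = - rq s. Now \<open>As 0 / v\<close> and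
  \<open>As 1 / v\<close> have product 1 instead of q, so no theta forms, and all four numerator
  factorials remain.\<close>

lemma W_residue:
  assumes e: "e = 1 \<and> i = 4 \<or> e = - 1 \<and> i = 5"
  shows "pre * R i = W e q z a b c h rq ra rb rc"
proof -
  let ?s = "ra * rc / rb"
  let ?v = "e * (rq * ra * rc / rb)"
  have i: "i < 6" using e by auto
  have e1: "e \<noteq> 0" "e * e = 1" "\<And>y. e * (e * y) = y" using e by auto
  have prod: "(\<Prod>i'\<in>{..<6} - {i}. g (vs i')) = g a * (g (c / b) * (g (- ?v) * (g (e * ?s) * g (- (e
      * ?s)))))" for g :: "complex \<Rightarrow> complex"
  proof -
    have d: "{..<6} - {4} = {0, 1, 2, 3, 5 :: nat}" "{..<6} - {5} = {0, 1, 2, 3, 4 :: nat}" by auto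
    from e show ?thesis
    proof
      assume "e = 1 \<and> i = 4"
      thus ?thesis by (simp add: d vs_eqs mult_ac)
    next
      assume "e = - 1 \<and> i = 5"
      thus ?thesis by (simp add: d vs_eqs mult_ac)
    qed
  qed
  have vi: "vs i = ?v" using e by (auto simp: vs_eqs)
  have args: "q * ?v / As 0 = e * (rq * rb * rc / ra)" "q * ?v / As 1 = e * (rq ^ 3 * ra / (rb * rc))"
     "q * ?v / As 2 = e * (rq ^ 3 * rb / (ra * rc))" "q * ?v / As 3 = e / z * (rq ^ 3 * rc / (ra * rb))"
     "As 0 / ?v = e * (rq * ra / (rb * rc))" "As 1 / ?v = e * (rb * rc / (rq * ra))" "As 2 / ?v = e * (ra
         * rc / (rq * rb))" "As 3 / ?v = e * z * (ra * rb / (rq * rc))"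
     "q * ?v / a = e * (rq ^ 3 * rc / (ra * rb))" "q * ?v / (c / b) = e * (rq ^ 3 * ra * rb / rc)" "q * ?v / - ?v = - q"
     "q * ?v / (e * ?s) = rq ^ 3" "q * ?v / - (e * ?s) = - (rq ^ 3)"
     "a / ?v = e * (ra * rb / (rq * rc))" "c / b / ?v = e * (rc / (rq * ra * rb))" "- ?v / ?v = - 1" "e * ?s / ?v
         = 1 / rq" "- (e * ?s) / ?v = - (1 / rq)"
     "b * z / c * ?v = e * z * (rq * ra * rb / rc)" "h / (e * z * (rq * ra * rb / rc)) = e * h / z * (rc / (rq * ra * rb))"
     "h * ?v = e * h * (rq * ra * rc / rb)"
    using root_nz nonzero e1 unfolding As_eqs by (simp_all add: expand)
  have S: "(\<Sum>k. q ^ k * (qpoch (e * (rq * rb * rc / ra)) q k * qpoch (e * (rq ^ 3 * ra / (rb * rc))) q k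
      * qpoch (e * (rq ^ 3 * rb / (ra * rc))) q k * qpoch (e / z * (rq ^ 3 * rc / (ra * rb))) q k
        * qpoch ?v q k * qpoch (e * z * (rq * ra * rb / rc)) q k * (inverse (qpoch (e * (rq ^ 3 * rc / (ra
            * rb))) q k) * (inverse (qpoch (e * (rq ^ 3 * ra * rb / rc)) q k)
        * (inverse (qpoch (- q) q k) * (inverse (qpoch (rq ^ 3) q k) * inverse (qpoch (- (rq ^ 3)) q k)))))
            * inverse (qpoch q q k)))
     = qphi [?v, e * (rq * rb * rc / ra), e * (rq ^ 3 * ra / (rb * rc)), e * (rq ^ 3 * rb / (ra * rc)), e * z * (rq
         * ra * rb / rc), e / z * (rq ^ 3 * rc / (ra * rb))]
            [- q, rq ^ 3, - (rq ^ 3), e * (rq ^ 3 * ra * rb / rc), e * (rq ^ 3 * rc / (ra * rb))] q q"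
    unfolding qphi_6_5 by (intro suminf_cong) (simp only: mult_ac)
  have alg: "A * B / (F * C) * Q * X / Z * (T1 * T2 * (A0 * A1 * A2 * A3) * (inverse D0 * (inverse D1 * (inverse m
      * (inverse r1 * inverse r2)))) * inverse (Q * P * P') * S)
      = T1 * T2 * (A * (B * (X * (A2 * (A1 * (A0 * A3)))))) / (m * (r1 * (r2 * (Z * (C * (F * (P * (D1 * (D0 * P'))))))))) * S"
    if "Q \<noteq> 0" for A B F C Q X Z T1 T2 A0 A1 A2 A3 P P' D0 D1 m r1 r2 S :: complex
    using that by (simp add: divide_inverse mult_ac)
  show ?thesis
    unfolding residue_v[OF i] vi prod[of "\<lambda>u. inverse (qpoch_inf (u / ?v) q)"] prod[of "\<lambda>u. inverse (qpoch (q * ?v / u) q k)" for k]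
    unfolding args S W_def lam_eq lists
    by (rule alg) (use inf_nz in simp)
qed

lemma products:
  "ra * rc / rb / (ra * rb / rc) * (b * z / c) = z"
  "ra * rc / rb * (ra * rb / rc) * (b * z / c) = a * b * z / c"
  unfolding monomials by simp_all

theorem generic_identity:
  assumes "qthetas [h, h * (c / (b * z))] q \<noteq> 0"
  shows "qphi [a, b] [c] q z * qphi [a, q * a / c] [q * a / b] q z =
    1 / qthetas [h, h * (c / (b * z))] q
    * (U1 q z a b c h rq ra rb rc + U2 q z a b c h rq ra rb rc
       + V 1 q z a b c h rq ra rb rc + V (- 1) q z a b c h rq ra rb rc
       + W 1 q z a b c h rq ra rb rc + W (- 1) q z a b c h rq ra rb rc)"
proof -
  have VW: "pre * R 2 = V 1 q z a b c h rq ra rb rc" "pre * R 3 = V (- 1) q z a b c h rq ra rb rc"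
    "pre * R 4 = W 1 q z a b c h rq ra rb rc" "pre * R 5 = W (- 1) q z a b c h rq ra rb rc"
    by (rule V_residue W_residue; simp)+
  have "qthetas [h, h * (c / (b * z))] q * (qphi [a, b] [c] q z * qphi [a, q * a / c] [q * a / b] q z)
      = pre * (\<Sum>i<6. R i)"
    using product_as_residues unfolding products monomials(10) f1_eq f2_eq by (simp add: qthetas_def)
  also have "\<dots> = pre * R 0 + pre * R 1 + pre * R 2 + pre * R 3 + pre * R 4 + pre * R 5"
    unfolding lessThan_6 by (simp add: distrib_left)
  also have "\<dots> = U1 q z a b c h rq ra rb rc + U2 q z a b c h rq ra rb rc
       + V 1 q z a b c h rq ra rb rc + V (- 1) q z a b c h rq ra rb rc
       + W 1 q z a b c h rq ra rb rc + W (- 1) q z a b c h rq ra rb rc"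
    unfolding U1_residue U2_residue VW ..
  finally show ?thesis using assms by (simp add: field_simps)
qed

end

context qbase
begin

section \<open>Passage to the limit\<close>

lemma admissible_den_iff: "admissible_den bs q \<longleftrightarrow> (\<forall>b\<in>set bs. \<forall>n. b * q ^ n \<noteq> 1)"
proof -
  have "b \<noteq> q powi (- int k) \<longleftrightarrow> b * q ^ k \<noteq> 1" for b k
    using q_nz by (simp add: power_int_minus field_simps)
  thus ?thesis by (simp add: admissible_den_def)
qed

section \<open>Continuity of the series in their parameters\<close>

lemma qpoch_eventually_bounded:
  assumes "(f \<longlongrightarrow> L) F"
  shows "\<exists>C. eventually (\<lambda>t. \<forall>k. norm (qpoch (f t) q k) \<le> C) F"
proof -
  have "((\<lambda>t. norm (f t)) \<longlongrightarrow> norm L) F" by (intro tendsto_norm assms)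
  hence "eventually (\<lambda>t. norm (f t) < norm L + 1) F" by (rule order_tendstoD) simp
  hence "eventually (\<lambda>t. \<forall>k. norm (qpoch (f t) q k) \<le> exp ((norm L + 1) / (1 - norm q))) F"
    by eventually_elim (auto intro: norm_qpoch_le')
  thus ?thesis by blast
qed

text \<open>The reciprocal is (f q^k; q)_inf / (f; q)_inf, and near the limit the denominator
  exceeds half the norm of its limit. The bound is therefore uniform in k.\<close>

lemma inverse_qpoch_eventually_bounded:
  assumes f: "(f \<longlongrightarrow> L) F" and L: "\<And>n. L * q ^ n \<noteq> 1"
  shows "\<exists>C. eventually (\<lambda>t. \<forall>k. norm (inverse (qpoch (f t) q k)) \<le> C) F"
proof -
  define m where "m = norm (qpoch_inf L q)"
  define E where "E = exp ((norm L + 1) / (1 - norm q))"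
  have m: "m > 0" using qpoch_inf_nonzero[OF L] by (simp add: m_def)
  have "((\<lambda>t. norm (f t)) \<longlongrightarrow> norm L) F" by (intro tendsto_norm f)
  hence 1: "eventually (\<lambda>t. norm (f t) < norm L + 1) F" by (rule order_tendstoD) simp
  have "((\<lambda>t. norm (qpoch_inf (f t) q)) \<longlongrightarrow> m) F" unfolding m_def
      by (intro tendsto_norm tendsto_qpoch_inf f)
  hence 2: "eventually (\<lambda>t. m / 2 < norm (qpoch_inf (f t) q)) F" by (rule order_tendstoD) (use m in simp)
  from 1 2 have "eventually (\<lambda>t. \<forall>k. norm (inverse (qpoch (f t) q k)) \<le> E / (m / 2)) F"
  proof eventually_elim
    case (elim t)
    show ?case
    proof
      fix k
      have nz: "qpoch_inf (f t) q \<noteq> 0" using elim m by auto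
      have s: "qpoch_inf (f t) q = qpoch (f t) q k * qpoch_inf (f t * q ^ k) q" by (rule qpoch_inf_split)
      hence "inverse (qpoch (f t) q k) = qpoch_inf (f t * q ^ k) q / qpoch_inf (f t) q"
        using nz by (auto simp: field_simps)
      also have "norm \<dots> \<le> E / (m / 2)"
        unfolding norm_divide E_def using elim m
        by (intro frac_le norm_qpoch_inf_le' norm_mult_q_power_le) auto
      finally show "norm (inverse (qpoch (f t) q k)) \<le> E / (m / 2)" .
    qed
  qed
  thus ?thesis by blast
qed

lemma qpochs_tendsto:
  "list_all2 (\<lambda>f L. (f \<longlongrightarrow> L) F) fs as
      \<Longrightarrow> ((\<lambda>t. qpochs (map (\<lambda>f. f t) fs) q k) \<longlongrightarrow> qpochs as q k) F"
  by (induction rule: list_all2_induct) (auto simp: qpochs_def intro!: tendsto_intros)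

lemma qpochs_eventually_bounded:
  "list_all2 (\<lambda>f L. (f \<longlongrightarrow> L) F) fs as \<Longrightarrow>
     \<exists>C. eventually (\<lambda>t. \<forall>k. norm (qpochs (map (\<lambda>f. f t) fs) q k) \<le> C) F"
proof (induction rule: list_all2_induct)
  case Nil
  show ?case by (intro exI[of _ 1]) (simp add: qpochs_def)
next
  case (Cons f fs L as)
  from Cons obtain C where C: "eventually (\<lambda>t. \<forall>k. norm (qpochs (map (\<lambda>f. f t) fs) q k)
      \<le> C) F" by blast
  from qpoch_eventually_bounded[OF Cons(1)] obtain D where D: "eventually (\<lambda>t. \<forall>k. norm (qpoch (f t) q k) \<le> D) F" by blast
  from C D have "eventually (\<lambda>t. \<forall>k. norm (qpochs (map (\<lambda>f. f t) (f # fs)) q k) \<le> D * C) F"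
  proof eventually_elim
    case (elim t)
    have "0 \<le> D" using elim(2) norm_ge_zero order_trans by blast
    thus ?case using elim by (auto simp: qpochs_def norm_mult intro!: mult_mono)
  qed
  thus ?case by blast
qed

lemma inverse_qpochs_eventually_bounded:
  "list_all2 (\<lambda>f L. (f \<longlongrightarrow> L) F \<and> (\<forall>n. L * q ^ n \<noteq> 1)) fs as \<Longrightarrow>
     \<exists>C. eventually (\<lambda>t. \<forall>k. norm (inverse (qpochs (map (\<lambda>f. f t) fs) q k)) \<le> C) F"
proof (induction rule: list_all2_induct)
  case Nil
  show ?case by (intro exI[of _ 1]) (simp add: qpochs_def)
next
  case (Cons f fs L as)
  from Cons obtain C where C: "eventually (\<lambda>t. \<forall>k. norm (inverse (qpochs (map (\<lambda>f. f t) fs) q k)) \<le> C) F" by blast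
  from inverse_qpoch_eventually_bounded[of f L F] Cons(1) obtain D where D: "eventually (\<lambda>t. \<forall>k. norm (inverse (qpoch (f t) q k)) \<le> D) F" by blast
  from C D have "eventually (\<lambda>t. \<forall>k. norm (inverse (qpochs (map (\<lambda>f. f t) (f # fs)) q k)) \<le> D * C) F"
  proof eventually_elim
    case (elim t)
    have "0 \<le> D" using elim(2) norm_ge_zero order_trans by blast
    thus ?case using elim by (auto simp: qpochs_def norm_mult inverse_mult_distrib norm_inverse intro!: mult_mono simp del: norm_inverse)
  qed
  thus ?case by blast
qed

lemma qpochs_nonzero: "(\<And>b n. b \<in> set bs \<Longrightarrow> b * q ^ n \<noteq> 1)
    \<Longrightarrow> qpochs bs q k \<noteq> 0"
  by (induction bs) (auto simp: qpochs_def intro!: qpoch_nonzero)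

text \<open>Tannery's theorem with the majorant C D |u|^k. Lists of functions as parameters cover
  the 2phi1 and the 6phi5 at once.\<close>

lemma tendsto_qphi:
  fixes F :: "'t filter"
  assumes F: "F \<noteq> bot"
    and fs: "list_all2 (\<lambda>f L. (f \<longlongrightarrow> L) F) fs as"
        and gs: "list_all2 (\<lambda>f L. (f \<longlongrightarrow> L) F) gs bs"
    and bs: "\<And>b n. b \<in> set bs \<Longrightarrow> b * q ^ n \<noteq> 1" and u: "norm u < 1"
  shows "((\<lambda>t. qphi (map (\<lambda>f. f t) fs) (map (\<lambda>f. f t) gs) q u) \<longlongrightarrow> qphi as bs q u) F"
proof -
  \<comment> \<open>The constant function q stands for the factor (q; q)_k, so that it is handled
    like the other lower parameters.\<close>
  let ?n = "\<lambda>t k. qpochs (map (\<lambda>f. f t) fs) q k" and ?d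
      = "\<lambda>t k. qpochs (map (\<lambda>f. f t) ((\<lambda>_. q) # gs)) q k"
  have gs': "list_all2 (\<lambda>f L. (f \<longlongrightarrow> L) F) ((\<lambda>_. q) # gs) (q # bs)" using gs by simp
  have bs': "b * q ^ n \<noteq> 1" if "b \<in> set (q # bs)" for b n using that bs q_mult_power_neq_1 by auto
  have gs'': "list_all2 (\<lambda>f L. (f \<longlongrightarrow> L) F \<and> (\<forall>n. L
      * q ^ n \<noteq> 1)) ((\<lambda>_. q) # gs) (q # bs)"
    using gs' bs' unfolding list_all2_conv_all_nth by (metis nth_mem)
  obtain C where C: "eventually (\<lambda>t. \<forall>k. norm (?n t k) \<le> C) F" using qpochs_eventually_bounded[OF fs] by blast
  obtain D where D: "eventually (\<lambda>t. \<forall>k. norm (inverse (?d t k)) \<le> D) F"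
      using inverse_qpochs_eventually_bounded[OF gs''] by blast
  have "((\<lambda>t. suminf (\<lambda>k. ?n t k / ?d t k
      * u ^ k)) \<longlongrightarrow> (\<Sum>k. qpochs as q k / qpochs (q # bs) q k * u ^ k)) F"
  proof (rule tannerys_theorem[THEN conjunct2, THEN conjunct2])
    show "((\<lambda>t. ?n t k / ?d t k * u ^ k) \<longlongrightarrow> qpochs as q k / qpochs (q # bs) q k * u ^ k) F" for k
      by (intro tendsto_intros qpochs_tendsto fs gs' qpochs_nonzero bs')
    have "eventually (\<lambda>t. \<forall>k. norm (?n t k / ?d t k * u ^ k) \<le> C * D * norm u ^ k) F"
      using C D
    proof eventually_elim
      case (elim t)
      have "0 \<le> C" using elim(1) norm_ge_zero order_trans by blast
      thus ?case using elim
        by (auto simp: divide_inverse norm_mult norm_power simp del: norm_inverse intro!: mult_right_mono mult_mono)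
    qed
    hence "\<forall>\<^sub>F x in sequentially \<times>\<^sub>F F. True \<and> (\<forall>k. norm (?n (snd x) k / ?d (snd x) k * u ^ k) \<le> C * D * norm u ^ k)"
      by (intro eventually_prodI) auto
    thus "\<forall>\<^sub>F (k, t) in sequentially \<times>\<^sub>F F. norm (?n t k / ?d t k * u ^ k) \<le> C * D * norm u ^ k"
      by eventually_elim auto
    show "summable (\<lambda>k. C * D * norm u ^ k)" using u by (intro summable_mult) simp
  qed (rule F)
  thus ?thesis by (simp add: qphi_def)
qed

lemma tendsto_qphi_2_1:
  assumes "F \<noteq> bot" "(f1 \<longlongrightarrow> a1) F" "(f2 \<longlongrightarrow> a2) F" "(g1 \<longlongrightarrow> b1) F"
    "admissible_den [b1] q" "norm u < 1"
  shows "((\<lambda>t. qphi [f1 t, f2 t] [g1 t] q u) \<longlongrightarrow> qphi [a1, a2] [b1] q u) F"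
  using tendsto_qphi[of F "[f1, f2]" "[a1, a2]" "[g1]" "[b1]" u] assms by (simp add: admissible_den_iff)

lemma tendsto_qphi_6_5:
  assumes "F \<noteq> bot" "(f1 \<longlongrightarrow> a1) F" "(f2 \<longlongrightarrow> a2) F"
      "(f3 \<longlongrightarrow> a3) F" "(f4 \<longlongrightarrow> a4) F" "(f5 \<longlongrightarrow> a5) F"
      "(f6 \<longlongrightarrow> a6) F"
    "(g1 \<longlongrightarrow> b1) F" "(g2 \<longlongrightarrow> b2) F" "(g3 \<longlongrightarrow> b3) F"
        "(g4 \<longlongrightarrow> b4) F" "(g5 \<longlongrightarrow> b5) F"
    "admissible_den [b1, b2, b3, b4, b5] q"
  shows "((\<lambda>t. qphi [f1 t, f2 t, f3 t, f4 t, f5 t, f6 t] [g1 t, g2 t, g3 t, g4 t, g5 t] q q)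
           \<longlongrightarrow> qphi [a1, a2, a3, a4, a5, a6] [b1, b2, b3, b4, b5] q q) F"
proof -
  have "list_all2 (\<lambda>f L. (f \<longlongrightarrow> L) F) [f1, f2, f3, f4, f5, f6] [a1, a2, a3, a4, a5, a6]"
    "list_all2 (\<lambda>f L. (f \<longlongrightarrow> L) F) [g1, g2, g3, g4, g5] [b1, b2, b3, b4, b5]"
    using assms by simp_all
  moreover have "b * q ^ n \<noteq> 1" if "b \<in> set [b1, b2, b3, b4, b5]" for b n
    using assms(13) that unfolding admissible_den_iff by blast
  ultimately have "((\<lambda>t. qphi (map (\<lambda>f. f t) [f1, f2, f3, f4, f5, f6]) (map (\<lambda>f. f t) [g1,
      g2, g3, g4, g5]) q q)
     \<longlongrightarrow> qphi [a1, a2, a3, a4, a5, a6] [b1, b2, b3, b4, b5] q q) F"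
    using norm_q by (intro tendsto_qphi assms(1))
  thus ?thesis by simp
qed

context
  fixes F :: "'t filter" and aF cF raF rcF :: "'t \<Rightarrow> complex" and z a b c h rq ra rb rc :: complex
  assumes F: "F \<noteq> bot"
    and lim: "(aF \<longlongrightarrow> a) F" "(cF \<longlongrightarrow> c) F" "(raF \<longlongrightarrow> ra) F"
        "(rcF \<longlongrightarrow> rc) F"
    and nz: "z \<noteq> 0" "a \<noteq> 0" "b \<noteq> 0" "c \<noteq> 0" "h \<noteq> 0" "rq \<noteq> 0"
        "ra \<noteq> 0" "rb \<noteq> 0" "rc \<noteq> 0"
begin

lemma tendsto_U1:
  assumes den: "qpochs_inf [c, c / (a * b), c / (a * b), q * a / b] q \<noteq> 0"
    and par: "admissible_den
      [q * a * b / c, rq * ra * rb / rc, - (rq * ra * rb / rc),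
       q * (ra * rb / rc), - (q * (ra * rb / rc))] q"
  shows "((\<lambda>t. U1 q z (aF t) b (cF t) h rq (raF t) rb (rcF t)) \<longlongrightarrow> U1 q z a b c h rq ra rb rc) F"
  unfolding U1_def
  by (rule tendsto_mult[OF tendsto_divide[OF _ _ den] tendsto_qphi_6_5[OF F _ _ _ _ _ _ _ _ _ _ _ par]];
      (unfold qthetas_Nil_Cons qpochs_inf_Nil_Cons)?; (intro tendsto_intros lim)?; (simp add: nz q_nz; fail)?)

lemma tendsto_U2:
  assumes den: "qpochs_inf [z, z, c, q * a / b, a * b / c, a * b / c] q \<noteq> 0"
    and par: "admissible_den
      [q * c / (a * b), rq * rc / (ra * rb), - (rq * rc / (ra * rb)),
       q * (rc / (ra * rb)), - (q * (rc / (ra * rb)))] q"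
  shows "((\<lambda>t. U2 q z (aF t) b (cF t) h rq (raF t) rb (rcF t)) \<longlongrightarrow> U2 q z a b c h rq ra rb rc) F"
  unfolding U2_def
  by (rule tendsto_mult[OF tendsto_divide[OF _ _ den] tendsto_qphi_6_5[OF F _ _ _ _ _ _ _ _ _ _ _ par]];
      (unfold qthetas_Nil_Cons qpochs_inf_Nil_Cons)?; (intro tendsto_intros lim)?; (simp add: nz q_nz; fail)?)

lemma tendsto_V:
  assumes eps: "\<epsilon> \<noteq> 0"
    and den: "qpochs_inf [-1, rq, - rq, z, c, q * a / b,
                  \<epsilon> * (rc / (ra * rb)), \<epsilon> * (ra * rb / rc)] q \<noteq> 0"
    and par: "admissible_den
      [- q, rq, - rq, \<epsilon> * q * (ra * rb / rc), \<epsilon> * q * (rc / (ra * rb))] q"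
  shows "((\<lambda>t. V \<epsilon> q z (aF t) b (cF t) h rq (raF t) rb (rcF t)) \<longlongrightarrow> V \<epsilon> q z a b c h rq ra rb rc) F"
  unfolding V_def
  by (rule tendsto_mult[OF tendsto_divide[OF _ _ den] tendsto_qphi_6_5[OF F _ _ _ _ _ _ _ _ _ _ _ par]];
      (unfold qthetas_Nil_Cons qpochs_inf_Nil_Cons)?; (intro tendsto_intros lim)?; (simp add: nz q_nz eps; fail)?)

lemma tendsto_W:
  assumes eps: "\<epsilon> \<noteq> 0"
    and den: "qpochs_inf [-1, 1 / rq, - (1 / rq), z, c, q * a / b,
                  \<epsilon> * (rq * ra * rc / rb), \<epsilon> * (rc / (rq * ra * rb)),
                  \<epsilon> * (ra * rb / (rq * rc)), \<epsilon> * z * (rq * ra * rb / rc)] q \<noteq> 0"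
    and par: "admissible_den
      [- q, rq ^ 3, - (rq ^ 3),
       \<epsilon> * (rq ^ 3 * ra * rb / rc), \<epsilon> * (rq ^ 3 * rc / (ra * rb))] q"
  shows "((\<lambda>t. W \<epsilon> q z (aF t) b (cF t) h rq (raF t) rb (rcF t)) \<longlongrightarrow> W \<epsilon> q z a b c h rq ra rb rc) F"
  unfolding W_def
  by (rule tendsto_mult[OF tendsto_divide[OF _ _ den] tendsto_qphi_6_5[OF F _ _ _ _ _ _ _ _ _ _ _ par]];
      (unfold qthetas_Nil_Cons qpochs_inf_Nil_Cons)?; (intro tendsto_intros lim)?; (simp add: nz q_nz eps; fail)?)

end

end

text \<open>Each excluded equation y t^n = p^k has at most one positive solution t. The solutions
  form a countable set, whereas every interval to the right of 1 is uncountable.\<close>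

lemma generic_scaling_dense:
  fixes p :: real and Y :: "(real \<times> nat) set"
  assumes "finite Y" and Y: "\<And>y n. (y, n) \<in> Y \<Longrightarrow> y \<noteq> 0 \<and> n > 0"
  shows "(1::real) islimpt {t. 0 < t \<and> (\<forall>(y, n)\<in>Y. \<forall>k::int. y * t ^ n \<noteq> p powi k)}"
proof -
  define Bad where "Bad = (\<Union>(y, n)\<in>Y. range (\<lambda>k::int. root n (p powi k / y)))"
  have "countable Bad" unfolding Bad_def
    by (rule countable_UN[OF countable_finite[OF assms(1)]]) (auto split: prod.splits)
  have good: "0 < t \<Longrightarrow> t \<notin> Bad \<Longrightarrow> t \<in> {t. 0 < t \<and> (\<forall>(y,
      n)\<in>Y. \<forall>k::int. y * t ^ n \<noteq> p powi k)}" for t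
  proof (clarsimp)
    fix y n k assume t: "0 < t" "t \<notin> Bad" and yn: "(y, n) \<in> Y" and eq: "y * t ^ n = p powi k"
    have "t ^ n = p powi k / y" using Y[OF yn] eq by (simp add: field_simps)
    hence "t = root n (p powi k / y)" using Y[OF yn] t by (metis less_imp_le real_root_power_cancel)
    thus False using t yn unfolding Bad_def by auto
  qed
  show ?thesis
    unfolding islimpt_approachable
  proof (intro allI impI)
    fix e :: real assume "e > 0"
    hence "uncountable {1<..<1 + e}" by (simp add: uncountable_open_interval)
    hence "uncountable ({1<..<1 + e} - Bad)" using \<open>countable Bad\<close> by (rule uncountable_minus_countable)
    then obtain t where "t \<in> {1<..<1 + e} - Bad" by (metis countable_empty equals0I)
    thus "\<exists>x'\<in>{t. 0 < t \<and> (\<forall>(y, n)\<in>Y. \<forall>k::int. y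
        * t ^ n \<noteq> p powi k)}. x' \<noteq> 1 \<and> dist x' 1 < e"
      using good[of t] by (intro bexI[of _ t]) (auto simp: dist_real_def)
  qed
qed

theorem theorem8p2:
  fixes q z a b c h rq ra rb rc :: complex
  assumes nonzero: "q \<noteq> 0" "z \<noteq> 0" "a \<noteq> 0" "b \<noteq> 0" "c \<noteq> 0" "h \<noteq> 0"
    and norms: "norm q < 1" "norm z < 1"
    and roots: "rq ^ 2 = q" "ra ^ 2 = a" "rb ^ 2 = b" "rc ^ 2 = c"
    and h: "\<And>k::int. h \<noteq> q powi k" "\<And>k::int. h * (c / (b * z)) \<noteq> q powi k"
    and den_theta: "qthetas [h, h * (c / (b * z))] q \<noteq> 0"
    and den_U1: "qpochs_inf [c, c / (a * b), c / (a * b), q * a / b] q \<noteq> 0"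
    and den_U2: "qpochs_inf [z, z, c, q * a / b, a * b / c, a * b / c] q \<noteq> 0"
    and den_V: "\<And>\<epsilon>. \<epsilon> \<in> {1, -1} \<Longrightarrow>
      qpochs_inf [-1, rq, - rq, z, c, q * a / b,
                  \<epsilon> * (rc / (ra * rb)), \<epsilon> * (ra * rb / rc)] q \<noteq> 0"
    and den_W: "\<And>\<epsilon>. \<epsilon> \<in> {1, -1} \<Longrightarrow>
      qpochs_inf [-1, 1 / rq, - (1 / rq), z, c, q * a / b,
                  \<epsilon> * (rq * ra * rc / rb), \<epsilon> * (rc / (rq * ra * rb)),
                  \<epsilon> * (ra * rb / (rq * rc)), \<epsilon> * z * (rq * ra * rb / rc)] q \<noteq> 0"
    and par_lhs: "admissible_den [c] q" "admissible_den [q * a / b] q"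
    and par_U1: "admissible_den
      [q * a * b / c, rq * ra * rb / rc, - (rq * ra * rb / rc),
       q * (ra * rb / rc), - (q * (ra * rb / rc))] q"
    and par_U2: "admissible_den
      [q * c / (a * b), rq * rc / (ra * rb), - (rq * rc / (ra * rb)),
       q * (rc / (ra * rb)), - (q * (rc / (ra * rb)))] q"
    and par_V: "\<And>\<epsilon>. \<epsilon> \<in> {1, -1} \<Longrightarrow> admissible_den
      [- q, rq, - rq, \<epsilon> * q * (ra * rb / rc), \<epsilon> * q * (rc / (ra * rb))] q"
    and par_W: "\<And>\<epsilon>. \<epsilon> \<in> {1, -1} \<Longrightarrow> admissible_den
      [- q, rq ^ 3, - (rq ^ 3),
       \<epsilon> * (rq ^ 3 * ra * rb / rc), \<epsilon> * (rq ^ 3 * rc / (ra * rb))] q"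
  shows "qphi [a, b] [c] q z * qphi [a, q * a / c] [q * a / b] q z =
    1 / qthetas [h, h * (c / (b * z))] q
    * (U1 q z a b c h rq ra rb rc + U2 q z a b c h rq ra rb rc
       + V 1 q z a b c h rq ra rb rc + V (-1) q z a b c h rq ra rb rc
       + W 1 q z a b c h rq ra rb rc + W (-1) q z a b c h rq ra rb rc)"
proof -
  interpret qbase q by unfold_locales (use nonzero norms in auto)
  \<comment> \<open>Replace ra by ra * t and rc by rc * t^3 for real t near 1.  The exponents 1 and 3 are chosen such that
    none of the monomials that have to be generic stays constant in t; Y lists their norms (inverted
    if the exponent of t is negative) together with the absolute value of the exponent.\<close>
  define p where "p = norm rq"
  define Y where "Y = {(inverse (norm (ra*rb/rc)), 2::nat), (inverse (norm (a*b/c)), 4), (norm (ra*rc/rb), 4),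
    (inverse (norm (ra*rb*z/rc)), 2), (norm a, 2), (norm (c/b), 6), (norm (a*c/b), 8), (inverse (norm (b*z/c)), 6),
    (inverse (norm (a*b*z/c)), 4), (norm c, 6), (norm (a/b), 2)}"
  define G where "G = {t. 0 < t \<and> (\<forall>(y, n)\<in>Y. \<forall>k::int. y * t ^ n \<noteq> p powi k)}"
  define F where "F = at (1::real) within G"
  have rnz: "rq \<noteq> 0" "ra \<noteq> 0" "rb \<noteq> 0" "rc \<noteq> 0" using roots nonzero by auto
  have "1 islimpt G" unfolding G_def
    by (rule generic_scaling_dense) (use nonzero rnz in \<open>auto simp: Y_def\<close>)
  hence F: "F \<noteq> bot" by (simp add: F_def trivial_limit_within)
  let ?a = "\<lambda>t. a * of_real t ^ 2" and ?c = "\<lambda>t. c * of_real t ^ 6"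
    and ?ra = "\<lambda>t. ra * of_real t" and ?rc = "\<lambda>t. rc * of_real t ^ 3"
  have t1: "((\<lambda>t. complex_of_real t) \<longlongrightarrow> 1) F"
    unfolding F_def using tendsto_of_real[OF tendsto_ident_at[of "1::real" G], where ?'a = complex] by simp
  have pow1: "((\<lambda>t. y * complex_of_real t ^ n) \<longlongrightarrow> y) F" for y n
    using tendsto_mult[OF tendsto_const[of y] tendsto_power[OF t1, of n]] by simp
  have lim: "(?a \<longlongrightarrow> a) F" "(?c \<longlongrightarrow> c) F" "(?ra \<longlongrightarrow> ra) F"
      "(?rc \<longlongrightarrow> rc) F"
    using pow1[of a 2] pow1[of c 6] pow1[of ra 1] pow1[of rc 3] by simp_all
  let ?T = "\<lambda>t. qthetas [h, h * (?c t / (b * z))] q"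
  let ?L = "\<lambda>t. qphi [?a t, b] [?c t] q z * qphi [?a t, q * ?a t / ?c t] [q * ?a t / b] q z"
  let ?S = "\<lambda>t. U1 q z (?a t) b (?c t) h rq (?ra t) rb (?rc t) + U2 q z (?a t) b (?c t) h rq (?ra t) rb (?rc t)
       + V 1 q z (?a t) b (?c t) h rq (?ra t) rb (?rc t) + V (-1) q z (?a t) b (?c t) h rq (?ra t) rb (?rc t)
       + W 1 q z (?a t) b (?c t) h rq (?ra t) rb (?rc t) + W (-1) q z (?a t) b (?c t) h rq (?ra t) rb (?rc t)"
  have T: "(?T \<longlongrightarrow> qthetas [h, h * (c / (b * z))] q) F"
    unfolding qthetas_Nil_Cons by (intro tendsto_intros lim) (use nonzero in auto)
  have L: "(?L \<longlongrightarrow> qphi [a, b] [c] q z * qphi [a, q * a / c] [q * a / b] q z) F"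
    by (intro tendsto_intros tendsto_qphi_2_1 lim F par_lhs norms) (use nonzero in auto)
  have S: "(?S \<longlongrightarrow> U1 q z a b c h rq ra rb rc + U2 q z a b c h rq ra rb rc
       + V 1 q z a b c h rq ra rb rc + V (-1) q z a b c h rq ra rb rc
       + W 1 q z a b c h rq ra rb rc + W (-1) q z a b c h rq ra rb rc) F"
    by (intro tendsto_add tendsto_U1 tendsto_U2 tendsto_V tendsto_W F lim den_U1 den_U2 den_V den_W
        par_U1 par_U2 par_V par_W nonzero rnz) auto
  \<comment> \<open>The scaled roots are square roots of the scaled a and c, so the generic theorem
    applies to them directly.\<close>
  have generic: "?L t = 1 / ?T t * ?S t" if t: "t \<in> G" and T0: "?T t \<noteq> 0" for t
  proof -
    have t0: "t > 0" using t by (simp add: G_def)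
    have up: "norm (y * of_real t ^ n) \<noteq> p powi k" if "(norm y, n) \<in> Y" for y :: complex and n k
      using t that t0 by (auto simp: G_def norm_mult norm_power)
    \<comment> \<open>For monomials with a negative power of t the equation is inverted; integral
      powers of \<open>p\<close> stay integral powers.\<close>
    have down: "norm (y / of_real t ^ n) \<noteq> p powi k" if "(inverse (norm y), n) \<in> Y" for y :: complex and n k
    proof
      assume "norm (y / of_real t ^ n) = p powi k"
      hence "inverse (norm y / t ^ n) = inverse (p powi k)" using t0 by (simp add: norm_divide norm_power)
      hence "inverse (norm y) * t ^ n = p powi (- k)" by (simp add: power_int_minus divide_inverse mult.commute)
      thus False using t that by (auto simp: G_def)
    qed
    have "qparams q z (?a t) b (?c t) h rq (?ra t) rb (?rc t)"
    proof
      fix y k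
      assume y: "y \<in> {?ra t * rb / ?rc t, ?a t * b / ?c t, ?ra t * ?rc t / rb, ?ra t * rb * z / ?rc t, ?a t, ?c t / b,
        ?a t * ?c t / b, b * z / ?c t, ?a t * b * z / ?c t, ?c t, ?a t / b}"
      have "{?ra t * rb / ?rc t, ?a t * b / ?c t, ?ra t * ?rc t / rb, ?ra t * rb * z / ?rc t, ?a t, ?c t / b,
        ?a t * ?c t / b, b * z / ?c t, ?a t * b * z / ?c t, ?c t, ?a t / b} =
        {ra*rb/rc / of_real t ^ 2, a*b/c / of_real t ^ 4, ra*rc/rb * of_real t ^ 4, ra*rb*z/rc / of_real t ^ 2,
         a * of_real t ^ 2, c/b * of_real t ^ 6, a*c/b * of_real t ^ 8, b*z/c / of_real t ^ 6,
         a*b*z/c / of_real t ^ 4, c * of_real t ^ 6, a/b * of_real t ^ 2}"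
        using t0 nonzero rnz by (intro arg_cong2[of _ _ _ _ insert] refl) (simp_all add: field_simps eval_nat_numeral)
      with y have "y \<in> {ra*rb/rc / of_real t ^ 2, a*b/c / of_real t ^ 4, ra*rc/rb * of_real t ^ 4, ra*rb*z/rc / of_real t ^ 2,
         a * of_real t ^ 2, c/b * of_real t ^ 6, a*c/b * of_real t ^ 8, b*z/c / of_real t ^ 6,
         a*b*z/c / of_real t ^ 4, c * of_real t ^ 6, a/b * of_real t ^ 2}" by simp
      thus "norm y \<noteq> norm rq powi k"
        unfolding p_def[symmetric] by (elim insertE emptyE; hypsubst; intro up down; simp add: Y_def)
    qed (use nonzero norms roots t0 in \<open>auto simp: power_mult_distrib power_mult[symmetric]\<close>)
    thus ?thesis by (rule qparams.generic_identity) (use T0 in simp)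
  qed
  have "eventually (\<lambda>t. t \<in> G) F" by (simp add: F_def eventually_at_topological) blast
  moreover have "eventually (\<lambda>t. ?T t \<noteq> 0) F" using tendsto_imp_eventually_ne[OF T den_theta] .
  ultimately have "eventually (\<lambda>t. 1 / ?T t * ?S t = ?L t) F"
    by eventually_elim (simp only: generic not_False_eq_True)
  hence "(?L \<longlongrightarrow> 1 / qthetas [h, h * (c / (b * z))] q
    * (U1 q z a b c h rq ra rb rc + U2 q z a b c h rq ra rb rc
       + V 1 q z a b c h rq ra rb rc + V (-1) q z a b c h rq ra rb rc
       + W 1 q z a b c h rq ra rb rc + W (-1) q z a b c h rq ra rb rc)) F"
    by (rule Lim_transform_eventually[rotated]) (intro tendsto_mult tendsto_divide tendsto_const T S den_theta)
  \<comment> \<open>Limits along \<open>F\<close> are unique because 1 is a limit point of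
    \<open>G\<close>.\<close>
  with L show ?thesis by (rule tendsto_unique[OF F])
qed

end
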